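(* The following two families of Lorentzian surfaces in the Minkowski space $\mathbb{E}^4_1$ are Lorentzian minimal surfaces with pointwise 1-type Gauss map of the first kind: (i) minimal Lorentzian surfaces lying in a Lorentzian hyperplane of $\mathbb{E}^4_1$; (ii) Lorentzian surfaces with degenerated relative null bundle. Conversely, every Lorentzian minimal surface in $\mathbb{E}^4_1$ with pointwise 1-type Gauss map of the first kind is congruent to an open portion of a surface of type (i) or (ii).
   Context: $\mathbb{E}^4_1$ is Minkowski space-time: $\mathbb{R}^4$ with the metric $\langle\cdot,\cdot\rangle$ of signature $(-,+,+,+)$. All surfaces are smooth and connected. A surface $M\subset\mathbb{E}^4_1$ (or a hyperplane) is Lorentzian if its induced metric is non-degenerate of index 1. Let $\nabla$ be the Levi-Civita connection of $M$ and $h$ its second fundamental form in $\mathbb{E}^4_1$. Let $\{f_1,f_2\}$ be a local pseudo-orthonormal frame of the tangent bundle: $\langle f_1,f_1\rangle=\langle f_2,f_2\rangle=0$, $\langle f_1,f_2\rangle=-1$, compatible with a fixed orientation of $M$. The mean curvature vector is $H=-h(f_1,f_2)$, and $M$ is minimal if $H=0$. The Laplace operator of $M$ is $\Delta=f_1f_2+f_2f_1-\nabla_{f_1}f_2-\nabla_{f_2}f_1$, applied componentwise to vector-valued maps. The Gauss map of $M$ is $\nu=f_1\wedge f_2:M\to\Lambda^2\mathbb{E}^4_1\cong\mathbb{E}^6_3$. $M$ has pointwise 1-type Gauss map if $\Delta\nu=f(\nu+C)$ for some smooth function $f$ on $M$ and some constant vector $C\in\mathbb{E}^6_3$; it is of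 the first kind if this holds with $C=0$, i.e. $\Delta\nu=f\nu$ for some smooth function $f$. The relative null space at $p\in M$ is $\mathcal{N}_p(M)=\{X\in T_pM : h(X,Y)=0 \text{ for all } Y\in T_pM\}$; $M$ has degenerated relative null bundle if $(\mathcal{N}_p(M),\langle\cdot,\cdot\rangle)$ is a degenerate inner product space for all $p\in M$. Congruent means equal up to an isometry of the ambient space.
   Formalization: The converse is false as stated (type can change where the relative null space jumps): it is proved for all of M if the dimension of the relative null spaces is locally constant, and otherwise for each component of the open dense subset where it is. *)

theory Defs
  imports "HOL-Analysis.Analysis"
begin

section \<open>Linear algebra of Minkowski space-time\<close>

definition mink :: "real^4 \<Rightarrow> real^4 \<Rightarrow> real" where
  "mink u v = - (u$1 * v$1) + u$2 * v$2 + u$3 * v$3 + u$4 * v$4"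

text \<open>The inner product space \<open>(V, mink)\<close> is degenerate if it is not nondegenerate in the
  following sense; the zero space is nondegenerate.\<close>

definition nondegenerate :: "(real^4) set \<Rightarrow> bool" where
  "nondegenerate V \<longleftrightarrow> (\<forall>u\<in>V. (\<forall>v\<in>V. mink u v = 0) \<longrightarrow> u = 0)"

definition metric_index :: "(real^4) set \<Rightarrow> nat" where
  "metric_index V =
     Max (dim ` {W. subspace W \<and> W \<subseteq> V \<and> (\<forall>w\<in>W. w \<noteq> 0 \<longrightarrow> mink w w < 0)})"

definition lorentzian_space :: "(real^4) set \<Rightarrow> bool" where
  "lorentzian_space V \<longleftrightarrow> nondegenerate V \<and> metric_index V = 1"

definition lorentzian_hyperplane :: "(real^4) set \<Rightarrow> bool" where
  "lorentzian_hyperplane P \<longleftrightarrow>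
     affine P \<and> aff_dim P = 3 \<and> lorentzian_space {x - y | x y. x \<in> P \<and> y \<in> P}"

definition pseudo_orthonormal :: "real^4 \<Rightarrow> real^4 \<Rightarrow> bool" where
  "pseudo_orthonormal u v \<longleftrightarrow> mink u u = 0 \<and> mink v v = 0 \<and> mink u v = -1"

text \<open>Bivectors are represented by skew-symmetric 4 by 4 matrices, a 6-dimensional space.\<close>

definition bivectors :: "(real^4^4) set" where
  "bivectors = {A. transpose A = - A}"

definition wedge :: "real^4 \<Rightarrow> real^4 \<Rightarrow> real^4^4" where
  "wedge u v = (\<chi> i j. u$i * v$j - u$j * v$i)"

definition tangential_part :: "(real^4) set \<Rightarrow> real^4 \<Rightarrow> real^4" where
  "tangential_part V w = (THE t. t \<in> V \<and> (\<forall>v\<in>V. mink (w - t) v = 0))"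

definition normal_part :: "(real^4) set \<Rightarrow> real^4 \<Rightarrow> real^4" where
  "normal_part V w = w - tangential_part V w"

definition mink_isometry :: "(real^4 \<Rightarrow> real^4) \<Rightarrow> bool" where
  "mink_isometry \<phi> \<longleftrightarrow>
     (\<exists>L b. linear L \<and> (\<forall>u v. mink (L u) (L v) = mink u v) \<and> \<phi> = (\<lambda>x. L x + b))"


section \<open>Smooth surfaces\<close>

text \<open>\<open>Ck_on k S f\<close> is meant for open \<open>S\<close>.\<close>

primrec Ck_on :: "nat \<Rightarrow> 'a::euclidean_space set \<Rightarrow> ('a \<Rightarrow> 'b::euclidean_space) \<Rightarrow> bool" where
  "Ck_on 0 S f \<longleftrightarrow> continuous_on S f"
| "Ck_on (Suc k) S f \<longleftrightarrow>
     f differentiable_on S \<and> (\<forall>v. Ck_on k S (\<lambda>x. frechet_derivative f (at x) v))"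

definition smooth_on :: "'a::euclidean_space set \<Rightarrow> ('a \<Rightarrow> 'b::euclidean_space) \<Rightarrow> bool" where
  "smooth_on S f \<longleftrightarrow> (\<forall>k. Ck_on k S f)"

text \<open>\<open>patch M U x\<close>: \<open>x\<close> restricted to \<open>U\<close> is a local parametrization of \<open>M\<close>.\<close>

definition patch :: "(real^4) set \<Rightarrow> (real^2) set \<Rightarrow> (real^2 \<Rightarrow> real^4) \<Rightarrow> bool" where
  "patch M U x \<longleftrightarrow>
     open U \<and> smooth_on U x \<and> (\<forall>a\<in>U. inj (frechet_derivative x (at a))) \<and>
     openin (top_of_set M) (x ` U) \<and> (\<exists>y. homeomorphism U (x ` U) x y)"

definition surface :: "(real^4) set \<Rightarrow> bool" where
  "surface M \<longleftrightarrow> M \<noteq> {} \<and> connected M \<and> (\<forall>p\<in>M. \<exists>U x. patch M U x \<and> p \<in> x ` U)"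

definition tangent_space :: "(real^4) set \<Rightarrow> real^4 \<Rightarrow> (real^4) set" where
  "tangent_space M p =
     {X. \<exists>U x a. patch M U x \<and> a \<in> U \<and> x a = p \<and> X \<in> range (frechet_derivative x (at a))}"

definition coord_bivector :: "(real^2 \<Rightarrow> real^4) \<Rightarrow> real^2 \<Rightarrow> real^4^4" where
  "coord_bivector x a =
     wedge (frechet_derivative x (at a) (axis 1 1)) (frechet_derivative x (at a) (axis 2 1))"

text \<open>An orientation is an atlas whose coordinate changes have positive Jacobian determinant.
  For two patches through the same point, that determinant is the factor between the
  bivectors spanned by their coordinate fields.\<close>

definition orientation :: "(real^4) set \<Rightarrow> ((real^2) set \<times> (real^2 \<Rightarrow> real^4)) set \<Rightarrow> bool" where
  "orientation M \<A> \<longleftrightarrow>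
     (\<forall>(U, x)\<in>\<A>. patch M U x) \<and> M \<subseteq> (\<Union>(U, x)\<in>\<A>. x ` U) \<and>
     (\<forall>(U, x)\<in>\<A>. \<forall>(V, y)\<in>\<A>. \<forall>a\<in>U. \<forall>b\<in>V. x a = y b \<longrightarrow>
        (\<exists>c>0. coord_bivector x a = c *\<^sub>R coord_bivector y b))"

definition positively_oriented ::
    "((real^2) set \<times> (real^2 \<Rightarrow> real^4)) set \<Rightarrow> real^4 \<Rightarrow> real^4 \<Rightarrow> real^4 \<Rightarrow> bool" where
  "positively_oriented \<A> p u v \<longleftrightarrow>
     (\<exists>(U, x)\<in>\<A>. \<exists>a\<in>U. x a = p \<and> (\<exists>c>0. wedge u v = c *\<^sub>R coord_bivector x a))"

definition lorentzian_surface :: "(real^4) set \<Rightarrow> bool" where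
  "lorentzian_surface M \<longleftrightarrow> surface M \<and> (\<forall>p\<in>M. lorentzian_space (tangent_space M p))"

definition smooth_map :: "(real^4) set \<Rightarrow> (real^4 \<Rightarrow> 'b::euclidean_space) \<Rightarrow> bool" where
  "smooth_map M F \<longleftrightarrow> (\<forall>U x. patch M U x \<longrightarrow> smooth_on U (F \<circ> x))"

text \<open>The derivative of \<open>F\<close> at \<open>p\<close> in direction \<open>X\<close>. Derivatives within \<open>M\<close> are unique only on
  tangent vectors, so this is used for tangent \<open>X\<close> only. For a map \<open>F\<close> into \<open>real^4\<close> it is the
  covariant derivative of the ambient space.\<close>

definition dir_deriv ::
    "(real^4) set \<Rightarrow> (real^4 \<Rightarrow> 'b::euclidean_space) \<Rightarrow> real^4 \<Rightarrow> real^4 \<Rightarrow> 'b" where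
  "dir_deriv M F p X = frechet_derivative F (at p within M) X"

definition tangent_field :: "(real^4) set \<Rightarrow> (real^4) set \<Rightarrow> (real^4 \<Rightarrow> real^4) \<Rightarrow> bool" where
  "tangent_field M W Y \<longleftrightarrow> smooth_map W Y \<and> (\<forall>q\<in>W. Y q \<in> tangent_space M q)"


section \<open>Levi-Civita connection, second fundamental form, Laplacian\<close>

text \<open>By the Gauss formula, the Levi-Civita connection of \<open>M\<close> and its second fundamental form
  are the tangential and the normal part of the ambient covariant derivative.\<close>

definition levi_civita :: "(real^4) set \<Rightarrow> (real^4 \<Rightarrow> real^4) \<Rightarrow> real^4 \<Rightarrow> real^4 \<Rightarrow> real^4" where
  "levi_civita M Y p X = tangential_part (tangent_space M p) (dir_deriv M Y p X)"

text \<open>The value does not depend on the local extension \<open>Y\<close> of \<open>w\<close>.\<close>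

definition second_ff :: "(real^4) set \<Rightarrow> real^4 \<Rightarrow> real^4 \<Rightarrow> real^4 \<Rightarrow> real^4" where
  "second_ff M p X w =
     (THE n. \<exists>W Y. openin (top_of_set M) W \<and> p \<in> W \<and> tangent_field M W Y \<and> Y p = w \<and>
                   n = normal_part (tangent_space M p) (dir_deriv M Y p X))"

text \<open>The mean curvature vector and the Laplacian are symmetric in the two members of a
  pseudo-orthonormal pair, so the orientation plays no role in their definitions.\<close>

definition mean_curvature :: "(real^4) set \<Rightarrow> real^4 \<Rightarrow> real^4" where
  "mean_curvature M p =
     (THE H. \<exists>u\<in>tangent_space M p. \<exists>v\<in>tangent_space M p.
               pseudo_orthonormal u v \<and> H = - second_ff M p u v)"

definition minimal :: "(real^4) set \<Rightarrow> bool" where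
  "minimal M \<longleftrightarrow> (\<forall>p\<in>M. mean_curvature M p = 0)"

definition local_frame ::
    "(real^4) set \<Rightarrow> (real^4) set \<Rightarrow> (real^4 \<Rightarrow> real^4) \<Rightarrow> (real^4 \<Rightarrow> real^4) \<Rightarrow> bool" where
  "local_frame M W f1 f2 \<longleftrightarrow>
     openin (top_of_set M) W \<and> tangent_field M W f1 \<and> tangent_field M W f2 \<and>
     (\<forall>q\<in>W. pseudo_orthonormal (f1 q) (f2 q))"

definition laplacian :: "(real^4) set \<Rightarrow> (real^4 \<Rightarrow> 'b::euclidean_space) \<Rightarrow> real^4 \<Rightarrow> 'b" where
  "laplacian M F p =
     (THE l. \<exists>W f1 f2. local_frame M W f1 f2 \<and> p \<in> W \<and>
        l = dir_deriv M (\<lambda>q. dir_deriv M F q (f2 q)) p (f1 p)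
          + dir_deriv M (\<lambda>q. dir_deriv M F q (f1 q)) p (f2 p)
          - dir_deriv M F p (levi_civita M f2 p (f1 p))
          - dir_deriv M F p (levi_civita M f1 p (f2 p)))"


section \<open>Gauss map and relative null bundle\<close>

definition gauss_map ::
    "(real^4) set \<Rightarrow> ((real^2) set \<times> (real^2 \<Rightarrow> real^4)) set \<Rightarrow> real^4 \<Rightarrow> real^4^4" where
  "gauss_map M \<A> p =
     (THE n. \<exists>u\<in>tangent_space M p. \<exists>v\<in>tangent_space M p.
               pseudo_orthonormal u v \<and> positively_oriented \<A> p u v \<and> n = wedge u v)"

definition one_type_gauss_map_with ::
    "(real^4) set \<Rightarrow> ((real^2) set \<times> (real^2 \<Rightarrow> real^4)) set \<Rightarrow> real^4^4 \<Rightarrow> bool" where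
  "one_type_gauss_map_with M \<A> C \<longleftrightarrow>
     (\<exists>f::real^4 \<Rightarrow> real. smooth_map M f \<and>
        (\<forall>p\<in>M. laplacian M (gauss_map M \<A>) p = f p *\<^sub>R (gauss_map M \<A> p + C)))"

definition pointwise_one_type ::
    "(real^4) set \<Rightarrow> ((real^2) set \<times> (real^2 \<Rightarrow> real^4)) set \<Rightarrow> bool" where
  "pointwise_one_type M \<A> \<longleftrightarrow> (\<exists>C\<in>bivectors. one_type_gauss_map_with M \<A> C)"

definition first_kind ::
    "(real^4) set \<Rightarrow> ((real^2) set \<times> (real^2 \<Rightarrow> real^4)) set \<Rightarrow> bool" where
  "first_kind M \<A> \<longleftrightarrow> one_type_gauss_map_with M \<A> 0"

definition relative_null_space :: "(real^4) set \<Rightarrow> real^4 \<Rightarrow> (real^4) set" where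
  "relative_null_space M p =
     {X \<in> tangent_space M p. \<forall>Y\<in>tangent_space M p. second_ff M p X Y = 0}"

definition degenerated_relative_null_bundle :: "(real^4) set \<Rightarrow> bool" where
  "degenerated_relative_null_bundle M \<longleftrightarrow> (\<forall>p\<in>M. \<not> nondegenerate (relative_null_space M p))"

definition type_i :: "(real^4) set \<Rightarrow> bool" where
  "type_i M \<longleftrightarrow> lorentzian_surface M \<and> minimal M \<and> (\<exists>P. lorentzian_hyperplane P \<and> M \<subseteq> P)"

definition type_ii :: "(real^4) set \<Rightarrow> bool" where
  "type_ii M \<longleftrightarrow> lorentzian_surface M \<and> degenerated_relative_null_bundle M"

definition congruent_to_open_portion :: "(real^4) set \<Rightarrow> (real^4) set \<Rightarrow> bool" where
  "congruent_to_open_portion M S \<longleftrightarrow>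
     (\<exists>\<phi>. mink_isometry \<phi> \<and> openin (top_of_set S) (\<phi> ` M))"

text \<open>The relative null spaces form a vector bundle where their dimension is locally constant.
  Elsewhere the type may change: let \<open>a\<close> be a null curve with \<open>a'(u) = (sqrt (1 + u^4 + u^6), u^2,
  u^3, 1)\<close> and \<open>b = (1, 0, 0, -1)\<close>. Near \<open>u = v = 0\<close>, \<open>a(u) + v b\<close> is a minimal Lorentzian
  surface with pointwise 1-type Gauss map of the first kind, which lies in no hyperplane; its
  relative null spaces are degenerate for \<open>u \<noteq> 0\<close>, but equal to the tangent plane for \<open>u = 0\<close>.\<close>

definition nullity_regular :: "(real^4) set \<Rightarrow> (real^4) set" where
  "nullity_regular M =
     {p \<in> M. \<exists>W. openin (top_of_set M) W \<and> p \<in> W \<and>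
        (\<forall>q\<in>W. dim (relative_null_space M q) = dim (relative_null_space M p))}"

end

theory Submission
  imports Defs
begin

text \<open>
  Let \<open>F1\<close>, \<open>F2\<close> be a pseudo-orthonormal frame of a Lorentzian surface \<open>M\<close>, and let \<open>N11\<close>,
  \<open>N12\<close>, \<open>N22\<close> be the values of the second fundamental form on it. The mean curvature vector is
  \<open>- N12\<close>, so on a minimal surface the normal vectors \<open>N11\<close> and \<open>N22\<close> carry all of the second
  fundamental form. The Codazzi equation then makes the normal derivative of \<open>N11\<close> along \<open>F2\<close> a
  multiple of \<open>N11\<close>, and that of \<open>N22\<close> along \<open>F1\<close> a multiple of \<open>N22\<close>. With this, two
  differentiations of the Gauss map \<open>\<nu> = F1 \<and> F2\<close> give
  \<open>\<Delta> \<nu> = 2 \<langle>N11, N22\<rangle> \<nu> + 2 N11 \<and> N22\<close>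
  (\<open>laplacian_gauss_map\<close>). The first summand is a tangent bivector and the second a normal one.
  So the Gauss map is of the first kind exactly if \<open>N11 \<and> N22 = 0\<close> everywhere
  (\<open>first_kind_iff\<close>), a condition that does not depend on the frame.

  Both families satisfy it. In a Lorentzian hyperplane, \<open>N11\<close> and \<open>N22\<close> are orthogonal to the
  constant normal of the hyperplane, and the normal plane of \<open>M\<close> is positive definite, so they are
  collinear. A degenerate relative null space contains a null tangent vector, that is, a multiple
  of \<open>F1\<close> or \<open>F2\<close>; then \<open>N12 = 0\<close>, and \<open>N11 = 0\<close> or \<open>N22 = 0\<close>.

  Conversely, let \<open>N11\<close> and \<open>N22\<close> be collinear everywhere on a minimal surface. The relative null
  space is spanned by those \<open>Fi\<close> for which \<open>Nii = 0\<close>, so its dimension counts how many of \<open>N11\<close>,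
  \<open>N22\<close> vanish. This number is upper semicontinuous, hence locally constant on a dense open set,
  and each component of that set is open in \<open>M\<close>. If the number is 1, then the relative null spaces
  are null lines. If it is 0 or 2, then the span of \<open>F1\<close>, \<open>F2\<close>, \<open>N11\<close> is closed under
  differentiation: the Codazzi equation controls one derivative of each of \<open>N11\<close> and \<open>N22\<close>, and
  the two vectors are multiples of each other. By uniqueness for linear differential equations, a
  constant vector orthogonal to this span at one point stays orthogonal to it
  (\<open>constant_normal_propagates\<close>), so the component lies in a hyperplane.

  Derivatives along \<open>M\<close> are computed in coordinates: tangent frames are images of vector fields
  \<open>\<xi>1\<close>, \<open>\<xi>2\<close> on the coordinate domain, and the covariant derivative of the ambient space becomes
  \<open>ddir\<close> (\<open>dir_deriv_eq\<close>).
\<close>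

section \<open>Calculus of smooth maps\<close>

abbreviation "\<D> f a \<equiv> frechet_derivative f (at a)"

lemma Ck_on_cong:
  assumes "open S" "\<And>x. x \<in> S \<Longrightarrow> f x = g x" "Ck_on k S f"
  shows "Ck_on k S g"
  using assms(2,3)
proof (induction k arbitrary: f g)
  case 0
  then show ?case using continuous_on_cong[of S S f g] by simp
next
  case (Suc k)
  have d: "f differentiable at x" if "x \<in> S" for x
    using Suc.prems(2) that assms(1) by (simp add: differentiable_on_eq_differentiable_at)
  have e: "\<D> f x = \<D> g x" if "x \<in> S" for x
    by (rule frechet_derivative_transform_within_open[OF d[OF that] assms(1) that]) (rule Suc.prems(1))
  have "g differentiable_on S"
    using Suc.prems by (auto simp: differentiable_on_def intro: differentiable_transform_within[where d=1])
  moreover have "Ck_on k S (\<lambda>x. \<D> g x v)" for v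
    by (rule Suc.IH[of "\<lambda>x. \<D> f x v"]) (use e Suc.prems(2) in auto)
  ultimately show ?case by simp
qed

lemma Ck_on_subset:
  assumes "Ck_on k S f" "T \<subseteq> S"
  shows "Ck_on k T f"
  using assms(1)
proof (induction k arbitrary: f)
  case 0
  then show ?case using assms(2) continuous_on_subset by auto
next
  case (Suc k)
  then show ?case using assms(2) differentiable_on_subset by auto
qed

lemma Ck_on_local:
  assumes "open S" "\<And>a. a \<in> S \<Longrightarrow> \<exists>T. open T \<and> a \<in> T \<and> T \<subseteq> S \<and> Ck_on k T f"
  shows "Ck_on k S f"
  using assms(2)
proof (induction k arbitrary: f)
  case 0
  have "isCont f a" if a: "a \<in> S" for a
  proof -
    obtain T where "open T" "a \<in> T" "continuous_on T f"
      using 0[OF a] by auto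
    then show ?thesis by (simp add: continuous_on_eq_continuous_at)
  qed
  then show ?case by (simp add: continuous_at_imp_continuous_on)
next
  case (Suc k)
  have "f differentiable at a" if a: "a \<in> S" for a
  proof -
    obtain T where "open T" "a \<in> T" "f differentiable_on T"
      using Suc.prems[OF a] by auto
    then show ?thesis by (simp add: differentiable_on_eq_differentiable_at)
  qed
  then have "f differentiable_on S"
    by (simp add: assms(1) differentiable_on_eq_differentiable_at)
  moreover have "Ck_on k S (\<lambda>x. \<D> f x v)" for v
    by (rule Suc.IH) (use Suc.prems in fastforce)
  ultimately show ?case by simp
qed

lemma Ck_on_SucD: "Ck_on (Suc k) S f \<Longrightarrow> Ck_on k S f"
proof (induction k arbitrary: f)
  case 0
  then show ?case by (simp add: differentiable_imp_continuous_on)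
qed simp

lemma Ck_on_SucI:
  assumes "open S" "\<And>x. x \<in> S \<Longrightarrow> (f has_derivative f' x) (at x)"
    and "\<And>v. Ck_on k S (\<lambda>x. f' x v)"
  shows "Ck_on (Suc k) S f"
proof -
  have "f differentiable_on S"
    using assms(1,2) by (auto simp: differentiable_on_eq_differentiable_at differentiable_def)
  moreover have "Ck_on k S (\<lambda>x. \<D> f x v)" for v
    by (rule Ck_on_cong[OF assms(1) _ assms(3)[of v]]) (simp add: frechet_derivative_at[OF assms(2)])
  ultimately show ?thesis by simp
qed

lemma Ck_on_Suc_has_derivative:
  assumes "open S" "Ck_on (Suc k) S f" "x \<in> S"
  shows "(f has_derivative \<D> f x) (at x)"
  using assms by (auto simp: differentiable_on_eq_differentiable_at frechet_derivative_works)

lemma Ck_on_const: "Ck_on k S (\<lambda>x. c)"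
  by (induction k arbitrary: c) auto

lemma Ck_on_add:
  assumes "open S" "Ck_on k S f" "Ck_on k S g"
  shows "Ck_on k S (\<lambda>x. f x + g x)"
  using assms(2,3)
proof (induction k arbitrary: f g)
  case 0
  then show ?case by (simp add: continuous_on_add)
next
  case (Suc k)
  show ?case
    by (rule Ck_on_SucI[OF assms(1) has_derivative_add])
      (use Suc in \<open>auto intro: Ck_on_Suc_has_derivative[OF assms(1)]\<close>)
qed

lemma Ck_on_sum:
  assumes "open S" "\<And>i. i \<in> I \<Longrightarrow> Ck_on k S (f i)"
  shows "Ck_on k S (\<lambda>x. \<Sum>i\<in>I. f i x)"
  using assms(2)
  by (induction I rule: infinite_finite_induct) (auto intro: Ck_on_const Ck_on_add[OF assms(1)])

lemma Ck_on_bounded_linear: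
  assumes "open S" "bounded_linear L" "Ck_on k S f"
  shows "Ck_on k S (\<lambda>x. L (f x))"
  using assms(3)
proof (induction k arbitrary: f)
  case 0
  then show ?case by (simp add: assms(2) bounded_linear.continuous_on)
next
  case (Suc k)
  show ?case
    by (rule Ck_on_SucI[OF assms(1) bounded_linear.has_derivative[OF assms(2)]])
      (use Suc in \<open>auto intro: Ck_on_Suc_has_derivative[OF assms(1)]\<close>)
qed

lemma Ck_on_bounded_bilinear:
  assumes "open S" "bounded_bilinear B" "Ck_on k S f" "Ck_on k S g"
  shows "Ck_on k S (\<lambda>x. B (f x) (g x))"
  using assms(3,4)
proof (induction k arbitrary: f g)
  case 0
  then show ?case by (simp add: assms(2) bounded_bilinear.continuous_on)
next
  case (Suc k)
  show ?case
    by (rule Ck_on_SucI[OF assms(1) bounded_bilinear.FDERIV[OF assms(2)]])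
      (use Suc.prems Ck_on_SucD[OF Suc.prems(1)] Ck_on_SucD[OF Suc.prems(2)] in
        \<open>auto intro!: Ck_on_add[OF assms(1)] Suc.IH Ck_on_Suc_has_derivative[OF assms(1)]\<close>)
qed

text \<open>The derivative of a composition is written as a sum over the standard basis, with the partial
  derivatives of the outer map as factors, because these are again compositions to which
  induction applies.\<close>

lemma Ck_on_compose:
  fixes f :: "'b::euclidean_space \<Rightarrow> 'c::euclidean_space"
    and g :: "'a::euclidean_space \<Rightarrow> 'b"
  assumes "open S" "open T" "g ` S \<subseteq> T" "Ck_on k T f" "Ck_on k S g"
  shows "Ck_on k S (\<lambda>x. f (g x))"
  using assms(4,5)
proof (induction k arbitrary: f)
  case 0
  then show ?case using assms(3) by (auto intro: continuous_on_compose2)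
next
  case (Suc k)
  define f' where "f' x = \<D> f x" for x
  define g' where "g' x = \<D> g x" for x
  have f': "(f has_derivative f' x) (at x)" if "x \<in> T" for x
    using Ck_on_Suc_has_derivative[OF assms(2) Suc.prems(1) that] by (simp add: f'_def)
  have g': "(g has_derivative g' x) (at x)" if "x \<in> S" for x
    using Ck_on_Suc_has_derivative[OF assms(1) Suc.prems(2) that] by (simp add: g'_def)
  have sm: "Ck_on k S (\<lambda>x. \<Sum>i\<in>Basis. (g' x v \<bullet> i) *\<^sub>R f' (g x) i)" for v
  proof (intro Ck_on_sum[OF assms(1)]
        Ck_on_bounded_bilinear[OF assms(1) bounded_bilinear_scaleR])
    fix i :: 'b assume "i \<in> Basis"
    show "Ck_on k S (\<lambda>x. g' x v \<bullet> i)"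
      using Ck_on_bounded_linear[OF assms(1) bounded_linear_inner_left] Suc.prems(2)
      by (auto simp: g'_def)
    show "Ck_on k S (\<lambda>x. f' (g x) i)"
      using Suc.IH[of "\<lambda>y. f' y i"] Suc.prems(1) Ck_on_SucD[OF Suc.prems(2)]
      by (auto simp: f'_def)
  qed
  show ?case
  proof (rule Ck_on_SucI[OF assms(1)])
    fix x assume x: "x \<in> S"
    then have gx: "g x \<in> T" using assms(3) by auto
    have "linear (f' (g x))" using f'[OF gx] has_derivative_linear by blast
    then have "f' (g x) (g' x v) = (\<Sum>i\<in>Basis. (g' x v \<bullet> i) *\<^sub>R f' (g x) i)" for v
      by (subst euclidean_representation[of "g' x v", symmetric])
        (simp add: linear_sum linear_scale)
    then have "f' (g x) \<circ> g' x = (\<lambda>v. \<Sum>i\<in>Basis. (g' x v \<bullet> i) *\<^sub>R f' (g x) i)"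
      by auto
    then show "((\<lambda>x. f (g x)) has_derivative
        (\<lambda>v. \<Sum>i\<in>Basis. (g' x v \<bullet> i) *\<^sub>R f' (g x) i)) (at x)"
      using diff_chain_at[OF g'[OF x] f'[OF gx]] by (simp add: o_def)
  qed (rule sm)
qed

lemma Ck_on_inverse:
  fixes f :: "'a::euclidean_space \<Rightarrow> real"
  assumes "open S" "\<And>x. x \<in> S \<Longrightarrow> f x \<noteq> 0" "Ck_on k S f"
  shows "Ck_on k S (\<lambda>x. inverse (f x))"
  using assms(3)
proof (induction k)
  case 0
  then show ?case using assms(2) by (auto intro: continuous_on_inverse)
next
  case (Suc k)
  note IH = Suc.IH[OF Ck_on_SucD[OF Suc.prems]]
  note mult = Ck_on_bounded_bilinear[OF assms(1) bounded_bilinear_mult]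
  show ?case
  proof (rule Ck_on_SucI[OF assms(1)])
    show "((\<lambda>x. inverse (f x)) has_derivative
        (\<lambda>v. - 1 * (inverse (f x) * \<D> f x v * inverse (f x)))) (at x)"
      if "x \<in> S" for x
      using Deriv.has_derivative_inverse[OF assms(2)[OF that]
          Ck_on_Suc_has_derivative[OF assms(1) Suc.prems that]] by simp
    show "Ck_on k S (\<lambda>x. - 1 * (inverse (f x) * \<D> f x v * inverse (f x)))" for v
      using Suc.prems by (intro mult Ck_on_const IH) auto
  qed
qed

lemma Ck_on_sqrt:
  fixes f :: "'a::euclidean_space \<Rightarrow> real"
  assumes "open S" "\<And>x. x \<in> S \<Longrightarrow> f x > 0" "Ck_on k S f"
  shows "Ck_on k S (\<lambda>x. sqrt (f x))"
  using assms(3)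
proof (induction k)
  case 0
  then show ?case by (auto intro: continuous_on_real_sqrt)
next
  case (Suc k)
  note IH = Suc.IH[OF Ck_on_SucD[OF Suc.prems]]
  note mult = Ck_on_bounded_bilinear[OF assms(1) bounded_bilinear_mult]
  show ?case
  proof (rule Ck_on_SucI[OF assms(1)])
    show "((\<lambda>x. sqrt (f x)) has_derivative
        (\<lambda>v. (1/2) * (inverse (sqrt (f x)) * \<D> f x v))) (at x)"
      if "x \<in> S" for x
      using has_derivative_real_sqrt[OF assms(2)[OF that]
          Ck_on_Suc_has_derivative[OF assms(1) Suc.prems that]]
      by (simp add: field_simps)
    show "Ck_on k S (\<lambda>x. (1/2) * (inverse (sqrt (f x)) * \<D> f x v))" for v
      using Suc.prems by (intro mult Ck_on_const Ck_on_inverse assms(1) IH) (use assms(2) in fastforce)+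
  qed
qed

lemma smooth_on_cong:
  "open S \<Longrightarrow> (\<And>x. x \<in> S \<Longrightarrow> f x = g x) \<Longrightarrow> smooth_on S f \<Longrightarrow> smooth_on S g"
  unfolding smooth_on_def by (auto intro: Ck_on_cong[of S f g])

lemma smooth_on_subset: "smooth_on S f \<Longrightarrow> T \<subseteq> S \<Longrightarrow> smooth_on T f"
  unfolding smooth_on_def using Ck_on_subset by blast

lemma smooth_on_local:
  assumes "open S" "\<And>a. a \<in> S \<Longrightarrow> \<exists>T. open T \<and> a \<in> T \<and> T \<subseteq> S \<and> smooth_on T f"
  shows "smooth_on S f"
  unfolding smooth_on_def
proof
  show "Ck_on k S f" for k
    by (rule Ck_on_local[OF assms(1)]) (use assms(2) in \<open>force simp: smooth_on_def\<close>)
qed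

lemma smooth_on_const: "smooth_on S (\<lambda>x. c)"
  by (simp add: smooth_on_def Ck_on_const)

lemma smooth_on_add: "open S \<Longrightarrow> smooth_on S f \<Longrightarrow> smooth_on S g \<Longrightarrow> smooth_on S (\<lambda>x. f x + g x)"
  unfolding smooth_on_def by (blast intro: Ck_on_add)

lemma smooth_on_bounded_linear:
  "open S \<Longrightarrow> bounded_linear L \<Longrightarrow> smooth_on S f \<Longrightarrow> smooth_on S (\<lambda>x. L (f x))"
  unfolding smooth_on_def by (blast intro: Ck_on_bounded_linear)

lemma smooth_on_bounded_bilinear:
  "open S \<Longrightarrow> bounded_bilinear B \<Longrightarrow> smooth_on S f \<Longrightarrow> smooth_on S g \<Longrightarrow>
    smooth_on S (\<lambda>x. B (f x) (g x))"
  unfolding smooth_on_def by (blast intro: Ck_on_bounded_bilinear)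

lemma smooth_on_compose:
  "open S \<Longrightarrow> open T \<Longrightarrow> g ` S \<subseteq> T \<Longrightarrow> smooth_on T f \<Longrightarrow> smooth_on S g \<Longrightarrow>
    smooth_on S (\<lambda>x. f (g x))"
  unfolding smooth_on_def by (auto intro: Ck_on_compose[of S T g])

lemma smooth_on_inverse:
  fixes f :: "'a::euclidean_space \<Rightarrow> real"
  shows "open S \<Longrightarrow> (\<And>x. x \<in> S \<Longrightarrow> f x \<noteq> 0) \<Longrightarrow> smooth_on S f \<Longrightarrow> smooth_on S (\<lambda>x. inverse (f x))"
  unfolding smooth_on_def by (intro allI Ck_on_inverse) simp_all

lemma smooth_on_sqrt:
  fixes f :: "'a::euclidean_space \<Rightarrow> real"
  shows "open S \<Longrightarrow> (\<And>x. x \<in> S \<Longrightarrow> f x > 0) \<Longrightarrow> smooth_on S f \<Longrightarrow> smooth_on S (\<lambda>x. sqrt (f x))"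
  unfolding smooth_on_def by (intro allI Ck_on_sqrt) simp_all

lemma smooth_on_minus: "open S \<Longrightarrow> smooth_on S f \<Longrightarrow> smooth_on S (\<lambda>x. - f x)"
  by (rule smooth_on_bounded_linear[of S uminus]) (auto intro: bounded_linear_minus bounded_linear_ident)

lemma smooth_on_diff:
  "open S \<Longrightarrow> smooth_on S f \<Longrightarrow> smooth_on S g \<Longrightarrow> smooth_on S (\<lambda>x. f x - g x)"
  using smooth_on_add[OF _ _ smooth_on_minus, of S f g] by simp

lemma smooth_on_scaleR:
  "open S \<Longrightarrow> smooth_on S f \<Longrightarrow> smooth_on S g \<Longrightarrow> smooth_on S (\<lambda>x. f x *\<^sub>R g x)"
  by (rule smooth_on_bounded_bilinear[OF _ bounded_bilinear_scaleR])

lemma smooth_on_mult: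
  fixes f :: "'a::euclidean_space \<Rightarrow> real"
  shows "open S \<Longrightarrow> smooth_on S f \<Longrightarrow> smooth_on S g \<Longrightarrow> smooth_on S (\<lambda>x. f x * g x)"
  by (rule smooth_on_bounded_bilinear[OF _ bounded_bilinear_mult])

lemma smooth_on_inner:
  "open S \<Longrightarrow> smooth_on S f \<Longrightarrow> smooth_on S g \<Longrightarrow> smooth_on S (\<lambda>x. f x \<bullet> g x)"
  by (rule smooth_on_bounded_bilinear[OF _ bounded_bilinear_inner])

lemma smooth_on_imp_continuous_on: "smooth_on S f \<Longrightarrow> continuous_on S f"
  unfolding smooth_on_def using Ck_on.simps(1) by blast

lemma smooth_on_has_derivative:
  assumes "smooth_on S f" "open S" "x \<in> S"
  shows "(f has_derivative \<D> f x) (at x)"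
  using Ck_on_Suc_has_derivative[OF assms(2) _ assms(3), of 0 f] assms(1)
  unfolding smooth_on_def by blast

lemma smooth_on_differentiable:
  "smooth_on S f \<Longrightarrow> open S \<Longrightarrow> x \<in> S \<Longrightarrow> f differentiable at x"
  using smooth_on_has_derivative differentiable_def by blast

subsection \<open>Derivatives along vector fields\<close>

definition ddir ::
    "('a::euclidean_space \<Rightarrow> 'a) \<Rightarrow> ('a \<Rightarrow> 'b::euclidean_space) \<Rightarrow> 'a \<Rightarrow> 'b" where
  "ddir \<xi> G = (\<lambda>a. \<D> G a (\<xi> a))"

text \<open>A derivative along a vector field differentiates along a direction that moves with the point.
  Expanding this direction in the standard basis reduces smoothness to that of the partial
  derivatives.\<close>

lemma frechet_derivative_Basis_sum:
  fixes f :: "'a::euclidean_space \<Rightarrow> 'b::euclidean_space"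
  assumes "f differentiable at a"
  shows "\<D> f a v = (\<Sum>i\<in>Basis. (v \<bullet> i) *\<^sub>R \<D> f a i)"
proof -
  have "linear (\<D> f a)"
    by (rule linear_frechet_derivative[OF assms])
  then show ?thesis
    by (subst euclidean_representation[of v, symmetric]) (simp add: linear_sum linear_scale)
qed

lemma smooth_on_ddir_const:
  assumes "smooth_on S G"
  shows "smooth_on S (\<lambda>a. \<D> G a v)"
  unfolding smooth_on_def
proof
  fix k
  have "Ck_on (Suc k) S G" using assms unfolding smooth_on_def by blast
  then show "Ck_on k S (\<lambda>a. \<D> G a v)" by simp
qed

lemma smooth_on_sum:
  assumes "open S" "\<And>i. i \<in> I \<Longrightarrow> smooth_on S (f i)"
  shows "smooth_on S (\<lambda>x. \<Sum>i\<in>I. f i x)"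
  using assms(2)
proof (induction I rule: infinite_finite_induct)
  case (insert i I)
  have "smooth_on S (\<lambda>x. f i x + (\<Sum>i\<in>I. f i x))"
    by (rule smooth_on_add[OF assms(1)]) (use insert in auto)
  then show ?case using insert by simp
qed (simp_all add: smooth_on_const)

lemma smooth_on_ddir:
  assumes "open S" "smooth_on S \<xi>" "smooth_on S G"
  shows "smooth_on S (ddir \<xi> G)"
proof -
  define H where "H a = (\<Sum>i\<in>Basis. (\<xi> a \<bullet> i) *\<^sub>R \<D> G a i)" for a
  have H: "smooth_on S H"
    unfolding H_def
    by (rule smooth_on_sum[OF assms(1)], rule smooth_on_scaleR[OF assms(1)],
        rule smooth_on_inner[OF assms(1,2) smooth_on_const], rule smooth_on_ddir_const[OF assms(3)])
  have eq: "H a = ddir \<xi> G a" if "a \<in> S" for a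
    unfolding ddir_def H_def
    by (rule frechet_derivative_Basis_sum[OF smooth_on_differentiable[OF assms(3,1) that], symmetric])
  show ?thesis
    by (rule smooth_on_cong[OF assms(1) _ H]) (rule eq)
qed

lemma ddir_eqI: "(G has_derivative G') (at a) \<Longrightarrow> ddir \<xi> G a = G' (\<xi> a)"
  by (simp add: ddir_def frechet_derivative_at[symmetric])

lemma ddir_cong:
  assumes "open S" "a \<in> S" "\<And>b. b \<in> S \<Longrightarrow> G b = H b" "G differentiable at a"
  shows "ddir \<xi> G a = ddir \<xi> H a"
  by (simp add: ddir_def frechet_derivative_transform_within_open[OF assms(4,1,2,3)])

lemma ddir_const [simp]: "ddir \<xi> (\<lambda>_. c) a = 0"
  by (simp add: ddir_def)

lemma ddir_add:
  assumes "G differentiable at a" "H differentiable at a"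
  shows "ddir \<xi> (\<lambda>b. G b + H b) a = ddir \<xi> G a + ddir \<xi> H a"
  using ddir_eqI[OF has_derivative_add[OF assms(1)[unfolded frechet_derivative_works]
        assms(2)[unfolded frechet_derivative_works]], of \<xi>]
  by (simp add: ddir_def)

lemma ddir_bounded_linear:
  assumes "bounded_linear L" "G differentiable at a"
  shows "ddir \<xi> (\<lambda>b. L (G b)) a = L (ddir \<xi> G a)"
  using ddir_eqI[OF bounded_linear.has_derivative[OF assms(1)
        assms(2)[unfolded frechet_derivative_works]], of \<xi>]
  by (simp add: ddir_def)

lemma differentiable_bounded_bilinear:
  assumes "bounded_bilinear B" "G differentiable at a" "H differentiable at a"
  shows "(\<lambda>b. B (G b) (H b)) differentiable at a"
  using bounded_bilinear.FDERIV[OF assms(1)] assms(2,3) unfolding differentiable_def by blast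

lemma ddir_bounded_bilinear:
  assumes "bounded_bilinear B" "G differentiable at a" "H differentiable at a"
  shows "ddir \<xi> (\<lambda>b. B (G b) (H b)) a = B (G a) (ddir \<xi> H a) + B (ddir \<xi> G a) (H a)"
  using ddir_eqI[OF bounded_bilinear.FDERIV[OF assms(1)
        assms(2)[unfolded frechet_derivative_works] assms(3)[unfolded frechet_derivative_works]], of \<xi>]
  by (simp add: ddir_def)

lemma ddir_direction_linear:
  assumes "G differentiable at a"
  shows "ddir (\<lambda>b. s b *\<^sub>R \<xi> b + t b *\<^sub>R \<zeta> b) G a = s a *\<^sub>R ddir \<xi> G a + t a *\<^sub>R ddir \<zeta> G a"
  using linear_frechet_derivative[OF assms]
  by (simp add: ddir_def linear_add linear_scale)

lemma has_real_derivative_along_line: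
  fixes G :: "'a::euclidean_space \<Rightarrow> real"
  assumes "G differentiable at (p + s *\<^sub>R v)"
  shows "((\<lambda>s. G (p + s *\<^sub>R v)) has_real_derivative \<D> G (p + s *\<^sub>R v) v) (at s)"
proof -
  let ?G' = "\<D> G (p + s *\<^sub>R v)"
  have "((\<lambda>s. p + s *\<^sub>R v) has_derivative (\<lambda>h. h *\<^sub>R v)) (at s)"
    by (auto intro!: derivative_eq_intros)
  from diff_chain_at[OF this assms[unfolded frechet_derivative_works]]
  have "((\<lambda>s. G (p + s *\<^sub>R v)) has_derivative (\<lambda>h. ?G' (h *\<^sub>R v))) (at s)"
    by (simp add: o_def)
  moreover have "?G' (h *\<^sub>R v) = ?G' v * h" for h
    using linear_frechet_derivative[OF assms] by (simp add: linear_scale)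
  ultimately show ?thesis by (simp add: has_field_derivative_def)
qed

text \<open>The mean value theorem, once in each of the two directions, turns the second difference into a
  mixed second derivative at a nearby point. The second difference does not depend on the order
  of \<open>v\<close> and \<open>w\<close>, so that shrinking \<open>t\<close> shows the symmetry of second derivatives.\<close>

lemma second_difference_mean_value:
  fixes G :: "'a::euclidean_space \<Rightarrow> real"
  assumes "open U" "smooth_on U G" "0 < t"
    and U: "\<And>s r. 0 \<le> s \<Longrightarrow> s \<le> t \<Longrightarrow> 0 \<le> r \<Longrightarrow> r \<le> t \<Longrightarrow> a + s *\<^sub>R v + r *\<^sub>R w \<in> U"
  shows "\<exists>s r. 0 \<le> s \<and> s \<le> t \<and> 0 \<le> r \<and> r \<le> t \<and>
    G (a + t *\<^sub>R v + t *\<^sub>R w) - G (a + t *\<^sub>R v) - G (a + t *\<^sub>R w) + G a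
      = t * (t * \<D> (\<lambda>b. \<D> G b v) (a + s *\<^sub>R v + r *\<^sub>R w) w)"
proof -
  define G' where "G' b = \<D> G b v" for b
  define \<phi> where "\<phi> s = G (a + t *\<^sub>R w + s *\<^sub>R v) - G (a + s *\<^sub>R v)" for s
  have "(\<phi> has_real_derivative G' (a + t *\<^sub>R w + s *\<^sub>R v) - G' (a + s *\<^sub>R v)) (at s)"
    if "0 \<le> s" "s \<le> t" for s
    unfolding \<phi>_def G'_def using U[OF that, of t] U[OF that, of 0] assms(3)
    by (intro DERIV_diff has_real_derivative_along_line smooth_on_differentiable[OF assms(2,1)])
      (simp_all add: algebra_simps)
  from MVT2[OF assms(3) this] obtain s where s: "0 < s" "s < t"
    "\<phi> t - \<phi> 0 = t * (G' (a + t *\<^sub>R w + s *\<^sub>R v) - G' (a + s *\<^sub>R v))" by auto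
  have G': "smooth_on U G'"
    unfolding G'_def by (rule smooth_on_ddir_const[OF assms(2)])
  have "((\<lambda>r. G' ((a + s *\<^sub>R v) + r *\<^sub>R w)) has_real_derivative
      \<D> G' ((a + s *\<^sub>R v) + r *\<^sub>R w) w) (at r)"
    if "0 \<le> r" "r \<le> t" for r
    by (rule has_real_derivative_along_line[OF smooth_on_differentiable[OF G' assms(1)]])
      (use U s that in auto)
  from MVT2[OF assms(3) this] obtain r where r: "0 < r" "r < t"
    "G' ((a + s *\<^sub>R v) + t *\<^sub>R w) - G' (a + s *\<^sub>R v)
       = t * \<D> G' ((a + s *\<^sub>R v) + r *\<^sub>R w) w" by auto
  show ?thesis
    using s r by (intro exI[of _ s] exI[of _ r]) (simp add: \<phi>_def G'_def[abs_def] algebra_simps)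
qed

lemma second_derivative_symmetric_real:
  fixes G :: "'a::euclidean_space \<Rightarrow> real"
  assumes "open U" "smooth_on U G" "a \<in> U"
  shows "\<D> (\<lambda>b. \<D> G b v) a w
       = \<D> (\<lambda>b. \<D> G b w) a v"
proof (rule ccontr)
  define A where "A b = \<D> (\<lambda>b. \<D> G b v) b w" for b
  define B where "B b = \<D> (\<lambda>b. \<D> G b w) b v" for b
  assume "\<not> ?thesis"
  then have ne: "A a \<noteq> B a" by (simp add: A_def B_def)
  define e where "e = \<bar>A a - B a\<bar> / 2"
  have e: "e > 0" using ne by (simp add: e_def)
  have "continuous_on U A" "continuous_on U B"
    unfolding A_def B_def
    by (intro smooth_on_imp_continuous_on smooth_on_ddir_const assms)+
  then have "isCont A a" "isCont B a"
    using assms by (auto simp: continuous_on_eq_continuous_at)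
  then obtain d1 d2 where d: "d1 > 0" "\<And>b. dist b a < d1 \<Longrightarrow> dist (A b) (A a) < e"
    "d2 > 0" "\<And>b. dist b a < d2 \<Longrightarrow> dist (B b) (B a) < e"
    unfolding continuous_at_eps_delta using e by metis
  obtain d3 where d3: "d3 > 0" "ball a d3 \<subseteq> U"
    using assms openE by blast
  \<comment> \<open>Within distance \<open>d\<close>, both mixed derivatives vary by less than half of their supposed
    difference; \<open>t\<close> is chosen such that the whole parallelogram stays there.\<close>
  define d where "d = min d1 (min d2 d3)"
  define t where "t = d / (norm v + norm w + 1)"
  have nn: "0 < norm v + norm w + 1" by (simp add: add_nonneg_pos)
  have t: "t > 0" using nn d(1,3) d3(1) by (simp add: t_def d_def)
  have near: "dist (a + s *\<^sub>R v + r *\<^sub>R w) a < d" "dist (a + r *\<^sub>R w + s *\<^sub>R v) a < d"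
    if "0 \<le> s" "s \<le> t" "0 \<le> r" "r \<le> t" for s r
  proof -
    have "norm (s *\<^sub>R v + r *\<^sub>R w) \<le> s * norm v + r * norm w"
      using that norm_triangle_ineq[of "s *\<^sub>R v" "r *\<^sub>R w"] by simp
    also have "\<dots> \<le> t * norm v + t * norm w"
      using that by (intro add_mono mult_right_mono) auto
    also have "\<dots> < t * (norm v + norm w + 1)"
      using t by (simp add: algebra_simps)
    also have "\<dots> = d" using nn by (simp add: t_def)
    finally show "dist (a + s *\<^sub>R v + r *\<^sub>R w) a < d" by (simp add: dist_norm add.assoc)
    then show "dist (a + r *\<^sub>R w + s *\<^sub>R v) a < d" by (simp add: algebra_simps)
  qed
  have inU: "b \<in> U" if "dist b a < d" for b
    using that d3(2) by (auto simp: d_def dist_commute mem_ball)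
  obtain s r where 1: "0 \<le> s" "s \<le> t" "0 \<le> r" "r \<le> t"
    "G (a + t *\<^sub>R v + t *\<^sub>R w) - G (a + t *\<^sub>R v) - G (a + t *\<^sub>R w) + G a
      = t * (t * A (a + s *\<^sub>R v + r *\<^sub>R w))"
    using second_difference_mean_value[OF assms(1,2) t, of a v w] near(1) inU
    unfolding A_def by blast
  obtain s' r' where 2: "0 \<le> s'" "s' \<le> t" "0 \<le> r'" "r' \<le> t"
    "G (a + t *\<^sub>R w + t *\<^sub>R v) - G (a + t *\<^sub>R w) - G (a + t *\<^sub>R v) + G a
      = t * (t * B (a + s' *\<^sub>R w + r' *\<^sub>R v))"
    using second_difference_mean_value[OF assms(1,2) t, of a w v] near(2) inU
    unfolding B_def by blast
  have "t * (t * A (a + s *\<^sub>R v + r *\<^sub>R w)) = t * (t * B (a + s' *\<^sub>R w + r' *\<^sub>R v))"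
    using 1(5) 2(5) by (simp add: algebra_simps)
  then have "A (a + s *\<^sub>R v + r *\<^sub>R w) = B (a + s' *\<^sub>R w + r' *\<^sub>R v)"
    using t by simp
  moreover have "dist (A (a + s *\<^sub>R v + r *\<^sub>R w)) (A a) < e"
    using near(1)[OF 1(1-4)] d(2) by (simp add: d_def)
  moreover have "dist (B (a + s' *\<^sub>R w + r' *\<^sub>R v)) (B a) < e"
    using near(2)[OF 2(3,4,1,2)] d(4) by (simp add: d_def)
  ultimately show False
    unfolding e_def dist_real_def by argo
qed

lemma second_derivative_symmetric:
  fixes G :: "'a::euclidean_space \<Rightarrow> 'b::euclidean_space"
  assumes "open U" "smooth_on U G" "a \<in> U"
  shows "\<D> (\<lambda>b. \<D> G b v) a w
       = \<D> (\<lambda>b. \<D> G b w) a v"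
proof (rule euclidean_eqI)
  fix i :: 'b assume "i \<in> Basis"
  have comp: "\<D> (\<lambda>b. H b \<bullet> i) b u = \<D> H b u \<bullet> i"
    if "H differentiable at b" for H :: "'a \<Rightarrow> 'b" and b u
    using ddir_bounded_linear[OF bounded_linear_inner_left that, of "\<lambda>_. u"] by (simp add: ddir_def)
  have twice: "\<D> (\<lambda>b. \<D> (\<lambda>b. G b \<bullet> i) b v) a w
      = \<D> (\<lambda>b. \<D> G b v) a w \<bullet> i" for v w
  proof -
    have s: "smooth_on U (\<lambda>b. \<D> G b v)"
      by (rule smooth_on_ddir_const[OF assms(2)])
    have "\<D> (\<lambda>b. \<D> G b v \<bullet> i) a
        = \<D> (\<lambda>b. \<D> (\<lambda>b. G b \<bullet> i) b v) a"
      by (rule frechet_derivative_transform_within_open[OF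
            smooth_on_differentiable[OF smooth_on_inner[OF assms(1) s smooth_on_const] assms(1,3)]
            assms(1,3)])
        (simp add: comp smooth_on_differentiable[OF assms(2,1)])
    then show ?thesis
      using comp[OF smooth_on_differentiable[OF s assms(1,3)]] by simp
  qed
  show "\<D> (\<lambda>b. \<D> G b v) a w \<bullet> i
      = \<D> (\<lambda>b. \<D> G b w) a v \<bullet> i"
    using second_derivative_symmetric_real[OF assms(1) _ assms(3), of "\<lambda>b. G b \<bullet> i" v w]
      smooth_on_inner[OF assms(1,2) smooth_on_const]
    by (simp add: twice)
qed

lemma ddir_ddir:
  assumes "open U" "smooth_on U G" "smooth_on U \<zeta>" "a \<in> U"
  shows "ddir \<xi> (ddir \<zeta> G) a = \<D> G a (ddir \<xi> \<zeta> a)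
    + \<D> (\<lambda>b. \<D> G b (\<zeta> a)) a (\<xi> a)"
proof -
  define P where "P i b = \<D> G b i" for i b
  have P: "(P i has_derivative \<D> (P i) a) (at a)" for i
    unfolding P_def
    by (rule smooth_on_has_derivative[OF smooth_on_ddir_const[OF assms(2)] assms(1,4)])
  have Z: "((\<lambda>b. \<zeta> b \<bullet> i) has_derivative (\<lambda>v. \<D> \<zeta> a v \<bullet> i)) (at a)" for i
    by (rule has_derivative_inner_left[OF smooth_on_has_derivative[OF assms(3,1,4)]])
  have G: "G differentiable at b" if "b \<in> U" for b
    by (rule smooth_on_differentiable[OF assms(2,1) that])
  have E1: "(\<Sum>i\<in>Basis. (\<zeta> b \<bullet> i) *\<^sub>R P i b) = ddir \<zeta> G b" if "b \<in> U" for b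
    unfolding P_def ddir_def by (rule frechet_derivative_Basis_sum[OF G[OF that], symmetric])
  have E2: "(\<Sum>i\<in>Basis. (\<zeta> a \<bullet> i) *\<^sub>R P i b) = \<D> G b (\<zeta> a)" if "b \<in> U" for b
    unfolding P_def by (rule frechet_derivative_Basis_sum[OF G[OF that], symmetric])
  have E3: "(\<Sum>i\<in>Basis. (u \<bullet> i) *\<^sub>R P i a) = \<D> G a u" for u
    unfolding P_def by (rule frechet_derivative_Basis_sum[OF G[OF assms(4)], symmetric])
  have D1: "(ddir \<zeta> G has_derivative (\<lambda>v. \<Sum>i\<in>Basis. (\<zeta> a \<bullet> i) *\<^sub>R \<D> (P i) a v
      + (\<D> \<zeta> a v \<bullet> i) *\<^sub>R P i a)) (at a)"
    by (rule has_derivative_transform_within_open[OF _ assms(1,4) E1])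
      (rule has_derivative_sum, rule has_derivative_scaleR[OF Z P])
  have D2: "((\<lambda>b. \<D> G b (\<zeta> a)) has_derivative
      (\<lambda>v. \<Sum>i\<in>Basis. (\<zeta> a \<bullet> i) *\<^sub>R \<D> (P i) a v)) (at a)"
    by (rule has_derivative_transform_within_open[OF _ assms(1,4) E2])
      (rule has_derivative_sum, rule has_derivative_scaleR_right[OF P])
  show ?thesis
    using ddir_eqI[OF D1, of \<xi>] frechet_derivative_at[OF D2, symmetric]
    by (simp add: sum.distrib E3 ddir_def)
qed

text \<open>Second derivatives cancel by symmetry; what is left is the derivative along the Lie bracket of
  the two fields.\<close>

lemma ddir_commutator:
  assumes "open U" "smooth_on U G" "smooth_on U \<xi>" "smooth_on U \<zeta>" "a \<in> U"
  shows "ddir \<xi> (ddir \<zeta> G) a - ddir \<zeta> (ddir \<xi> G) a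
    = \<D> G a (ddir \<xi> \<zeta> a - ddir \<zeta> \<xi> a)"
  using ddir_ddir[OF assms(1,2,4,5), of \<xi>] ddir_ddir[OF assms(1,2,3,5), of \<zeta>]
    second_derivative_symmetric[OF assms(1,2,5), of "\<zeta> a" "\<xi> a"]
    linear_frechet_derivative[OF smooth_on_differentiable[OF assms(2,1,5)]]
  by (simp add: linear_diff)

text \<open>Gronwall's argument: along a segment, the square of the norm of \<open>G\<close> grows at most at the rate
  \<open>c\<close>, so that its product with \<open>exp (- c t)\<close> decreases from zero.\<close>

lemma zero_of_linear_derivative_bound:
  fixes G :: "'a::euclidean_space \<Rightarrow> 'b::euclidean_space"
  assumes "convex U" "\<And>b. b \<in> U \<Longrightarrow> G differentiable at b" "a \<in> U" "G a = 0" "b \<in> U"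
    and bound: "\<And>b v. b \<in> U \<Longrightarrow> norm (\<D> G b v) \<le> K * norm v * norm (G b)"
  shows "G b = 0"
proof -
  define w where "w = b - a"
  define c where "c = 2 * K * norm w"
  define \<psi> where "\<psi> t = (G (a + t *\<^sub>R w) \<bullet> G (a + t *\<^sub>R w)) * exp (- c * t)" for t
  have "\<exists>y. DERIV \<psi> t :> y \<and> y \<le> 0" if t: "0 \<le> t" "t \<le> 1" for t
  proof -
    let ?p = "a + t *\<^sub>R w"
    let ?g = "G ?p" and ?d = "\<D> G ?p w"
    have "?p = (1 - t) *\<^sub>R a + t *\<^sub>R b" by (simp add: w_def algebra_simps)
    then have p: "?p \<in> U" using convexD_alt[OF assms(1,3,5) t] by simp
    have d: "(\<lambda>b. G b \<bullet> G b) differentiable at ?p"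
      using assms(2)[OF p] by (intro differentiable_inner)
    have dd: "\<D> (\<lambda>b. G b \<bullet> G b) ?p w = ?g \<bullet> ?d + ?d \<bullet> ?g"
      using ddir_bounded_bilinear[OF bounded_bilinear_inner assms(2)[OF p] assms(2)[OF p], of "\<lambda>_. w"]
      by (simp add: ddir_def)
    have "DERIV \<psi> t :> (?g \<bullet> ?d + ?d \<bullet> ?g) * exp (- c * t) + exp (- c * t) * (- c) * (?g \<bullet> ?g)"
      unfolding \<psi>_def
      by (rule DERIV_mult[OF has_real_derivative_along_line[OF d, unfolded dd]])
        (auto intro!: derivative_eq_intros)
    moreover have "?g \<bullet> ?d \<le> K * norm w * (?g \<bullet> ?g)"
    proof -
      have "?g \<bullet> ?d \<le> norm ?g * norm ?d" by (rule norm_cauchy_schwarz)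
      also have "\<dots> \<le> norm ?g * (K * norm w * norm ?g)"
        by (intro mult_left_mono bound p) auto
      finally show ?thesis by (simp add: power2_norm_eq_inner[symmetric] power2_eq_square mult_ac)
    qed
    then have "(?g \<bullet> ?d + ?d \<bullet> ?g) - c * (?g \<bullet> ?g) \<le> 0"
      by (simp add: c_def inner_commute)
    then have "((?g \<bullet> ?d + ?d \<bullet> ?g) - c * (?g \<bullet> ?g)) * exp (- c * t) \<le> 0"
      by (simp add: mult_le_0_iff)
    then have "(?g \<bullet> ?d + ?d \<bullet> ?g) * exp (- c * t) + exp (- c * t) * (- c) * (?g \<bullet> ?g) \<le> 0"
      by (simp add: algebra_simps)
    ultimately show ?thesis by blast
  qed
  then have "\<psi> 1 \<le> \<psi> 0"
    by (rule DERIV_nonpos_imp_nonincreasing[of 0 1, rotated]) simp_all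
  then have "(G b \<bullet> G b) * exp (- c) \<le> 0"
    by (simp add: \<psi>_def assms(4) w_def)
  then have "G b \<bullet> G b \<le> 0"
    by (simp add: mult_le_0_iff)
  then show ?thesis
    using inner_gt_zero_iff[of "G b"] by linarith
qed

section \<open>Algebra of Minkowski space-time\<close>

lemma mink_commute: "mink u v = mink v u"
  by (simp add: mink_def mult.commute)

lemma mink_simps:
  "mink (u + u') v = mink u v + mink u' v" "mink v (u + u') = mink v u + mink v u'"
  "mink (u - u') v = mink u v - mink u' v" "mink v (u - u') = mink v u - mink v u'"
  "mink (c *\<^sub>R u) v = c * mink u v" "mink v (c *\<^sub>R u) = c * mink v u"
  "mink (- u) v = - mink u v" "mink v (- u) = - mink v u"
  "mink 0 v = 0" "mink v 0 = 0"
  by (simp_all add: mink_def algebra_simps)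

lemma bounded_bilinear_mink: "bounded_bilinear mink"
  by (simp add: bilinear_conv_bounded_bilinear[symmetric] bilinear_def linear_iff mink_simps)

lemma wedge_simps:
  "wedge (u + u') v = wedge u v + wedge u' v" "wedge v (u + u') = wedge v u + wedge v u'"
  "wedge (u - u') v = wedge u v - wedge u' v" "wedge v (u - u') = wedge v u - wedge v u'"
  "wedge (c *\<^sub>R u) v = c *\<^sub>R wedge u v" "wedge v (c *\<^sub>R u) = c *\<^sub>R wedge v u"
  "wedge (- u) v = - wedge u v" "wedge v (- u) = - wedge v u"
  "wedge 0 v = 0" "wedge v 0 = 0" "wedge u u = 0"
  by (simp_all add: wedge_def vec_eq_iff algebra_simps)

lemma wedge_commute: "wedge v u = - wedge u v"
  by (simp add: wedge_def vec_eq_iff)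

lemma bounded_bilinear_wedge: "bounded_bilinear wedge"
  by (simp add: bilinear_conv_bounded_bilinear[symmetric] bilinear_def linear_iff wedge_simps)

lemma smooth_on_mink:
  "open S \<Longrightarrow> smooth_on S f \<Longrightarrow> smooth_on S g \<Longrightarrow> smooth_on S (\<lambda>x. mink (f x) (g x))"
  by (rule smooth_on_bounded_bilinear[OF _ bounded_bilinear_mink])

lemma smooth_on_wedge:
  "open S \<Longrightarrow> smooth_on S f \<Longrightarrow> smooth_on S g \<Longrightarrow> smooth_on S (\<lambda>x. wedge (f x) (g x))"
  by (rule smooth_on_bounded_bilinear[OF _ bounded_bilinear_wedge])

lemma ddir_mink:
  assumes "G differentiable at a" "H differentiable at a"
  shows "ddir \<xi> (\<lambda>b. mink (G b) (H b)) a = mink (G a) (ddir \<xi> H a) + mink (ddir \<xi> G a) (H a)"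
  by (rule ddir_bounded_bilinear[OF bounded_bilinear_mink assms])

lemma ddir_wedge:
  assumes "G differentiable at a" "H differentiable at a"
  shows "ddir \<xi> (\<lambda>b. wedge (G b) (H b)) a = wedge (G a) (ddir \<xi> H a) + wedge (ddir \<xi> G a) (H a)"
  by (rule ddir_bounded_bilinear[OF bounded_bilinear_wedge assms])

lemma ddir_scaleR:
  assumes "G differentiable at a" "H differentiable at a"
  shows "ddir \<xi> (\<lambda>b. G b *\<^sub>R H b) a = G a *\<^sub>R ddir \<xi> H a + ddir \<xi> G a *\<^sub>R H a"
  by (rule ddir_bounded_bilinear[OF bounded_bilinear_scaleR assms])

text \<open>This is the reversed Cauchy-Schwarz inequality. Orthogonality equates the product of the time
  components with the inner product of the space parts; the Lagrange identity bounds the latter.\<close>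

lemma orthogonal_timelike_imp_spacelike:
  assumes "mink t t < 0" "mink t s = 0" "s \<noteq> 0"
  shows "mink s s > 0"
proof -
  define P where "P = (t$2)^2 + (t$3)^2 + (t$4)^2"
  define Q where "Q = (s$2)^2 + (s$3)^2 + (s$4)^2"
  have t1: "(t$1)^2 > P" using assms(1) by (simp add: mink_def P_def power2_eq_square)
  have P0: "P \<ge> 0" and Q0: "Q \<ge> 0" by (simp_all add: P_def Q_def)
  have e: "t$1 * s$1 = t$2 * s$2 + t$3 * s$3 + t$4 * s$4"
    using assms(2) by (simp add: mink_def)
  have "P * Q - (t$2 * s$2 + t$3 * s$3 + t$4 * s$4)^2
      = (t$2 * s$3 - t$3 * s$2)^2 + (t$2 * s$4 - t$4 * s$2)^2 + (t$3 * s$4 - t$4 * s$3)^2"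
    by (simp add: P_def Q_def power2_eq_square algebra_simps)
  also have "\<dots> \<ge> 0" by simp
  finally have CS: "(t$1)^2 * (s$1)^2 \<le> P * Q" by (simp add: e flip: power_mult_distrib)
  have "Q \<noteq> 0"
  proof
    assume Q: "Q = 0"
    then have z: "s$2 = 0" "s$3 = 0" "s$4 = 0"
      unfolding Q_def by (smt (verit) zero_le_power2 power_eq_0_iff)+
    have "(t$1)^2 * (s$1)^2 \<le> 0" using CS Q by simp
    moreover have "t$1 \<noteq> 0" using t1 P0 by auto
    ultimately have "s$1 = 0" by (simp add: mult_le_0_iff)
    then show False using assms(3) z by (simp add: vec_eq_iff forall_4)
  qed
  then have "P * Q < (t$1)^2 * Q" using t1 Q0 by simp
  then have "(t$1)^2 * (s$1)^2 < (t$1)^2 * Q" using CS by linarith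
  then have "(s$1)^2 < Q" using mult_less_cancel_left_pos t1 P0 by (smt (verit))
  then show ?thesis by (simp add: mink_def Q_def power2_eq_square)
qed

text \<open>The time coordinate is injective on a negative definite subspace, because its kernel in
  Minkowski space is positive definite.\<close>

lemma negative_definite_dim_le_1:
  assumes "subspace W" "\<forall>w\<in>W. w \<noteq> 0 \<longrightarrow> mink w w < 0"
  shows "dim W \<le> 1"
proof -
  have lin: "linear (\<lambda>w::real^4. w$1)" by (simp add: linear_iff)
  have "inj_on (\<lambda>w::real^4. w$1) (span W)"
  proof (rule inj_onI)
    fix u v assume uv: "u \<in> span W" "v \<in> span W" "u$1 = v$1"
    have "u - v \<in> W" using uv(1,2) assms(1) by (metis span_eq_iff subspace_diff)
    moreover have "mink (u - v) (u - v) \<ge> 0" using uv(3) by (simp add: mink_def)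
    ultimately show "u = v" using assms(2) by fastforce
  qed
  then have "dim ((\<lambda>w::real^4. w$1) ` W) = dim W" by (rule dim_image_eq[OF lin])
  then show ?thesis using dim_subset_UNIV[of "(\<lambda>w::real^4. w$1) ` W"] by simp
qed

lemma lorentzian_space_timelike:
  assumes "subspace V" "lorentzian_space V"
  obtains t where "t \<in> V" "mink t t < 0"
proof -
  let ?A = "{W. subspace W \<and> W \<subseteq> V \<and> (\<forall>w\<in>W. w \<noteq> 0 \<longrightarrow> mink w w < 0)}"
  have fin: "finite (dim ` ?A)"
    by (rule finite_subset[of _ "{..1}"]) (use negative_definite_dim_le_1 in auto)
  have m: "Max (dim ` ?A) = 1"
    using assms(2) by (simp add: lorentzian_space_def metric_index_def)
  have "{0} \<in> ?A" using subspace_0[OF assms(1)] by simp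
  then have "dim ` ?A \<noteq> {}" by blast
  then have "1 \<in> dim ` ?A" using Max_in[OF fin] m by auto
  then obtain W where W: "subspace W" "W \<subseteq> V" "\<forall>w\<in>W. w \<noteq> 0 \<longrightarrow> mink w w < 0" "dim W = 1"
    by auto
  then obtain w where "w \<in> W" "w \<noteq> 0" by (metis dim_eq_0 insertCI subsetI singletonD zero_neq_one)
  then show ?thesis using that W by blast
qed

text \<open>As the ambient index is 1, a single timelike vector forces both nondegeneracy and index 1.\<close>

lemma lorentzian_spaceI:
  assumes "subspace V" "t \<in> V" "mink t t < 0"
  shows "lorentzian_space V"
proof -
  let ?A = "{W. subspace W \<and> W \<subseteq> V \<and> (\<forall>w\<in>W. w \<noteq> 0 \<longrightarrow> mink w w < 0)}"
  have "t \<noteq> 0" using assms(3) by (auto simp: mink_simps)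
  have "span {t} \<in> ?A"
  proof (intro CollectI conjI ballI impI)
    show "span {t} \<subseteq> V" using assms(1,2) by (simp add: span_minimal)
    fix w assume "w \<in> span {t}" "w \<noteq> 0"
    then obtain c where c: "w = c *\<^sub>R t" "c \<noteq> 0" by (auto simp: span_singleton)
    have "c * c > 0" using c(2) by (simp add: zero_less_mult_iff linorder_neq_iff) (metis linorder_less_linear)
    then have "(c * c) * mink t t < 0" using assms(3) by (simp add: mult_pos_neg)
    then show "mink w w < 0" by (simp add: c(1) mink_simps mult.assoc)
  qed simp
  moreover have "dim (span {t}) = 1" using \<open>t \<noteq> 0\<close> by (simp add: dim_span)
  ultimately have "1 \<in> dim ` ?A" by (metis (no_types, lifting) image_eqI)
  then have "metric_index V = 1"
    unfolding metric_index_def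
    by (intro Max_eqI finite_subset[of "dim ` ?A" "{..1}"]) (use negative_definite_dim_le_1 in auto)
  moreover have "nondegenerate V"
    unfolding nondegenerate_def
    using orthogonal_timelike_imp_spacelike[OF assms(3)] assms(2) mink_commute by (metis less_irrefl)
  ultimately show ?thesis by (simp add: lorentzian_space_def)
qed

lemma pseudo_orthonormal_commute: "pseudo_orthonormal u v \<Longrightarrow> pseudo_orthonormal v u"
  by (simp add: pseudo_orthonormal_def mink_commute)

text \<open>A Lorentzian plane has exactly two null lines, so two pseudo-orthonormal pairs in it differ by
  a rescaling and possibly by a swap. All independence of frames below rests on this.\<close>

lemma pseudo_orthonormal_rescaled:
  assumes "pseudo_orthonormal u v" "pseudo_orthonormal u' v'"
    and "u' = \<alpha> *\<^sub>R u + \<beta> *\<^sub>R v" "v' = \<gamma> *\<^sub>R u + \<delta> *\<^sub>R v"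
  obtains c where "c \<noteq> 0" "u' = c *\<^sub>R u" "v' = (1 / c) *\<^sub>R v"
  | c where "c \<noteq> 0" "u' = c *\<^sub>R v" "v' = (1 / c) *\<^sub>R u"
proof -
  have 1: "\<alpha> * \<beta> = 0" "\<gamma> * \<delta> = 0" "\<alpha> * \<delta> + \<beta> * \<gamma> = 1"
    using assms(1,2) unfolding assms(3,4)
    by (auto simp: pseudo_orthonormal_def mink_simps mink_commute[of v u] algebra_simps)
  show ?thesis
  proof (cases "\<beta> = 0")
    case True
    then have "\<alpha> * \<delta> = 1" using 1 by simp
    then have "\<alpha> \<noteq> 0" by auto
    moreover from this have "\<delta> = 1 / \<alpha>" "\<gamma> = 0"
      using 1 \<open>\<alpha> * \<delta> = 1\<close> by (auto simp: field_simps True)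
    ultimately show ?thesis using that(1)[of \<alpha>] True assms(3,4) by simp
  next
    case False
    then have "\<alpha> = 0" using 1 by simp
    then have "\<beta> * \<gamma> = 1" using 1 by simp
    then have "\<gamma> = 1 / \<beta>" using False by (simp add: field_simps)
    moreover from this have "\<delta> = 0" using 1 False by auto
    ultimately show ?thesis using that(2)[of \<beta>] False \<open>\<alpha> = 0\<close> assms(3,4) by simp
  qed
qed

text \<open>The factor is given by the Euclidean inner product, because in this form it depends smoothly on
  \<open>u\<close> and \<open>v\<close>.\<close>

lemma wedge_eq_0D:
  assumes "wedge u v = 0" "u \<noteq> 0"
  shows "v = ((v \<bullet> u) / (u \<bullet> u)) *\<^sub>R u"
proof -
  have e: "u$i * v$j = u$j * v$i" for i j
    using assms(1) by (simp add: wedge_def vec_eq_iff)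
  have "(u \<bullet> u) * v$i = (v \<bullet> u) * u$i" for i
  proof -
    have "u$j * u$j * v$i = v$j * u$j * u$i" for j using e[of i j] by (simp add: mult.commute)
    then show ?thesis by (simp only: inner_vec_def sum_distrib_right inner_real_def)
  qed
  moreover have "u \<bullet> u \<noteq> 0" using assms(2) by simp
  ultimately show ?thesis by (simp add: vec_eq_iff field_simps)
qed

section \<open>Patches of a surface\<close>

lemma patch_subset:
  assumes "patch M U x" "U' \<subseteq> U" "open U'"
  shows "patch M U' x"
proof -
  obtain y where y: "homeomorphism U (x ` U) x y" using assms(1) by (auto simp: patch_def)
  have "openin (top_of_set (x ` U)) (x ` U')"
    by (rule homeomorphism_imp_open_map[OF y]) (use assms(2,3) in \<open>auto simp: openin_open_eq openin_open\<close>)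
  moreover have "openin (top_of_set M) (x ` U)" using assms(1) by (simp add: patch_def)
  ultimately have "openin (top_of_set M) (x ` U')" by (rule openin_trans)
  moreover have "homeomorphism U' (x ` U') x y"
    by (rule homeomorphism_of_subsets[OF y assms(2)]) (use assms(2) in auto)
  moreover have "smooth_on U' x"
    using assms(1,2) smooth_on_subset by (auto simp: patch_def)
  ultimately show ?thesis
    using assms by (auto simp: patch_def)
qed

lemma patch_openin_iff:
  assumes "openin (top_of_set M) N"
  shows "patch N U x \<longleftrightarrow> patch M U x \<and> x ` U \<subseteq> N"
proof -
  have "openin (top_of_set N) (x ` U) \<longleftrightarrow> openin (top_of_set M) (x ` U) \<and> x ` U \<subseteq> N"
  proof
    assume "openin (top_of_set N) (x ` U)"
    then show "openin (top_of_set M) (x ` U) \<and> x ` U \<subseteq> N"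
      using openin_trans[OF _ assms] openin_imp_subset by blast
  next
    assume "openin (top_of_set M) (x ` U) \<and> x ` U \<subseteq> N"
    then show "openin (top_of_set N) (x ` U)"
      using openin_subset_trans[of M "x ` U" N] openin_imp_subset[OF assms] by blast
  qed
  then show ?thesis by (auto simp: patch_def)
qed

lemma patch_preimage_open:
  assumes "patch M U x" "openin (top_of_set M) W"
  shows "open {a \<in> U. x a \<in> W}"
proof -
  obtain O' where O: "open O'" "W = M \<inter> O'" using assms(2) by (auto simp: openin_open)
  have "openin (top_of_set M) (x ` U)" using assms(1) by (simp add: patch_def)
  then have "x ` U \<subseteq> M" by (rule openin_imp_subset)
  then have "{a \<in> U. x a \<in> W} = U \<inter> x -` O'" using O by auto
  moreover have "open (U \<inter> x -` O')"
    using assms(1) smooth_on_imp_continuous_on by (intro continuous_open_preimage O) (auto simp: patch_def)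
  ultimately show ?thesis by simp
qed

lemma at_within_openin:
  assumes "openin (top_of_set M) N" "p \<in> N"
  shows "at p within M = at p within N"
proof -
  obtain O' where O: "open O'" "N = M \<inter> O'" using assms(1) by (auto simp: openin_open)
  show ?thesis
    by (rule at_within_nhd[of p O']) (use O assms(2) in auto)
qed

locale surface_patch =
  fixes M U x
  assumes patch: "patch M U x"
begin

lemma open_U: "open U" and smooth_x: "smooth_on U x"
  and image_openin: "openin (top_of_set M) (x ` U)"
  and inj_derivative: "a \<in> U \<Longrightarrow> inj (\<D> x a)"
  using patch by (auto simp: patch_def)

lemma image_subset: "x ` U \<subseteq> M"
  using image_openin openin_imp_subset by blast

lemma x_has_derivative: "a \<in> U \<Longrightarrow> (x has_derivative \<D> x a) (at a)"
  by (rule smooth_on_has_derivative[OF smooth_x open_U])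

lemma linear_dx: "a \<in> U \<Longrightarrow> linear (\<D> x a)"
  using x_has_derivative has_derivative_linear by blast

definition chart where "chart = (SOME y. homeomorphism U (x ` U) x y)"

lemma homeo: "homeomorphism U (x ` U) x chart"
proof -
  have "\<exists>y. homeomorphism U (x ` U) x y" using patch by (simp add: patch_def)
  then show ?thesis unfolding chart_def by (rule someI_ex)
qed

lemma chart_x: "a \<in> U \<Longrightarrow> chart (x a) = a"
  using homeo by (auto simp: homeomorphism_def)

lemma chart_has_derivative:
  assumes "a \<in> U" "linear L" "L \<circ> \<D> x a = id"
  shows "(chart has_derivative L) (at (x a) within M)"
proof -
  have "(chart has_derivative L) (at (x a) within x ` U)"
  proof (rule has_derivative_inverse_within[OF _ _ assms])
    show "(x has_derivative \<D> x a) (at a within U)"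
      by (rule has_derivative_at_withinI[OF x_has_derivative[OF assms(1)]])
    show "continuous (at (x a) within x ` U) chart"
      using homeo assms(1) by (auto simp: homeomorphism_def continuous_on_eq_continuous_within)
  qed (rule chart_x)
  then show ?thesis
    using at_within_openin[OF image_openin] assms(1) by simp
qed

lemma dx_left_inverse:
  assumes "a \<in> U"
  obtains L where "linear L" "L \<circ> \<D> x a = id"
  using linear_injective_left_inverse[OF linear_dx inj_derivative] assms by blast

text \<open>Derivatives along the surface are computed in coordinates, because the inverse of a
  parametrization is differentiable within \<open>M\<close>, with a left inverse of the Jacobian as its
  derivative.\<close>

lemma dir_deriv_eq:
  assumes "open U'" "a \<in> U'" "U' \<subseteq> U" "\<And>b. b \<in> U' \<Longrightarrow> F (x b) = G b" "G differentiable at a"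
  shows "dir_deriv M F (x a) (\<D> x a v) = \<D> G a v"
proof -
  have a: "a \<in> U" using assms(2,3) by blast
  interpret sub: surface_patch M U' x
    by unfold_locales (rule patch_subset[OF patch assms(3,1)])
  note within = at_within_openin[OF sub.image_openin imageI[OF assms(2)]]
  obtain L where L: "linear L" "L \<circ> \<D> x a = id"
    using dx_left_inverse[OF a] .
  have G: "(G has_derivative \<D> G a) (at a)"
    using assms(5) by (simp add: frechet_derivative_works)
  have "(G \<circ> chart has_derivative \<D> G a \<circ> L) (at (x a) within x ` U')"
    using chart_has_derivative[OF a L] G chart_x[OF a] within
    by (intro diff_chain_within) (auto intro: has_derivative_at_withinI)
  then have "(F has_derivative \<D> G a \<circ> L) (at (x a) within x ` U')"
    by (rule has_derivative_transform[rotated 2]) (use assms(2,3,4) chart_x in auto)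
  then have "F differentiable (at (x a) within x ` U')"
    by (auto simp: differentiable_def)
  then have "(F has_derivative frechet_derivative F (at (x a) within x ` U')) (at (x a) within x ` U')"
    by (simp add: frechet_derivative_works)
  from diff_chain_within[OF has_derivative_at_withinI[OF x_has_derivative[OF a]] this]
  have "(F \<circ> x has_derivative frechet_derivative F (at (x a) within x ` U') \<circ> \<D> x a)
      (at a)"
    using at_within_open[OF assms(2,1)] by simp
  then have "(G has_derivative frechet_derivative F (at (x a) within x ` U') \<circ> \<D> x a)
      (at a)"
    by (rule has_derivative_transform_within_open[OF _ assms(1,2)]) (simp add: assms(4))
  from frechet_derivative_at[OF this, symmetric] within show ?thesis
    by (simp add: dir_deriv_def)
qed

lemma dir_deriv_ddir:
  assumes "open U'" "a \<in> U'" "U' \<subseteq> U" "\<And>b. b \<in> U' \<Longrightarrow> F (x b) = G b" "G differentiable at a"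
  shows "dir_deriv M F (x a) (ddir \<zeta> x a) = ddir \<zeta> G a"
  unfolding ddir_def by (rule dir_deriv_eq[where F=F, OF assms])

lemma derivative_through_chart:
  fixes z :: "'a::euclidean_space \<Rightarrow> real^4"
  assumes "(z has_derivative z') (at b)" "open V" "b \<in> V" "z ` V \<subseteq> M" "a \<in> U" "z b = x a"
    and "linear L" "L \<circ> \<D> x a = id"
  shows "((\<lambda>c. chart (z c)) has_derivative (\<lambda>v. L (z' v))) (at b)"
proof -
  have "(chart has_derivative L) (at (z b) within z ` V)"
    using chart_has_derivative[OF assms(5,7,8)] assms(4,6) has_derivative_subset by metis
  from diff_chain_within[OF has_derivative_at_withinI[OF assms(1)] this]
  show ?thesis
    using at_within_open[OF assms(3,2)] by (simp add: o_def)
qed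

text \<open>Another parametrization \<open>z\<close> through the same point factors as \<open>x \<circ> (chart \<circ> z)\<close>, so that the
  range of its derivative lies in that of the derivative of \<open>x\<close>.\<close>

lemma tangent_space_eq:
  assumes a: "a \<in> U"
  shows "tangent_space M (x a) = range (\<D> x a)"
proof
  show "range (\<D> x a) \<subseteq> tangent_space M (x a)"
    using patch a by (auto simp: tangent_space_def)
  show "tangent_space M (x a) \<subseteq> range (\<D> x a)"
  proof
    fix X assume "X \<in> tangent_space M (x a)"
    then obtain V z b v where z: "patch M V z" "b \<in> V" "z b = x a"
      "X = \<D> z b v" by (auto simp: tangent_space_def)
    interpret z: surface_patch M V z by unfold_locales (rule z)
    define V' where "V' = {b \<in> V. z b \<in> x ` U}"
    have V': "open V'" "b \<in> V'"
      unfolding V'_def using patch_preimage_open[OF z(1) image_openin] z(2,3) a by auto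
    obtain L where L: "linear L" "L \<circ> \<D> x a = id"
      using dx_left_inverse[OF a] .
    let ?z' = "\<D> z b"
    have "((\<lambda>c. chart (z c)) has_derivative (\<lambda>v. L (?z' v))) (at b)"
      by (rule derivative_through_chart[OF z.x_has_derivative[OF z(2)] z.open_U z(2) z.image_subset a z(3) L])
    moreover have "chart (z b) = a" using z(3) chart_x[OF a] by simp
    ultimately have "(x \<circ> (\<lambda>c. chart (z c)) has_derivative \<D> x a \<circ> (\<lambda>v. L (?z' v))) (at b)"
      using x_has_derivative[OF a] by (intro diff_chain_at) simp_all
    then have "(z has_derivative \<D> x a \<circ> (\<lambda>v. L (?z' v))) (at b)"
      by (rule has_derivative_transform_within_open[OF _ V']) (auto simp: V'_def chart_x)
    then have "?z' = \<D> x a \<circ> (\<lambda>v. L (?z' v))"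
      by (metis frechet_derivative_at)
    then show "X \<in> range (\<D> x a)"
      using z(4) by (metis comp_apply rangeI)
  qed
qed

lemma subspace_tangent_space: "a \<in> U \<Longrightarrow> subspace (tangent_space M (x a))"
  using linear_subspace_image[OF linear_dx subspace_UNIV] by (simp add: tangent_space_eq)

end

text \<open>A patch of \<open>M\<close> can be shrunk to a patch of an open part, so tangent spaces are the same.\<close>

lemma tangent_space_openin:
  assumes "openin (top_of_set M) N" "surface M" "p \<in> N"
  shows "tangent_space N p = tangent_space M p"
    and "\<exists>U x. patch N U x \<and> p \<in> x ` U"
proof -
  have "p \<in> M" using assms openin_imp_subset by blast
  then obtain U x a where x: "patch M U x" "a \<in> U" "x a = p"
    using assms(2) by (force simp: surface_def)
  define U' where "U' = {a \<in> U. x a \<in> N}"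
  have "open U'" unfolding U'_def by (rule patch_preimage_open[OF x(1) assms(1)])
  moreover have U': "U' \<subseteq> U" "x ` U' \<subseteq> N" "a \<in> U'" using x assms(3) by (auto simp: U'_def)
  ultimately have M: "patch M U' x" using patch_subset[OF x(1)] by blast
  then have N: "patch N U' x" using patch_openin_iff[OF assms(1)] U' by blast
  then show "\<exists>U x. patch N U x \<and> p \<in> x ` U" using U'(3) x(3) by blast
  interpret M: surface_patch M U' x by unfold_locales (rule M)
  interpret N: surface_patch N U' x by unfold_locales (rule N)
  show "tangent_space N p = tangent_space M p"
    using M.tangent_space_eq[OF U'(3)] N.tangent_space_eq[OF U'(3)] x(3) by simp
qed

section \<open>Pseudo-orthonormal frames in coordinates\<close>

text \<open>The component of \<open>w\<close> orthogonal to the plane of a pseudo-orthonormal pair \<open>u\<close>, \<open>v\<close>.\<close>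

definition normal_comp :: "real^4 \<Rightarrow> real^4 \<Rightarrow> real^4 \<Rightarrow> real^4" where
  "normal_comp u v w = w + mink w v *\<^sub>R u + mink w u *\<^sub>R v"

lemma normal_comp_commute: "normal_comp v u = normal_comp u v"
  by (simp add: normal_comp_def fun_eq_iff)

lemma normal_comp_simps:
  "normal_comp u v (w + w') = normal_comp u v w + normal_comp u v w'"
  "normal_comp u v (w - w') = normal_comp u v w - normal_comp u v w'"
  "normal_comp u v (c *\<^sub>R w) = c *\<^sub>R normal_comp u v w"
  by (simp_all add: normal_comp_def mink_simps algebra_simps)

lemma normal_comp_frame:
  assumes "pseudo_orthonormal u v"
  shows "normal_comp u v u = 0" "normal_comp u v v = 0"
    "mink (normal_comp u v w) u = 0" "mink (normal_comp u v w) v = 0"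
  using assms by (simp_all add: pseudo_orthonormal_def normal_comp_def mink_simps mink_commute[of v u])

text \<open>The value of the second fundamental form on the images of two vector fields \<open>\<zeta>\<close>, \<open>\<eta>\<close> of the
  coordinate domain (see \<open>second_ff_eq\<close>), where \<open>\<xi>1\<close> and \<open>\<xi>2\<close> give the frame.\<close>

definition sff where
  "sff x \<xi>1 \<xi>2 \<zeta> \<eta> a = normal_comp (ddir \<xi>1 x a) (ddir \<xi>2 x a) (ddir \<zeta> (ddir \<eta> x) a)"

text \<open>The connection coefficient of the frame: the Levi-Civita derivatives of \<open>F1\<close> and \<open>F2\<close> along
  \<open>\<zeta>\<close> are \<open>\<phi> \<zeta> *\<^sub>R F1\<close> and \<open>- \<phi> \<zeta> *\<^sub>R F2\<close> (see \<open>ddir_F\<close>).\<close>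

definition conn where
  "conn x \<xi>1 \<xi>2 \<zeta> a = - mink (ddir \<zeta> (ddir \<xi>1 x) a) (ddir \<xi>2 x a)"

lemma sff_swap: "sff x \<xi>2 \<xi>1 = sff x \<xi>1 \<xi>2"
  by (simp add: sff_def normal_comp_commute fun_eq_iff)

text \<open>The frame is given by its components \<open>\<xi>1\<close>, \<open>\<xi>2\<close> in the coordinate domain, so that derivatives
  along the frame, and the Lie bracket of its members, are taken on an open set of the plane.\<close>

locale framed_patch = surface_patch M U x for M U x +
  fixes \<xi>1 \<xi>2 :: "real^2 \<Rightarrow> real^2"
  assumes smooth_xi: "smooth_on U \<xi>1" "smooth_on U \<xi>2"
    and frame: "a \<in> U \<Longrightarrow> pseudo_orthonormal (ddir \<xi>1 x a) (ddir \<xi>2 x a)"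
begin

abbreviation "F1 \<equiv> ddir \<xi>1 x"
abbreviation "F2 \<equiv> ddir \<xi>2 x"
abbreviation "N11 \<equiv> sff x \<xi>1 \<xi>2 \<xi>1 \<xi>1"
abbreviation "N12 \<equiv> sff x \<xi>1 \<xi>2 \<xi>1 \<xi>2"
abbreviation "N22 \<equiv> sff x \<xi>1 \<xi>2 \<xi>2 \<xi>2"
abbreviation "\<phi> \<equiv> conn x \<xi>1 \<xi>2"

lemma swapped: "framed_patch M U x \<xi>2 \<xi>1"
  by unfold_locales (use smooth_xi frame pseudo_orthonormal_commute in auto)

lemma smooth_F: "smooth_on U F1" "smooth_on U F2"
  using smooth_xi smooth_x open_U by (auto intro: smooth_on_ddir)

lemma diff_F: "a \<in> U \<Longrightarrow> F1 differentiable at a" "a \<in> U \<Longrightarrow> F2 differentiable at a"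
  using smooth_on_differentiable[OF _ open_U] smooth_F by auto

lemma mink_F:
  assumes "a \<in> U"
  shows "mink (F1 a) (F1 a) = 0" "mink (F2 a) (F2 a) = 0" "mink (F1 a) (F2 a) = -1" "mink (F2 a) (F1 a) = -1"
  using frame[OF assms] by (simp_all add: pseudo_orthonormal_def mink_commute)

lemma mink_ddir_F:
  assumes a: "a \<in> U"
  shows "mink (ddir \<zeta> F1 a) (F1 a) = 0" "mink (ddir \<zeta> F2 a) (F2 a) = 0"
    "mink (ddir \<zeta> F1 a) (F2 a) = - mink (F1 a) (ddir \<zeta> F2 a)"
proof -
  have e: "ddir \<zeta> (\<lambda>b. mink (G b) (H b)) a = 0"
    if "G differentiable at a" "H differentiable at a" "\<And>b. b \<in> U \<Longrightarrow> mink (G b) (H b) = c"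
    for G H :: "real^2 \<Rightarrow> real^4" and c
    using ddir_cong[OF open_U a that(3)] differentiable_bounded_bilinear[OF bounded_bilinear_mink that(1,2)]
    by simp
  show "mink (ddir \<zeta> F1 a) (F1 a) = 0" "mink (ddir \<zeta> F2 a) (F2 a) = 0"
    "mink (ddir \<zeta> F1 a) (F2 a) = - mink (F1 a) (ddir \<zeta> F2 a)"
    using e[OF diff_F(1)[OF a] diff_F(1)[OF a], of 0] e[OF diff_F(2)[OF a] diff_F(2)[OF a], of 0]
      e[OF diff_F(1)[OF a] diff_F(2)[OF a], of "-1"] mink_F
    by (simp_all add: ddir_mink diff_F[OF a] mink_commute)
qed

lemma conn_swap: "a \<in> U \<Longrightarrow> conn x \<xi>2 \<xi>1 \<zeta> a = - \<phi> \<zeta> a"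
  using mink_ddir_F(3)[of a \<zeta>] by (simp add: conn_def mink_commute)

lemma ddir_F:
  assumes "a \<in> U"
  shows "ddir \<zeta> F1 a = \<phi> \<zeta> a *\<^sub>R F1 a + sff x \<xi>1 \<xi>2 \<zeta> \<xi>1 a"
    "ddir \<zeta> F2 a = - \<phi> \<zeta> a *\<^sub>R F2 a + sff x \<xi>1 \<xi>2 \<zeta> \<xi>2 a"
  using mink_ddir_F[OF assms, of \<zeta>]
  by (simp_all add: conn_def sff_def normal_comp_def mink_commute[of "F1 a"])

lemma normal_comp_F:
  assumes "a \<in> U"
  shows "normal_comp (F1 a) (F2 a) (F1 a) = 0" "normal_comp (F1 a) (F2 a) (F2 a) = 0"
  using normal_comp_frame[OF frame[OF assms]] by auto

lemma mink_sff:
  assumes "a \<in> U"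
  shows "mink (sff x \<xi>1 \<xi>2 \<zeta> \<eta> a) (F1 a) = 0" "mink (sff x \<xi>1 \<xi>2 \<zeta> \<eta> a) (F2 a) = 0"
    "mink (F1 a) (sff x \<xi>1 \<xi>2 \<zeta> \<eta> a) = 0" "mink (F2 a) (sff x \<xi>1 \<xi>2 \<zeta> \<eta> a) = 0"
  using normal_comp_frame[OF frame[OF assms]] by (simp_all add: sff_def mink_commute)

lemma dx_combination:
  "a \<in> U \<Longrightarrow> \<D> x a (\<alpha> *\<^sub>R \<xi>1 a + \<beta> *\<^sub>R \<xi>2 a) = \<alpha> *\<^sub>R F1 a + \<beta> *\<^sub>R F2 a"
  using linear_dx by (simp add: linear_add linear_scale ddir_def)

text \<open>With an arbitrary vector in place of the image of \<open>v\<close>, the right-hand side is a left inverse of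
  the Jacobian that varies smoothly with the point.\<close>

lemma coordinates:
  assumes a: "a \<in> U"
  shows "v = (- mink (\<D> x a v) (F2 a)) *\<^sub>R \<xi>1 a
           + (- mink (\<D> x a v) (F1 a)) *\<^sub>R \<xi>2 a"
proof -
  have ind: "\<alpha> = 0 \<and> \<beta> = 0" if "\<alpha> *\<^sub>R \<xi>1 a + \<beta> *\<^sub>R \<xi>2 a = 0" for \<alpha> \<beta>
  proof -
    have "\<alpha> *\<^sub>R F1 a + \<beta> *\<^sub>R F2 a = 0"
      using dx_combination[OF a, of \<alpha> \<beta>] that linear_0[OF linear_dx[OF a]] by simp
    then have "mink (\<alpha> *\<^sub>R F1 a + \<beta> *\<^sub>R F2 a) (F1 a) = 0" "mink (\<alpha> *\<^sub>R F1 a + \<beta> *\<^sub>R F2 a) (F2 a) = 0"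
      by (simp_all add: mink_simps)
    then show ?thesis by (simp add: mink_simps mink_F[OF a])
  qed
  have ne: "\<xi>1 a \<noteq> \<xi>2 a" using ind[of 1 "-1"] by auto
  have "independent {\<xi>1 a, \<xi>2 a}"
    using ind[of 1] ind[of 0 1] by (auto simp: independent_insert span_singleton ne) (metis add.commute add_diff_cancel_right' diff_self one_neq_zero scaleR_minus_left scaleR_one uminus_add_conv_diff)
  then have "UNIV \<subseteq> span {\<xi>1 a, \<xi>2 a}"
    by (intro card_ge_dim_independent) (auto simp: ne)
  then have "v \<in> span {\<xi>1 a, \<xi>2 a}" by auto
  then obtain \<alpha> \<beta> where v: "v = \<alpha> *\<^sub>R \<xi>1 a + \<beta> *\<^sub>R \<xi>2 a"
    by (auto simp: span_insert span_singleton algebra_simps)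
  have "\<D> x a v = \<alpha> *\<^sub>R F1 a + \<beta> *\<^sub>R F2 a"
    unfolding v by (rule dx_combination[OF a])
  then show ?thesis by (simp add: mink_simps mink_F[OF a] flip: v)
qed

lemma tangent_iff:
  assumes "a \<in> U"
  shows "X \<in> tangent_space M (x a) \<longleftrightarrow> (\<exists>\<alpha> \<beta>. X = \<alpha> *\<^sub>R F1 a + \<beta> *\<^sub>R F2 a)"
proof
  assume "X \<in> tangent_space M (x a)"
  then obtain v where "X = \<D> x a v"
    by (auto simp: tangent_space_eq[OF assms])
  then show "\<exists>\<alpha> \<beta>. X = \<alpha> *\<^sub>R F1 a + \<beta> *\<^sub>R F2 a"
    by (metis coordinates[OF assms] dx_combination[OF assms])
next
  assume "\<exists>\<alpha> \<beta>. X = \<alpha> *\<^sub>R F1 a + \<beta> *\<^sub>R F2 a"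
  then show "X \<in> tangent_space M (x a)"
    by (metis dx_combination[OF assms] rangeI tangent_space_eq[OF assms])
qed

lemma tangent_combination:
  "a \<in> U \<Longrightarrow> \<alpha> *\<^sub>R F1 a + \<beta> *\<^sub>R F2 a \<in> tangent_space M (x a)"
  "a \<in> U \<Longrightarrow> F1 a \<in> tangent_space M (x a)" "a \<in> U \<Longrightarrow> F2 a \<in> tangent_space M (x a)"
proof -
  show t: "\<alpha> *\<^sub>R F1 a + \<beta> *\<^sub>R F2 a \<in> tangent_space M (x a)" if "a \<in> U" for \<alpha> \<beta>
    using tangent_iff[OF that] by blast
  show "a \<in> U \<Longrightarrow> F1 a \<in> tangent_space M (x a)" "a \<in> U \<Longrightarrow> F2 a \<in> tangent_space M (x a)"
    using t[of 1 0] t[of 0 1] by simp_all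
qed

lemma tangent_expansion:
  assumes "a \<in> U" "X \<in> tangent_space M (x a)"
  shows "X = (- mink X (F2 a)) *\<^sub>R F1 a + (- mink X (F1 a)) *\<^sub>R F2 a"
  using assms tangent_iff[OF assms(1)] by (auto simp: mink_simps mink_F)

lemma tangential_part_eq:
  assumes a: "a \<in> U"
  shows "tangential_part (tangent_space M (x a)) w = (- mink w (F2 a)) *\<^sub>R F1 a + (- mink w (F1 a)) *\<^sub>R F2 a"
  unfolding tangential_part_def
proof (rule the_equality)
  show "(- mink w (F2 a)) *\<^sub>R F1 a + (- mink w (F1 a)) *\<^sub>R F2 a \<in> tangent_space M (x a) \<and>
    (\<forall>v\<in>tangent_space M (x a). mink (w - ((- mink w (F2 a)) *\<^sub>R F1 a + (- mink w (F1 a)) *\<^sub>R F2 a)) v = 0)"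
    by (auto simp: tangent_iff[OF a] mink_simps mink_F[OF a] simp del: scaleR_minus_left)
next
  fix t assume t: "t \<in> tangent_space M (x a) \<and> (\<forall>v\<in>tangent_space M (x a). mink (w - t) v = 0)"
  note tangent_combination(2,3)[OF a]
  then have "mink t (F1 a) = mink w (F1 a)" "mink t (F2 a) = mink w (F2 a)"
    using t by (auto simp: mink_simps)
  then show "t = (- mink w (F2 a)) *\<^sub>R F1 a + (- mink w (F1 a)) *\<^sub>R F2 a"
    using tangent_expansion[OF a] t by metis
qed

lemma normal_part_eq:
  "a \<in> U \<Longrightarrow> normal_part (tangent_space M (x a)) w = normal_comp (F1 a) (F2 a) w"
  by (simp add: normal_part_def tangential_part_eq normal_comp_def)

text \<open>The difference of the two derivatives is the image of a Lie bracket, hence tangent.\<close>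

lemma sff_symmetric:
  assumes a: "a \<in> U"
  shows "sff x \<xi>1 \<xi>2 \<xi>2 \<xi>1 a = N12 a"
proof -
  let ?v = "ddir \<xi>1 \<xi>2 a - ddir \<xi>2 \<xi>1 a"
  have "ddir \<xi>1 F2 a - ddir \<xi>2 F1 a = \<D> x a ?v"
    by (rule ddir_commutator[OF open_U smooth_x smooth_xi a])
  moreover have "\<D> x a ?v \<in> tangent_space M (x a)"
    by (simp add: tangent_space_eq[OF a])
  ultimately obtain \<alpha> \<beta> where "ddir \<xi>1 F2 a - ddir \<xi>2 F1 a = \<alpha> *\<^sub>R F1 a + \<beta> *\<^sub>R F2 a"
    using tangent_iff[OF a] by auto
  then have "normal_comp (F1 a) (F2 a) (ddir \<xi>1 F2 a - ddir \<xi>2 F1 a) = 0"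
    by (simp add: normal_comp_simps normal_comp_F[OF a])
  then show ?thesis by (simp add: sff_def normal_comp_simps)
qed

text \<open>Changes of coordinates are smooth. In terms of the frame, a left inverse of the Jacobian
  depends smoothly on the point; so the derivative of \<open>chart \<circ> z\<close> is a smooth expression in
  \<open>chart \<circ> z\<close> itself, which therefore gains one order of differentiability at a time.\<close>

lemma smooth_transition:
  assumes z: "patch M V z" "z ` V \<subseteq> x ` U"
  shows "smooth_on V (\<lambda>c. chart (z c))"
proof -
  interpret z: surface_patch M V z by unfold_locales (rule z)
  define \<theta> where "\<theta> c = chart (z c)" for c
  have \<theta>: "\<theta> c \<in> U" "x (\<theta> c) = z c" if c: "c \<in> V" for c
  proof -
    obtain a where "a \<in> U" "z c = x a" using z(2) c by blast
    then show "\<theta> c \<in> U" "x (\<theta> c) = z c" by (simp_all add: \<theta>_def chart_x)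
  qed
  then have sub: "\<theta> ` V \<subseteq> U" by auto
  define L where "L a w = mink w (F2 a) *\<^sub>R (- \<xi>1 a) + mink w (F1 a) *\<^sub>R (- \<xi>2 a)" for a w
  have L: "linear (L a)" "L a \<circ> \<D> x a = id" if "a \<in> U" for a
    using coordinates[OF that, symmetric]
    by (auto simp: L_def linear_iff mink_simps algebra_simps fun_eq_iff)
  have deriv: "(\<theta> has_derivative (\<lambda>v. L (\<theta> c) (\<D> z c v))) (at c)" if c: "c \<in> V" for c
    unfolding \<theta>_def[abs_def]
    by (rule derivative_through_chart[OF z.x_has_derivative[OF c] z.open_U c z.image_subset
          \<theta>(1)[OF c, unfolded \<theta>_def] \<theta>(2)[OF c, unfolded \<theta>_def, symmetric] L[OF \<theta>(1)[OF c, unfolded \<theta>_def]]])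
  have "Ck_on k V \<theta>" for k
  proof (induction k)
    case 0
    have "\<theta> differentiable_on V"
      using deriv z.open_U by (auto simp: differentiable_on_eq_differentiable_at differentiable_def)
    then show ?case by (simp add: differentiable_imp_continuous_on)
  next
    case (Suc k)
    have comp: "Ck_on k V (\<lambda>c. G (\<theta> c))" if "smooth_on U G" for G :: "real^2 \<Rightarrow> 'n::euclidean_space"
      by (rule Ck_on_compose[OF z.open_U open_U sub _ Suc]) (use that in \<open>simp add: smooth_on_def\<close>)
    have dz: "Ck_on k V (\<lambda>c. \<D> z c v)" for v
      using smooth_on_ddir_const[OF z.smooth_x] by (simp add: smooth_on_def)
    note mink = Ck_on_bounded_bilinear[OF z.open_U bounded_bilinear_mink]
    note scaleR = Ck_on_bounded_bilinear[OF z.open_U bounded_bilinear_scaleR]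
    have "Ck_on k V (\<lambda>c. L (\<theta> c) (\<D> z c v))" for v
      unfolding L_def
      by (rule Ck_on_add[OF z.open_U scaleR[OF mink[OF dz comp] comp] scaleR[OF mink[OF dz comp] comp]])
        (rule smooth_F smooth_on_minus open_U smooth_xi)+
    from Ck_on_SucI[OF z.open_U deriv this] show ?case .
  qed
  then show ?thesis by (simp add: smooth_on_def \<theta>_def[abs_def])
qed

lemma smooth_map_through_chart:
  assumes "smooth_on U G"
  shows "smooth_map (x ` U) (\<lambda>q. G (chart q))"
  unfolding smooth_map_def
proof (intro allI impI)
  fix V z assume z: "patch (x ` U) V z"
  have zM: "patch M V z" "z ` V \<subseteq> x ` U" using z patch_openin_iff[OF image_openin] by auto
  have "smooth_on V (\<lambda>c. G (chart (z c)))"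
    by (rule smooth_on_compose[OF _ open_U _ assms smooth_transition[OF zM]])
      (use z zM(2) chart_x in \<open>auto simp: patch_def\<close>)
  then show "smooth_on V ((\<lambda>q. G (chart q)) \<circ> z)" by (simp add: o_def)
qed

lemma tangent_field_through_chart:
  assumes "smooth_on U G" "\<And>b. b \<in> U \<Longrightarrow> G b \<in> tangent_space M (x b)"
  shows "tangent_field M (x ` U) (\<lambda>q. G (chart q))"
  using smooth_map_through_chart[OF assms(1)] assms(2) by (auto simp: tangent_field_def chart_x)

text \<open>A tangential extension of the second argument is a combination of \<open>F1\<close> and \<open>F2\<close> with
  differentiable coefficients. The terms in which the coefficients are differentiated are tangent,
  so the normal part depends on the values of the coefficients at the point only.\<close>

lemma second_ff_eq:
  assumes a: "a \<in> U"
  shows "second_ff M (x a) (\<alpha>1 *\<^sub>R F1 a + \<alpha>2 *\<^sub>R F2 a) (\<beta>1 *\<^sub>R F1 a + \<beta>2 *\<^sub>R F2 a)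
    = (\<alpha>1 * \<beta>1) *\<^sub>R N11 a + (\<alpha>1 * \<beta>2 + \<alpha>2 * \<beta>1) *\<^sub>R N12 a + (\<alpha>2 * \<beta>2) *\<^sub>R N22 a" (is "?L = ?R")
proof -
  define v where "v = \<alpha>1 *\<^sub>R \<xi>1 a + \<alpha>2 *\<^sub>R \<xi>2 a"
  define X where "X = \<alpha>1 *\<^sub>R F1 a + \<alpha>2 *\<^sub>R F2 a"
  define w where "w = \<beta>1 *\<^sub>R F1 a + \<beta>2 *\<^sub>R F2 a"
  have X: "X = \<D> x a v" by (simp add: X_def v_def dx_combination[OF a])
  define \<zeta> where "\<zeta> = (\<lambda>b. \<alpha>1 *\<^sub>R \<xi>1 b + \<alpha>2 *\<^sub>R \<xi>2 b)"
  have *: "normal_part (tangent_space M (x a)) (dir_deriv M Y (x a) X) = ?R"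
    if W: "openin (top_of_set M) W" "x a \<in> W" and Y: "tangent_field M W Y" "Y (x a) = w" for W Y
  proof -
    define U' where "U' = {b \<in> U. x b \<in> W}"
    have U': "open U'" "a \<in> U'" "U' \<subseteq> U"
      unfolding U'_def using patch_preimage_open[OF patch W(1)] W(2) a by auto
    have "patch M U' x" by (rule patch_subset[OF patch U'(3,1)])
    then have "patch W U' x" using patch_openin_iff[OF W(1)] by (auto simp: U'_def)
    then have sY: "smooth_on U' (\<lambda>b. Y (x b))"
      using Y(1) by (auto simp: tangent_field_def smooth_map_def o_def)
    define c1 where "c1 b = - mink (Y (x b)) (F2 b)" for b
    define c2 where "c2 b = - mink (Y (x b)) (F1 b)" for b
    have "smooth_on U' c1" "smooth_on U' c2"
      unfolding c1_def c2_def
      by (intro smooth_on_minus smooth_on_mink U'(1) sY smooth_on_subset[OF smooth_F(1) U'(3)]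
          smooth_on_subset[OF smooth_F(2) U'(3)])+
    then have c: "c1 differentiable at a" "c2 differentiable at a"
      using smooth_on_differentiable U' by blast+
    have eq: "Y (x b) = c1 b *\<^sub>R F1 b + c2 b *\<^sub>R F2 b" if "b \<in> U'" for b
      unfolding c1_def c2_def
      by (rule tangent_expansion) (use that Y(1) in \<open>auto simp: U'_def tangent_field_def\<close>)
    have ca: "c1 a = \<beta>1" "c2 a = \<beta>2"
      by (simp_all add: c1_def c2_def Y(2) w_def mink_simps mink_F[OF a])
    have d: "(\<lambda>b. c1 b *\<^sub>R F1 b) differentiable at a" "(\<lambda>b. c2 b *\<^sub>R F2 b) differentiable at a"
      by (intro differentiable_scaleR c diff_F a)+
    have "dir_deriv M Y (x a) (ddir \<zeta> x a) = ddir \<zeta> (\<lambda>b. c1 b *\<^sub>R F1 b + c2 b *\<^sub>R F2 b) a"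
      by (rule dir_deriv_ddir[where F=Y, OF U']) (auto intro: d eq differentiable_add)
    then have "dir_deriv M Y (x a) X = ddir \<zeta> (\<lambda>b. c1 b *\<^sub>R F1 b + c2 b *\<^sub>R F2 b) a"
      by (simp add: X v_def \<zeta>_def ddir_def)
    also have "\<dots> = c1 a *\<^sub>R ddir \<zeta> F1 a + ddir \<zeta> c1 a *\<^sub>R F1 a + (c2 a *\<^sub>R ddir \<zeta> F2 a + ddir \<zeta> c2 a *\<^sub>R F2 a)"
      by (simp add: ddir_add d ddir_scaleR c diff_F a)
    also have "\<dots> = \<beta>1 *\<^sub>R (\<alpha>1 *\<^sub>R ddir \<xi>1 F1 a + \<alpha>2 *\<^sub>R ddir \<xi>2 F1 a) + ddir \<zeta> c1 a *\<^sub>R F1 a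
        + (\<beta>2 *\<^sub>R (\<alpha>1 *\<^sub>R ddir \<xi>1 F2 a + \<alpha>2 *\<^sub>R ddir \<xi>2 F2 a) + ddir \<zeta> c2 a *\<^sub>R F2 a)"
      by (simp add: ca \<zeta>_def ddir_direction_linear diff_F a)
    finally show ?thesis
      using sff_symmetric[OF a]
      by (simp add: normal_part_eq[OF a] normal_comp_simps normal_comp_F[OF a] sff_def algebra_simps)
  qed
  let ?G = "\<lambda>b. \<beta>1 *\<^sub>R F1 b + \<beta>2 *\<^sub>R F2 b"
  have Y: "tangent_field M (x ` U) (\<lambda>q. ?G (chart q))" "?G (chart (x a)) = w" "x a \<in> x ` U"
    by (rule tangent_field_through_chart[OF smooth_on_add[OF open_U
          smooth_on_scaleR[OF open_U smooth_on_const smooth_F(1)]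
          smooth_on_scaleR[OF open_U smooth_on_const smooth_F(2)]] tangent_combination(1)])
      (simp_all add: w_def chart_x a)
  show ?thesis
    unfolding second_ff_def X_def[symmetric] w_def[symmetric]
  proof (rule the_equality)
    show "\<exists>W Y. openin (top_of_set M) W \<and> x a \<in> W \<and> tangent_field M W Y \<and> Y (x a) = w \<and>
        ?R = normal_part (tangent_space M (x a)) (dir_deriv M Y (x a) X)"
      using *[OF image_openin Y(3,1,2)] image_openin Y
      by (intro exI[of _ "x ` U"] exI[of _ "\<lambda>q. ?G (chart q)"]) (simp only: simp_thms)
  qed (use * in blast)
qed

lemma second_ff_frame:
  assumes a: "a \<in> U"
  shows "second_ff M (x a) (c *\<^sub>R F1 a) (d *\<^sub>R F1 a) = (c * d) *\<^sub>R N11 a"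
    "second_ff M (x a) (c *\<^sub>R F1 a) (d *\<^sub>R F2 a) = (c * d) *\<^sub>R N12 a"
    "second_ff M (x a) (c *\<^sub>R F2 a) (d *\<^sub>R F1 a) = (c * d) *\<^sub>R N12 a"
    "second_ff M (x a) (c *\<^sub>R F2 a) (d *\<^sub>R F2 a) = (c * d) *\<^sub>R N22 a"
  using second_ff_eq[OF a, of c 0 d 0] second_ff_eq[OF a, of c 0 0 d]
    second_ff_eq[OF a, of 0 c d 0] second_ff_eq[OF a, of 0 c 0 d] by simp_all

lemma mean_curvature_eq:
  assumes a: "a \<in> U"
  shows "mean_curvature M (x a) = - N12 a"
  unfolding mean_curvature_def
proof (rule the_equality)
  note tangent_combination(2,3)[OF a]
  then show "\<exists>u\<in>tangent_space M (x a). \<exists>v\<in>tangent_space M (x a).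
      pseudo_orthonormal u v \<and> - N12 a = - second_ff M (x a) u v"
    using second_ff_frame(2)[OF a, of 1 1] frame[OF a]
    by (intro bexI[of _ "F1 a"] bexI[of _ "F2 a"]) auto
next
  fix H assume "\<exists>u\<in>tangent_space M (x a). \<exists>v\<in>tangent_space M (x a).
      pseudo_orthonormal u v \<and> H = - second_ff M (x a) u v"
  then obtain u v \<alpha> \<beta> \<gamma> \<delta> where uv: "pseudo_orthonormal u v" "H = - second_ff M (x a) u v"
    "u = \<alpha> *\<^sub>R F1 a + \<beta> *\<^sub>R F2 a" "v = \<gamma> *\<^sub>R F1 a + \<delta> *\<^sub>R F2 a"
    unfolding tangent_iff[OF a] Bex_def by blast
  show "H = - N12 a"
    by (rule pseudo_orthonormal_rescaled[OF frame[OF a] uv(1,3,4)])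
      (simp_all only: uv(2) second_ff_frame[OF a], simp_all)
qed

end

lemma orthonormal_to_pseudo_orthonormal:
  assumes "mink t t = -1" "mink s s = 1" "mink t s = 0"
  shows "pseudo_orthonormal ((1 / sqrt 2) *\<^sub>R (t + s)) ((1 / sqrt 2) *\<^sub>R (t - s))"
  using assms by (simp add: pseudo_orthonormal_def mink_simps mink_commute[of s t])

text \<open>Gram-Schmidt orthogonalization, started with a coordinate direction that is timelike at the given
  point, yields an orthonormal frame \<open>t\<close>, \<open>s\<close>; then \<open>(t + s) / sqrt 2\<close> and \<open>(t - s) / sqrt 2\<close>
  are null. The vector fields \<open>\<zeta>1\<close>, \<open>\<zeta>2\<close> of the coordinate domain map to \<open>t\<close> and to the
  normalized \<open>s\<close>.\<close>

lemma exists_framed_patch: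
  assumes M: "lorentzian_surface M" and x: "patch M V x" "a \<in> V"
  obtains U \<xi>1 \<xi>2 where "framed_patch M U x \<xi>1 \<xi>2" "a \<in> U" "U \<subseteq> V"
proof -
  interpret V: surface_patch M V x by unfold_locales (rule x)
  have "x a \<in> M" using V.image_subset x(2) by auto
  then obtain t0 where t0: "t0 \<in> tangent_space M (x a)" "mink t0 t0 < 0"
    using M lorentzian_space_timelike[OF V.subspace_tangent_space[OF x(2)]]
    by (auto simp: lorentzian_surface_def)
  then obtain v where v: "t0 = \<D> x a v"
    by (auto simp: V.tangent_space_eq[OF x(2)])
  \<comment> \<open>A direction independent of \<open>v\<close>: its rotation by a right angle.\<close>
  define w :: "real^2" where "w = vector [- v$2, v$1]"
  have "v \<noteq> 0" using t0 v linear_0[OF V.linear_dx[OF x(2)]] by (auto simp: mink_simps)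
  have vw: "w + c *\<^sub>R v \<noteq> 0" for c
  proof
    assume "w + c *\<^sub>R v = 0"
    then have "- v$2 + c * v$1 = 0" "v$1 + c * v$2 = 0"
      by (auto simp: vec_eq_iff forall_2 w_def)
    then have e: "v$2 = c * v$1" "v$1 = - c * v$2" by linarith+
    have "v$1 * v$1 + v$2 * v$2 = (- c * v$2) * v$1 + (c * v$1) * v$2"
      by (subst (2) e(1)) (subst (1) e(2), simp)
    then have "v$1 * v$1 + v$2 * v$2 = 0" by simp
    then have "v$1 = 0 \<and> v$2 = 0" by (simp add: sum_squares_eq_zero_iff)
    then show False using \<open>v \<noteq> 0\<close> by (simp add: vec_eq_iff forall_2)
  qed
  define e1 where "e1 b = \<D> x b v" for b
  define e2 where "e2 b = \<D> x b w" for b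
  have se: "smooth_on V e1" "smooth_on V e2"
    unfolding e1_def e2_def by (rule smooth_on_ddir_const[OF V.smooth_x])+
  define E where "E b = - mink (e1 b) (e1 b)" for b
  have sE: "smooth_on V E" unfolding E_def by (intro smooth_on_minus smooth_on_mink se V.open_U)
  define U where "U = {b \<in> V. E b > 0}"
  have "U = V \<inter> E -` {0<..}" by (auto simp: U_def)
  moreover have "open (V \<inter> E -` {0<..})"
    by (rule continuous_open_preimage[OF smooth_on_imp_continuous_on[OF sE] V.open_U open_greaterThan])
  ultimately have U: "open U" by simp
  have UV: "U \<subseteq> V" and aU: "a \<in> U" using x(2) t0 v by (auto simp: U_def E_def e1_def)
  interpret surface_patch M U x by unfold_locales (rule patch_subset[OF x(1) UV U])
  have se': "smooth_on U e1" "smooth_on U e2" "smooth_on U E"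
    using smooth_on_subset[OF _ UV] se sE by auto
  define \<tau> where "\<tau> b = inverse (sqrt (E b))" for b
  have s\<tau>: "smooth_on U \<tau>"
    unfolding \<tau>_def
    by (rule smooth_on_inverse[OF U _ smooth_on_sqrt[OF U _ se'(3)]]) (auto simp: U_def)
  define t where "t b = \<tau> b *\<^sub>R e1 b" for b
  define \<sigma> where "\<sigma> b = mink (e2 b) (t b) * \<tau> b" for b
  define s where "s b = e2 b + \<sigma> b *\<^sub>R e1 b" for b
  have st: "smooth_on U t" unfolding t_def by (intro smooth_on_scaleR s\<tau> se' U)
  have s\<sigma>: "smooth_on U \<sigma>" unfolding \<sigma>_def by (intro smooth_on_mult smooth_on_mink s\<tau> st se' U)
  have ss: "smooth_on U s" unfolding s_def by (intro smooth_on_add smooth_on_scaleR s\<sigma> se' U)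
  have tt: "mink (t b) (t b) = -1" if "b \<in> U" for b
  proof -
    have "E b > 0" using that by (simp add: U_def)
    then have "\<tau> b * (\<tau> b * E b) = 1" by (simp add: \<tau>_def field_simps)
    then have "\<tau> b * (\<tau> b * mink (e1 b) (e1 b)) = -1" by (simp add: E_def)
    then show ?thesis by (simp only: t_def mink_simps)
  qed
  have ts: "mink (t b) (s b) = 0" if "b \<in> U" for b
  proof -
    have "s b = e2 b + mink (e2 b) (t b) *\<^sub>R t b" by (simp add: s_def \<sigma>_def t_def)
    then show ?thesis using tt[OF that] by (simp add: mink_simps mink_commute[of "t b" "e2 b"])
  qed
  have s_dx: "s b = \<D> x b (w + \<sigma> b *\<^sub>R v)" if "b \<in> U" for b
    using linear_dx[OF that] by (simp add: s_def e1_def e2_def linear_add linear_scale)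
  have S0: "mink (s b) (s b) > 0" if b: "b \<in> U" for b
  proof (rule orthogonal_timelike_imp_spacelike)
    show "mink (t b) (t b) < 0" using tt[OF b] by simp
    show "mink (t b) (s b) = 0" by (rule ts[OF b])
    show "s b \<noteq> 0"
      using s_dx[OF b] vw linear_dx[OF b] inj_derivative[OF b] by (metis linear_injective_0)
  qed
  define \<mu> where "\<mu> b = inverse (sqrt (mink (s b) (s b)))" for b
  have s\<mu>: "smooth_on U \<mu>"
    unfolding \<mu>_def
    by (rule smooth_on_inverse[OF U _ smooth_on_sqrt[OF U _ smooth_on_mink[OF U ss ss]]])
      (use S0 in \<open>simp_all add: less_imp_neq[symmetric]\<close>)
  have mm: "mink (\<mu> b *\<^sub>R s b) (\<mu> b *\<^sub>R s b) = 1" if "b \<in> U" for b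
    using S0[OF that] by (simp add: \<mu>_def mink_simps field_simps)
  define \<zeta>1 where "\<zeta>1 b = \<tau> b *\<^sub>R v" for b
  define \<zeta>2 where "\<zeta>2 b = \<mu> b *\<^sub>R (w + \<sigma> b *\<^sub>R v)" for b
  have sz: "smooth_on U \<zeta>1" "smooth_on U \<zeta>2"
    unfolding \<zeta>1_def \<zeta>2_def by (intro smooth_on_scaleR smooth_on_add smooth_on_const s\<tau> s\<mu> s\<sigma> U)+
  define \<xi>1 where "\<xi>1 b = (1 / sqrt 2) *\<^sub>R (\<zeta>1 b + \<zeta>2 b)" for b
  define \<xi>2 where "\<xi>2 b = (1 / sqrt 2) *\<^sub>R (\<zeta>1 b - \<zeta>2 b)" for b
  have "framed_patch M U x \<xi>1 \<xi>2"
  proof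
    show "smooth_on U \<xi>1" "smooth_on U \<xi>2"
      unfolding \<xi>1_def \<xi>2_def
      by (intro smooth_on_scaleR smooth_on_add smooth_on_diff smooth_on_const sz U)+
    fix b assume b: "b \<in> U"
    have "\<D> x b (\<zeta>1 b) = t b" "\<D> x b (\<zeta>2 b) = \<mu> b *\<^sub>R s b"
      using linear_dx[OF b] by (simp_all add: \<zeta>1_def \<zeta>2_def t_def e1_def s_dx[OF b] linear_scale)
    then have "ddir \<xi>1 x b = (1 / sqrt 2) *\<^sub>R (t b + \<mu> b *\<^sub>R s b)"
      "ddir \<xi>2 x b = (1 / sqrt 2) *\<^sub>R (t b - \<mu> b *\<^sub>R s b)"
      using linear_dx[OF b]
      by (simp_all add: ddir_def \<xi>1_def \<xi>2_def linear_scale linear_add linear_diff)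
    then show "pseudo_orthonormal (ddir \<xi>1 x b) (ddir \<xi>2 x b)"
      using orthonormal_to_pseudo_orthonormal[OF tt[OF b] mm[OF b]] ts[OF b] by (simp add: mink_simps)
  qed
  then show ?thesis using that aU UV by blast
qed

context framed_patch
begin

lemma framed_subset:
  assumes "U' \<subseteq> U" "open U'"
  shows "framed_patch M U' x \<xi>1 \<xi>2"
  by unfold_locales
    (use patch_subset[OF patch assms] smooth_on_subset[OF _ assms(1)] smooth_xi frame assms in auto)

lemma local_frame_through_chart:
  "local_frame M (x ` U) (\<lambda>q. F1 (chart q)) (\<lambda>q. F2 (chart q))"
  using tangent_field_through_chart smooth_F tangent_combination image_openin frame
  by (auto simp: local_frame_def chart_x)

text \<open>Every local frame has this form in any given coordinates, by expanding it in a frame that is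
  already available there.\<close>

lemma framed_of_local_frame:
  assumes W: "local_frame M W f1 f2" and a: "a \<in> U" "x a \<in> W"
  obtains U' \<eta>1 \<eta>2 where "framed_patch M U' x \<eta>1 \<eta>2" "a \<in> U'" "U' \<subseteq> U"
    "\<And>b. b \<in> U' \<Longrightarrow> ddir \<eta>1 x b = f1 (x b) \<and> ddir \<eta>2 x b = f2 (x b)"
proof -
  have WM: "openin (top_of_set M) W" using W by (simp add: local_frame_def)
  define U' where "U' = {b \<in> U. x b \<in> W}"
  have U': "open U'" "a \<in> U'" "U' \<subseteq> U"
    unfolding U'_def using patch_preimage_open[OF patch WM] a by auto
  have p: "patch M U' x" by (rule patch_subset[OF patch U'(3,1)])
  then have "patch W U' x" using patch_openin_iff[OF WM] by (auto simp: U'_def)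
  then have sf: "smooth_on U' (\<lambda>b. f1 (x b))" "smooth_on U' (\<lambda>b. f2 (x b))"
    using W by (auto simp: local_frame_def tangent_field_def smooth_map_def o_def)
  have sF: "smooth_on U' F1" "smooth_on U' F2" "smooth_on U' \<xi>1" "smooth_on U' \<xi>2"
    using smooth_on_subset[OF _ U'(3)] smooth_F smooth_xi by auto
  define \<eta> where "\<eta> f b = (- mink (f (x b)) (F2 b)) *\<^sub>R \<xi>1 b + (- mink (f (x b)) (F1 b)) *\<^sub>R \<xi>2 b" for f b
  have s: "smooth_on U' (\<eta> f)" if "smooth_on U' (\<lambda>b. f (x b))" for f
    unfolding \<eta>_def by (intro smooth_on_add smooth_on_scaleR smooth_on_minus smooth_on_mink that U' sF)
  have d: "ddir (\<eta> f) x b = f (x b)" if "b \<in> U'" "\<And>q. q \<in> W \<Longrightarrow> f q \<in> tangent_space M q" for f b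
  proof -
    have b: "b \<in> U" "x b \<in> W" using that by (auto simp: U'_def)
    have "ddir (\<eta> f) x b = \<D> x b (\<eta> f b)" by (simp add: ddir_def)
    also have "\<dots> = (- mink (f (x b)) (F2 b)) *\<^sub>R F1 b + (- mink (f (x b)) (F1 b)) *\<^sub>R F2 b"
      unfolding \<eta>_def by (rule dx_combination[OF b(1)])
    also have "\<dots> = f (x b)" using tangent_expansion[OF b(1) that(2)[OF b(2)]] by simp
    finally show ?thesis .
  qed
  have e: "ddir (\<eta> f1) x b = f1 (x b) \<and> ddir (\<eta> f2) x b = f2 (x b)" if "b \<in> U'" for b
    using d[OF that] W by (simp add: local_frame_def tangent_field_def)
  have "framed_patch M U' x (\<eta> f1) (\<eta> f2)"
    by unfold_locales (use p s sf e W in \<open>auto simp: local_frame_def U'_def\<close>)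
  then show ?thesis using that[of U' "\<eta> f1" "\<eta> f2"] U' e by blast
qed

lemma smooth_sff: 
  assumes "smooth_on U \<zeta>" "smooth_on U \<eta>"
  shows "smooth_on U (sff x \<xi>1 \<xi>2 \<zeta> \<eta>)"
proof -
  have d: "smooth_on U (ddir \<zeta> (ddir \<eta> x))"
    by (intro smooth_on_ddir open_U assms smooth_x)
  have "smooth_on U (\<lambda>a. sff x \<xi>1 \<xi>2 \<zeta> \<eta> a)"
    unfolding sff_def normal_comp_def
    by (intro smooth_on_add smooth_on_scaleR smooth_on_mink open_U d smooth_F)
  then show ?thesis by simp
qed

lemma smooth_conn:
  assumes "smooth_on U \<zeta>"
  shows "smooth_on U (\<phi> \<zeta>)"
proof -
  have d: "smooth_on U (ddir \<zeta> F1)"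
    by (intro smooth_on_ddir open_U assms smooth_F)
  have "smooth_on U (\<lambda>a. \<phi> \<zeta> a)"
    unfolding conn_def by (intro smooth_on_minus smooth_on_mink open_U d smooth_F)
  then show ?thesis by simp
qed

end

section \<open>Minimal surfaces: Codazzi equation and Laplacian of the Gauss map\<close>

lemma scaleR_double:
  fixes v :: "'a::real_vector"
  shows "(2 * c) *\<^sub>R v = c *\<^sub>R v + c *\<^sub>R v"
  using scaleR_add_left[of c c v] by simp

locale minimal_framed_patch = framed_patch +
  assumes N12_0: "a \<in> U \<Longrightarrow> N12 a = 0"
begin

text \<open>Each formula for \<open>F1\<close> and \<open>N11\<close> has a mirror image for \<open>F2\<close> and \<open>N22\<close>, obtained by
  interpreting the locale with the two fields exchanged.\<close>

lemma minimal_swapped: "minimal_framed_patch M U x \<xi>2 \<xi>1"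
proof -
  interpret sw: framed_patch M U x \<xi>2 \<xi>1 by (rule swapped)
  show ?thesis
  proof
    fix a assume "a \<in> U"
    then show "sff x \<xi>2 \<xi>1 \<xi>2 \<xi>1 a = 0"
      using N12_0 sff_symmetric by (simp add: sff_swap[of x \<xi>1 \<xi>2])
  qed
qed

lemma frame_derivatives:
  assumes "a \<in> U"
  shows "ddir \<xi>1 F1 a = \<phi> \<xi>1 a *\<^sub>R F1 a + N11 a" "ddir \<xi>2 F1 a = \<phi> \<xi>2 a *\<^sub>R F1 a"
    "ddir \<xi>1 F2 a = - \<phi> \<xi>1 a *\<^sub>R F2 a" "ddir \<xi>2 F2 a = - \<phi> \<xi>2 a *\<^sub>R F2 a + N22 a"
  using ddir_F[OF assms, of \<xi>1] ddir_F[OF assms, of \<xi>2] sff_symmetric[OF assms] N12_0[OF assms]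
  by simp_all

lemma bracket:
  assumes a: "a \<in> U"
  shows "ddir \<xi>1 \<xi>2 a - ddir \<xi>2 \<xi>1 a = - \<phi> \<xi>2 a *\<^sub>R \<xi>1 a - \<phi> \<xi>1 a *\<^sub>R \<xi>2 a"
proof -
  have "\<D> x a (ddir \<xi>1 \<xi>2 a - ddir \<xi>2 \<xi>1 a) = ddir \<xi>1 F2 a - ddir \<xi>2 F1 a"
    by (rule ddir_commutator[OF open_U smooth_x smooth_xi a, symmetric])
  also have "\<dots> = \<D> x a (- \<phi> \<xi>2 a *\<^sub>R \<xi>1 a + - \<phi> \<xi>1 a *\<^sub>R \<xi>2 a)"
    unfolding dx_combination[OF a] by (simp add: frame_derivatives[OF a])
  finally show ?thesis using inj_derivative[OF a] by (auto dest: injD)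
qed

lemma diffs:
  assumes "a \<in> U"
  shows "F1 differentiable at a" "F2 differentiable at a" "N11 differentiable at a"
    "N22 differentiable at a" "\<phi> \<xi>1 differentiable at a" "\<phi> \<xi>2 differentiable at a"
  using smooth_on_differentiable[OF _ open_U assms] smooth_F smooth_sff smooth_conn smooth_xi by auto

text \<open>Derivatives of \<open>F1\<close> along \<open>\<xi>1\<close> and \<open>\<xi>2\<close> commute up to the bracket, which determines the
  derivative of \<open>N11\<close> up to a multiple of \<open>F1\<close>. That multiple follows by pairing with \<open>F2\<close>, which
  stays orthogonal to \<open>N11\<close>.\<close>

lemma codazzi:
  assumes a: "a \<in> U"
  shows "ddir \<xi>2 N11 a = (2 * \<phi> \<xi>2 a) *\<^sub>R N11 a + mink (N11 a) (N22 a) *\<^sub>R F1 a"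
proof -
  note d = diffs[OF a]
  define d1 where "d1 = ddir \<xi>2 (\<phi> \<xi>1) a"
  define d2 where "d2 = ddir \<xi>1 (\<phi> \<xi>2) a"
  have 1: "ddir \<xi>2 (ddir \<xi>1 F1) a = ddir \<xi>2 (\<lambda>b. \<phi> \<xi>1 b *\<^sub>R F1 b + N11 b) a"
    by (rule ddir_cong[OF open_U a frame_derivatives(1)])
      (simp_all add: smooth_on_differentiable[OF smooth_on_ddir open_U a] open_U smooth_xi smooth_F)
  have 2: "ddir \<xi>1 (ddir \<xi>2 F1) a = ddir \<xi>1 (\<lambda>b. \<phi> \<xi>2 b *\<^sub>R F1 b) a"
    by (rule ddir_cong[OF open_U a frame_derivatives(2)])
      (simp_all add: smooth_on_differentiable[OF smooth_on_ddir open_U a] open_U smooth_xi smooth_F)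
  have s: "(\<lambda>b. \<phi> \<xi>1 b *\<^sub>R F1 b) differentiable at a"
    by (rule differentiable_bounded_bilinear[OF bounded_bilinear_scaleR d(5,1)])
  have "ddir \<xi>1 (ddir \<xi>2 F1) a - ddir \<xi>2 (ddir \<xi>1 F1) a
      = \<D> F1 a (- \<phi> \<xi>2 a *\<^sub>R \<xi>1 a - \<phi> \<xi>1 a *\<^sub>R \<xi>2 a)"
    unfolding ddir_commutator[OF open_U smooth_F(1) smooth_xi a] bracket[OF a] ..
  also have "\<dots> = - \<phi> \<xi>2 a *\<^sub>R ddir \<xi>1 F1 a - \<phi> \<xi>1 a *\<^sub>R ddir \<xi>2 F1 a"
    using linear_frechet_derivative[OF d(1)] by (simp add: linear_diff linear_scale linear_neg ddir_def)
  finally have e: "\<phi> \<xi>2 a *\<^sub>R (\<phi> \<xi>1 a *\<^sub>R F1 a + N11 a) + d2 *\<^sub>R F1 a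
      - (\<phi> \<xi>1 a *\<^sub>R (\<phi> \<xi>2 a *\<^sub>R F1 a) + d1 *\<^sub>R F1 a + ddir \<xi>2 N11 a)
      = - \<phi> \<xi>2 a *\<^sub>R (\<phi> \<xi>1 a *\<^sub>R F1 a + N11 a) - \<phi> \<xi>1 a *\<^sub>R (\<phi> \<xi>2 a *\<^sub>R F1 a)"
    unfolding 1 2 ddir_add[OF s d(3)] ddir_scaleR[OF d(5,1)] ddir_scaleR[OF d(6,1)]
      frame_derivatives(1,2)[OF a] d1_def d2_def .
  have solve: "P = (2 * q) *\<^sub>R n + (k2 - k1 + 2 * (q * p)) *\<^sub>R f"
    if "q *\<^sub>R (p *\<^sub>R f + n) + k2 *\<^sub>R f - (p *\<^sub>R (q *\<^sub>R f) + k1 *\<^sub>R f + P)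
      = - q *\<^sub>R (p *\<^sub>R f + n) - p *\<^sub>R (q *\<^sub>R f)" for P n f :: "real^4" and p q k1 k2 :: real
  proof -
    have "P = (q *\<^sub>R (p *\<^sub>R f + n) + k2 *\<^sub>R f) - (p *\<^sub>R (q *\<^sub>R f) + k1 *\<^sub>R f)
      - (- q *\<^sub>R (p *\<^sub>R f + n) - p *\<^sub>R (q *\<^sub>R f))"
      unfolding that[symmetric] by simp
    then show ?thesis by (simp add: vec_eq_iff algebra_simps)
  qed
  from solve[OF e]
  obtain c where c: "ddir \<xi>2 N11 a = (2 * \<phi> \<xi>2 a) *\<^sub>R N11 a + c *\<^sub>R F1 a" by blast
  have "ddir \<xi>2 (\<lambda>b. mink (N11 b) (F2 b)) a = ddir \<xi>2 (\<lambda>_. 0::real) a"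
    by (rule ddir_cong[OF open_U a _ differentiable_bounded_bilinear[OF bounded_bilinear_mink d(3,2)]])
      (simp add: mink_sff)
  then have "mink (ddir \<xi>2 N11 a) (F2 a) = - mink (N11 a) (ddir \<xi>2 F2 a)"
    by (simp add: ddir_mink d)
  then have "c = mink (N11 a) (N22 a)"
    by (simp add: c frame_derivatives[OF a] mink_simps mink_sff[OF a] mink_F[OF a])
  then show ?thesis using c by simp
qed

lemma codazzi_swapped:
  assumes a: "a \<in> U"
  shows "ddir \<xi>1 N22 a = (- 2 * \<phi> \<xi>1 a) *\<^sub>R N22 a + mink (N11 a) (N22 a) *\<^sub>R F2 a"
proof -
  interpret sw: minimal_framed_patch M U x \<xi>2 \<xi>1 by (rule minimal_swapped)
  show ?thesis
    using sw.codazzi[OF a] conn_swap[OF a] by (simp add: sff_swap[of x \<xi>1 \<xi>2] mink_commute)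
qed

abbreviation "B \<equiv> \<lambda>b. wedge (F1 b) (F2 b)"
abbreviation "\<kappa> \<equiv> \<lambda>b. mink (N11 b) (N22 b)"

lemma smooth_B: "smooth_on U B"
  by (intro smooth_on_wedge open_U smooth_F)

lemma ddir_B:
  assumes "a \<in> U"
  shows "ddir \<xi>1 B a = wedge (N11 a) (F2 a)" "ddir \<xi>2 B a = wedge (F1 a) (N22 a)"
  using diffs[OF assms] frame_derivatives[OF assms] by (simp_all add: ddir_wedge wedge_simps)

lemma ddir_ddir_B:
  assumes a: "a \<in> U"
  shows "ddir \<xi>2 (ddir \<xi>1 B) a = \<kappa> a *\<^sub>R B a + wedge (N11 a) (N22 a) + \<phi> \<xi>2 a *\<^sub>R wedge (N11 a) (F2 a)"
    "ddir \<xi>1 (ddir \<xi>2 B) a = \<kappa> a *\<^sub>R B a + wedge (N11 a) (N22 a) - \<phi> \<xi>1 a *\<^sub>R wedge (F1 a) (N22 a)"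
proof -
  note d = diffs[OF a]
  have "ddir \<xi>2 (ddir \<xi>1 B) a = ddir \<xi>2 (\<lambda>b. wedge (N11 b) (F2 b)) a"
    by (rule ddir_cong[OF open_U a ddir_B(1)])
      (simp_all add: smooth_on_differentiable[OF smooth_on_ddir open_U a] open_U smooth_xi smooth_B)
  then show "ddir \<xi>2 (ddir \<xi>1 B) a = \<kappa> a *\<^sub>R B a + wedge (N11 a) (N22 a) + \<phi> \<xi>2 a *\<^sub>R wedge (N11 a) (F2 a)"
    unfolding ddir_wedge[OF d(3,2)] codazzi[OF a] frame_derivatives[OF a] wedge_simps scaleR_double
    by simp
  have "ddir \<xi>1 (ddir \<xi>2 B) a = ddir \<xi>1 (\<lambda>b. wedge (F1 b) (N22 b)) a"
    by (rule ddir_cong[OF open_U a ddir_B(2)])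
      (simp_all add: smooth_on_differentiable[OF smooth_on_ddir open_U a] open_U smooth_xi smooth_B)
  then show "ddir \<xi>1 (ddir \<xi>2 B) a = \<kappa> a *\<^sub>R B a + wedge (N11 a) (N22 a) - \<phi> \<xi>1 a *\<^sub>R wedge (F1 a) (N22 a)"
    unfolding ddir_wedge[OF d(1,4)] codazzi_swapped[OF a] frame_derivatives[OF a] wedge_simps
    by (simp add: scaleR_double[of "\<phi> \<xi>1 a"])
qed

text \<open>The terms with connection coefficients in \<open>ddir_ddir_B\<close> are exactly those that the Levi-Civita
  terms of the Laplacian remove. The sign \<open>e\<close> allows for frames of either orientation.\<close>

lemma laplacian_in_frame:
  assumes a: "a \<in> U"
    and \<nu>: "\<And>b. b \<in> U \<Longrightarrow> \<nu> (x b) = e *\<^sub>R B b"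
    and f: "\<And>b. b \<in> U \<Longrightarrow> f1 (x b) = F1 b" "\<And>b. b \<in> U \<Longrightarrow> f2 (x b) = F2 b"
  shows "dir_deriv M (\<lambda>q. dir_deriv M \<nu> q (f2 q)) (x a) (f1 (x a))
       + dir_deriv M (\<lambda>q. dir_deriv M \<nu> q (f1 q)) (x a) (f2 (x a))
       - dir_deriv M \<nu> (x a) (levi_civita M f2 (x a) (f1 (x a)))
       - dir_deriv M \<nu> (x a) (levi_civita M f1 (x a) (f2 (x a)))
     = (2 * e) *\<^sub>R (\<kappa> a *\<^sub>R B a + wedge (N11 a) (N22 a))"
proof -
  have dB: "B differentiable at b" if "b \<in> U" for b
    by (rule smooth_on_differentiable[OF smooth_B open_U that])
  have deB: "(\<lambda>b. e *\<^sub>R B b) differentiable at b" if "b \<in> U" for b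
    by (rule differentiable_bounded_bilinear[OF bounded_bilinear_scaleR _ dB[OF that]]) simp
  have \<nu>': "dir_deriv M \<nu> (x b) (ddir \<zeta> x b) = e *\<^sub>R ddir \<zeta> B b" if "b \<in> U" for \<zeta> b
  proof -
    have "dir_deriv M \<nu> (x b) (ddir \<zeta> x b) = ddir \<zeta> (\<lambda>b. e *\<^sub>R B b) b"
      by (rule dir_deriv_ddir[where F=\<nu>, OF open_U that order_refl \<nu> deB[OF that]])
    then show ?thesis
      by (simp add: ddir_bounded_linear[OF bounded_linear_scaleR_right dB[OF that]])
  qed
  have second: "dir_deriv M (\<lambda>q. dir_deriv M \<nu> q (f q)) (x a) (ddir \<eta> x a) = e *\<^sub>R ddir \<eta> (ddir \<zeta> B) a"
    if f: "\<And>b. b \<in> U \<Longrightarrow> f (x b) = ddir \<zeta> x b" and \<zeta>: "smooth_on U \<zeta>" for f \<zeta> \<eta>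
  proof -
    have d: "ddir \<zeta> B differentiable at a"
      by (rule smooth_on_differentiable[OF smooth_on_ddir[OF open_U \<zeta> smooth_B] open_U a])
    have "dir_deriv M (\<lambda>q. dir_deriv M \<nu> q (f q)) (x a) (ddir \<eta> x a)
        = ddir \<eta> (\<lambda>b. e *\<^sub>R ddir \<zeta> B b) a"
      by (rule dir_deriv_ddir[where F="\<lambda>q. dir_deriv M \<nu> q (f q)", OF open_U a order_refl])
        (simp_all add: f \<nu>' differentiable_bounded_bilinear[OF bounded_bilinear_scaleR _ d])
    then show ?thesis
      by (simp add: ddir_bounded_linear[OF bounded_linear_scaleR_right d])
  qed
  have lc: "levi_civita M f (x a) (ddir \<eta> x a)
      = (- mink (ddir \<eta> G a) (F2 a)) *\<^sub>R F1 a + (- mink (ddir \<eta> G a) (F1 a)) *\<^sub>R F2 a"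
    if "\<And>b. b \<in> U \<Longrightarrow> f (x b) = G b" "G differentiable at a" for f G \<eta>
  proof -
    have "dir_deriv M f (x a) (ddir \<eta> x a) = ddir \<eta> G a"
      by (rule dir_deriv_ddir[where F=f, OF open_U a order_refl that])
    then show ?thesis by (simp add: levi_civita_def tangential_part_eq[OF a])
  qed
  note dx = smooth_on_differentiable[OF smooth_x open_U a]
  have "levi_civita M f2 (x a) (F1 a)
      = (- mink (ddir \<xi>1 F2 a) (F2 a)) *\<^sub>R F1 a + (- mink (ddir \<xi>1 F2 a) (F1 a)) *\<^sub>R F2 a"
    by (rule lc[OF f(2) diffs(2)[OF a]])
  then have lc1: "levi_civita M f2 (x a) (F1 a) = ddir (\<lambda>b. 0 *\<^sub>R \<xi>1 b + (- \<phi> \<xi>1 a) *\<^sub>R \<xi>2 b) x a"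
    unfolding ddir_direction_linear[OF dx] frame_derivatives[OF a] by (simp add: mink_simps mink_F[OF a])
  have "levi_civita M f1 (x a) (F2 a)
      = (- mink (ddir \<xi>2 F1 a) (F2 a)) *\<^sub>R F1 a + (- mink (ddir \<xi>2 F1 a) (F1 a)) *\<^sub>R F2 a"
    by (rule lc[OF f(1) diffs(1)[OF a]])
  then have lc2: "levi_civita M f1 (x a) (F2 a) = ddir (\<lambda>b. \<phi> \<xi>2 a *\<^sub>R \<xi>1 b + 0 *\<^sub>R \<xi>2 b) x a"
    unfolding ddir_direction_linear[OF dx] frame_derivatives[OF a] by (simp add: mink_simps mink_F[OF a])
  have second12: "dir_deriv M (\<lambda>q. dir_deriv M \<nu> q (f2 q)) (x a) (F1 a) = e *\<^sub>R ddir \<xi>1 (ddir \<xi>2 B) a"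
    by (rule second[OF f(2) smooth_xi(2)])
  have second21: "dir_deriv M (\<lambda>q. dir_deriv M \<nu> q (f1 q)) (x a) (F2 a) = e *\<^sub>R ddir \<xi>2 (ddir \<xi>1 B) a"
    by (rule second[OF f(1) smooth_xi(1)])
  define X where "X = \<kappa> a *\<^sub>R B a + wedge (N11 a) (N22 a)"
  have "e *\<^sub>R (X - \<phi> \<xi>1 a *\<^sub>R wedge (F1 a) (N22 a)) + e *\<^sub>R (X + \<phi> \<xi>2 a *\<^sub>R wedge (N11 a) (F2 a))
      - e *\<^sub>R (0 *\<^sub>R wedge (N11 a) (F2 a) + (- \<phi> \<xi>1 a) *\<^sub>R wedge (F1 a) (N22 a))
      - e *\<^sub>R (\<phi> \<xi>2 a *\<^sub>R wedge (N11 a) (F2 a) + 0 *\<^sub>R wedge (F1 a) (N22 a)) = (2 * e) *\<^sub>R X"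
    unfolding scaleR_double[of e X] by (simp add: scaleR_add_right scaleR_diff_right)
  then show ?thesis
    unfolding f[OF a] second12 second21 lc1 lc2 \<nu>'[OF a]
      ddir_direction_linear[OF dB[OF a]] ddir_ddir_B[OF a] ddir_B[OF a] X_def .
qed

end

lemma minimal_framed_patchI:
  assumes "minimal M" "framed_patch M U x \<xi>1 \<xi>2"
  shows "minimal_framed_patch M U x \<xi>1 \<xi>2"
proof -
  interpret framed_patch M U x \<xi>1 \<xi>2 by (rule assms)
  show ?thesis
  proof
    fix a assume a: "a \<in> U"
    then have "mean_curvature M (x a) = 0" using assms(1) image_subset by (auto simp: minimal_def)
    then show "N12 a = 0" using mean_curvature_eq[OF a] by simp
  qed
qed

text \<open>The interior product of a bivector with a vector. It separates tangent from normal bivectors.\<close>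

definition contract :: "real^4^4 \<Rightarrow> real^4 \<Rightarrow> real^4" where
  "contract A w = (\<chi> i. mink (A $ i) w)"

lemma contract_wedge: "contract (wedge u v) w = mink v w *\<^sub>R u - mink u w *\<^sub>R v"
  by (simp add: contract_def wedge_def mink_def vec_eq_iff algebra_simps)

lemma contract_simps: "contract (c *\<^sub>R A) w = c *\<^sub>R contract A w" "contract 0 w = 0"
  "contract (A + A') w = contract A w + contract A' w"
  by (simp_all add: contract_def vec_eq_iff mink_def algebra_simps)

lemma wedge_pseudo_orthonormal_neq_0:
  assumes "pseudo_orthonormal u v"
  shows "wedge u v \<noteq> 0"
proof
  assume "wedge u v = 0"
  then have "mink (contract (wedge u v) u) v = 0" by (simp add: contract_simps mink_simps)
  then show False
    using assms by (simp add: contract_wedge mink_simps pseudo_orthonormal_def mink_commute[of v u])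
qed

lemma (in framed_patch) wedge_F_neq_0: "a \<in> U \<Longrightarrow> wedge (F1 a) (F2 a) \<noteq> 0"
  by (rule wedge_pseudo_orthonormal_neq_0[OF frame])

lemma (in framed_patch) wedge_normal_independent:
  assumes a: "a \<in> U" and e: "wedge (N11 a) (N22 a) = c *\<^sub>R wedge (F1 a) (F2 a)"
  shows "wedge (N11 a) (N22 a) = 0"
proof -
  have "mink (contract (wedge (N11 a) (N22 a)) (F1 a)) (F2 a) = 0"
    by (simp add: contract_wedge mink_sff[OF a] mink_simps)
  moreover have "mink (contract (wedge (N11 a) (N22 a)) (F1 a)) (F2 a) = c"
    unfolding e by (simp add: contract_simps contract_wedge mink_simps mink_F[OF a])
  ultimately show ?thesis using e by simp
qed

section \<open>The Gauss map\<close>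

lemma positively_oriented_unique:
  assumes "orientation M \<A>" "positively_oriented \<A> p u v" "positively_oriented \<A> p u' v'"
  shows "\<exists>c>0. wedge u v = c *\<^sub>R wedge u' v'"
proof -
  obtain U x a c where 1: "(U, x) \<in> \<A>" "a \<in> U" "x a = p" "c > 0" "wedge u v = c *\<^sub>R coord_bivector x a"
    using assms(2) by (auto simp: positively_oriented_def)
  obtain V z b d where 2: "(V, z) \<in> \<A>" "b \<in> V" "z b = p" "d > 0" "wedge u' v' = d *\<^sub>R coord_bivector z b"
    using assms(3) by (auto simp: positively_oriented_def)
  obtain k where k: "k > 0" "coord_bivector x a = k *\<^sub>R coord_bivector z b"
  proof -
    have "\<forall>(U, x)\<in>\<A>. \<forall>(V, y)\<in>\<A>. \<forall>a\<in>U. \<forall>b\<in>V. x a = y b \<longrightarrow>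
        (\<exists>c>0. coord_bivector x a = c *\<^sub>R coord_bivector y b)"
      using assms(1) by (simp add: orientation_def)
    from bspec[OF this 1(1)] have "\<forall>(V, y)\<in>\<A>. \<forall>a\<in>U. \<forall>b\<in>V. x a = y b \<longrightarrow>
        (\<exists>c>0. coord_bivector x a = c *\<^sub>R coord_bivector y b)" by simp
    from bspec[OF this 2(1)] have "\<forall>a\<in>U. \<forall>b\<in>V. x a = z b \<longrightarrow>
        (\<exists>c>0. coord_bivector x a = c *\<^sub>R coord_bivector z b)" by simp
    from bspec[OF bspec[OF this 1(2)] 2(2)] have "\<exists>c>0. coord_bivector x a = c *\<^sub>R coord_bivector z b"
      using 1(3) 2(3) by simp
    then show ?thesis using that by blast
  qed
  have "wedge u v = (c * k / d) *\<^sub>R wedge u' v'" using 1(5) 2(4,5) k(2) by simp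
  then show ?thesis using 1(4) 2(4) k(1) by (intro exI[of _ "c * k / d"]) simp
qed

lemma (in framed_patch) gauss_map_eq:
  assumes A: "orientation M \<A>" and a: "a \<in> U" and pos: "positively_oriented \<A> (x a) (F1 a) (F2 a)"
  shows "gauss_map M \<A> (x a) = wedge (F1 a) (F2 a)"
  unfolding gauss_map_def
proof (rule the_equality)
  show "\<exists>u\<in>tangent_space M (x a). \<exists>v\<in>tangent_space M (x a). pseudo_orthonormal u v \<and>
      positively_oriented \<A> (x a) u v \<and> wedge (F1 a) (F2 a) = wedge u v"
    by (rule bexI[of _ "F1 a"], rule bexI[of _ "F2 a"])
      (use tangent_combination(2,3)[OF a] frame[OF a] pos in simp_all)
next
  fix n assume "\<exists>u\<in>tangent_space M (x a). \<exists>v\<in>tangent_space M (x a). pseudo_orthonormal u v \<and>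
      positively_oriented \<A> (x a) u v \<and> n = wedge u v"
  then obtain u v \<alpha> \<beta> \<gamma> \<delta> where uv: "pseudo_orthonormal u v" "positively_oriented \<A> (x a) u v"
    "n = wedge u v" "u = \<alpha> *\<^sub>R F1 a + \<beta> *\<^sub>R F2 a" "v = \<gamma> *\<^sub>R F1 a + \<delta> *\<^sub>R F2 a"
    unfolding tangent_iff[OF a] Bex_def by blast
  show "n = wedge (F1 a) (F2 a)"
  proof (rule pseudo_orthonormal_rescaled[OF frame[OF a] uv(1,4,5)])
    fix c :: real assume "c \<noteq> 0" "u = c *\<^sub>R F1 a" "v = (1 / c) *\<^sub>R F2 a"
    then show ?thesis by (simp add: uv(3) wedge_simps)
  next
    fix c :: real assume "c \<noteq> 0" "u = c *\<^sub>R F2 a" "v = (1 / c) *\<^sub>R F1 a"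
    then have "wedge u v = - wedge (F1 a) (F2 a)" by (simp add: wedge_simps wedge_commute[of "F2 a" "F1 a"])
    moreover obtain k where "k > 0" "wedge u v = k *\<^sub>R wedge (F1 a) (F2 a)"
      using positively_oriented_unique[OF A uv(2) pos] by blast
    ultimately have "(k + 1) *\<^sub>R wedge (F1 a) (F2 a) = 0" by (simp add: scaleR_add_left)
    then have False using wedge_F_neq_0[OF a] \<open>k > 0\<close> by simp
    then show ?thesis ..
  qed
qed

text \<open>The factor is the determinant of the frame in coordinates; its sign decides the orientation.\<close>

lemma (in framed_patch) wedge_F_coord_bivector:
  assumes "a \<in> U"
  shows "wedge (F1 a) (F2 a) = (\<xi>1 a $ 1 * \<xi>2 a $ 2 - \<xi>1 a $ 2 * \<xi>2 a $ 1) *\<^sub>R coord_bivector x a"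
proof -
  have e: "\<D> x a v = v$1 *\<^sub>R \<D> x a (axis 1 1)
      + v$2 *\<^sub>R \<D> x a (axis 2 1)" for v :: "real^2"
  proof -
    have "v = v$1 *\<^sub>R axis 1 1 + v$2 *\<^sub>R axis 2 1"
      by (simp add: vec_eq_iff forall_2 axis_def)
    then have "\<D> x a v
        = \<D> x a (v$1 *\<^sub>R axis 1 1 + v$2 *\<^sub>R axis 2 1)" by (rule arg_cong)
    then show ?thesis by (simp only: linear_add[OF linear_dx[OF assms]] linear_scale[OF linear_dx[OF assms]])
  qed
  have w: "wedge (p *\<^sub>R u + q *\<^sub>R v) (r *\<^sub>R u + s *\<^sub>R v) = (p * s - q * r) *\<^sub>R wedge u v"
    for p q r s u v
    by (simp add: wedge_def vec_eq_iff algebra_simps)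
  show ?thesis
    unfolding ddir_def coord_bivector_def e[of "\<xi>1 a"] e[of "\<xi>2 a"] w ..
qed

lemma (in framed_patch) gauss_map_near:
  assumes A: "orientation M \<A>" and V: "(V, x) \<in> \<A>" "U \<subseteq> V" and a: "a \<in> U"
  obtains U' e where "open U'" "a \<in> U'" "U' \<subseteq> U" "e = 1 \<or> e = (-1::real)"
    "\<And>b. b \<in> U' \<Longrightarrow> gauss_map M \<A> (x b) = e *\<^sub>R wedge (F1 b) (F2 b)"
proof -
  interpret sw: framed_patch M U x \<xi>2 \<xi>1 by (rule swapped)
  define D where "D b = \<xi>1 b $ 1 * \<xi>2 b $ 2 - \<xi>1 b $ 2 * \<xi>2 b $ 1" for b
  have w: "wedge (F1 b) (F2 b) = D b *\<^sub>R coord_bivector x b" if "b \<in> U" for b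
    unfolding D_def by (rule wedge_F_coord_bivector[OF that])
  have w': "wedge (F2 b) (F1 b) = (- D b) *\<^sub>R coord_bivector x b" if "b \<in> U" for b
    using w[OF that] wedge_commute[of "F2 b" "F1 b"] by simp
  have "continuous_on U D"
    unfolding D_def
    by (intro continuous_intros smooth_on_imp_continuous_on smooth_xi)
  then have op: "open (U \<inter> D -` {0<..})" "open (U \<inter> D -` {..<0})"
    using open_U by (auto intro: continuous_open_preimage)
  have "D a \<noteq> 0" using w[OF a] wedge_F_neq_0[OF a] by auto
  then consider "D a > 0" | "D a < 0" by linarith
  then show ?thesis
  proof cases
    case 1
    show ?thesis
    proof (rule that[of "U \<inter> D -` {0<..}" 1])
      fix b assume b: "b \<in> U \<inter> D -` {0<..}"
      then have "positively_oriented \<A> (x b) (F1 b) (F2 b)"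
        unfolding positively_oriented_def using V w[of b] by (intro bexI[of _ "(V, x)"]) auto
      then show "gauss_map M \<A> (x b) = 1 *\<^sub>R wedge (F1 b) (F2 b)"
        using gauss_map_eq[OF A] b by simp
    qed (use op 1 a in auto)
  next
    case 2
    show ?thesis
    proof (rule that[of "U \<inter> D -` {..<0}" "-1"])
      fix b assume b: "b \<in> U \<inter> D -` {..<0}"
      then have "positively_oriented \<A> (x b) (F2 b) (F1 b)"
        unfolding positively_oriented_def using V w'[of b]
        by (intro bexI[of _ "(V, x)"]) (auto intro!: bexI[of _ b] exI[of _ "- D b"])
      then show "gauss_map M \<A> (x b) = (-1) *\<^sub>R wedge (F1 b) (F2 b)"
        using sw.gauss_map_eq[OF A] b wedge_commute[of "F2 b" "F1 b"] by simp
    qed (use op 2 a in auto)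
  qed
qed

text \<open>The description that defines the Laplacian ranges over all frames near the point. Rescaling a frame
  leaves the value unchanged; swapping its members reverses both \<open>e\<close> and the two wedge products.\<close>

lemma (in framed_patch) laplacian_gauss_map:
  assumes A: "orientation M \<A>" and V: "(V, x) \<in> \<A>" "U \<subseteq> V" and a: "a \<in> U" and M: "minimal M"
  obtains e where "e = 1 \<or> e = (-1::real)" "gauss_map M \<A> (x a) = e *\<^sub>R wedge (F1 a) (F2 a)"
    "laplacian M (gauss_map M \<A>) (x a)
      = (2 * e) *\<^sub>R (mink (N11 a) (N22 a) *\<^sub>R wedge (F1 a) (F2 a) + wedge (N11 a) (N22 a))"
proof -
  let ?\<nu> = "gauss_map M \<A>"
  define lap where "lap f1 f2 = dir_deriv M (\<lambda>q. dir_deriv M ?\<nu> q (f2 q)) (x a) (f1 (x a))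
       + dir_deriv M (\<lambda>q. dir_deriv M ?\<nu> q (f1 q)) (x a) (f2 (x a))
       - dir_deriv M ?\<nu> (x a) (levi_civita M f2 (x a) (f1 (x a)))
       - dir_deriv M ?\<nu> (x a) (levi_civita M f1 (x a) (f2 (x a)))" for f1 f2
  have frame_value: "\<exists>e. (e = 1 \<or> e = -1) \<and> ?\<nu> (x a) = e *\<^sub>R wedge (ddir \<eta>1 x a) (ddir \<eta>2 x a) \<and>
      lap f1 f2 = (2 * e) *\<^sub>R (mink (sff x \<eta>1 \<eta>2 \<eta>1 \<eta>1 a) (sff x \<eta>1 \<eta>2 \<eta>2 \<eta>2 a) *\<^sub>R wedge (ddir \<eta>1 x a) (ddir \<eta>2 x a)
        + wedge (sff x \<eta>1 \<eta>2 \<eta>1 \<eta>1 a) (sff x \<eta>1 \<eta>2 \<eta>2 \<eta>2 a))"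
    if \<eta>: "framed_patch M U1 x \<eta>1 \<eta>2" "a \<in> U1" "U1 \<subseteq> U"
      "\<And>b. b \<in> U1 \<Longrightarrow> f1 (x b) = ddir \<eta>1 x b" "\<And>b. b \<in> U1 \<Longrightarrow> f2 (x b) = ddir \<eta>2 x b"
    for U1 \<eta>1 \<eta>2 f1 f2
  proof -
    interpret h: framed_patch M U1 x \<eta>1 \<eta>2 by (rule \<eta>(1))
    obtain U' e where U': "open U'" "a \<in> U'" "U' \<subseteq> U1" "e = 1 \<or> e = (-1::real)"
      "\<And>b. b \<in> U' \<Longrightarrow> ?\<nu> (x b) = e *\<^sub>R wedge (h.F1 b) (h.F2 b)"
      using h.gauss_map_near[OF A V(1) order_trans[OF \<eta>(3) V(2)] \<eta>(2)] by metis
    interpret m: minimal_framed_patch M U' x \<eta>1 \<eta>2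
      by (rule minimal_framed_patchI[OF M h.framed_subset[OF U'(3,1)]])
    have "f1 (x b) = ddir \<eta>1 x b" "f2 (x b) = ddir \<eta>2 x b" if "b \<in> U'" for b
      using \<eta>(4,5) U'(3) that by auto
    from m.laplacian_in_frame[where \<nu>="?\<nu>", OF U'(2,5) this] show ?thesis
      using U'(2,4,5) unfolding lap_def by blast
  qed
  have F: "local_frame M (x ` U) (\<lambda>q. F1 (chart q)) (\<lambda>q. F2 (chart q))"
    by (rule local_frame_through_chart)
  obtain e where e: "e = 1 \<or> e = -1" "?\<nu> (x a) = e *\<^sub>R wedge (F1 a) (F2 a)"
    "lap (\<lambda>q. F1 (chart q)) (\<lambda>q. F2 (chart q))
      = (2 * e) *\<^sub>R (mink (N11 a) (N22 a) *\<^sub>R wedge (F1 a) (F2 a) + wedge (N11 a) (N22 a))"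
    using frame_value[OF framed_patch_axioms a order_refl, of "\<lambda>q. F1 (chart q)" "\<lambda>q. F2 (chart q)"]
    by (auto simp: chart_x)
  have unique: "lap f1 f2 = (2 * e) *\<^sub>R (mink (N11 a) (N22 a) *\<^sub>R wedge (F1 a) (F2 a) + wedge (N11 a) (N22 a))"
    if f: "local_frame M W f1 f2" "x a \<in> W" for W f1 f2
  proof -
    obtain U1 \<eta>1 \<eta>2 where \<eta>: "framed_patch M U1 x \<eta>1 \<eta>2" "a \<in> U1" "U1 \<subseteq> U"
      "\<And>b. b \<in> U1 \<Longrightarrow> ddir \<eta>1 x b = f1 (x b) \<and> ddir \<eta>2 x b = f2 (x b)"
      using framed_of_local_frame[OF f(1) a f(2)] by metis
    interpret h: framed_patch M U1 x \<eta>1 \<eta>2 by (rule \<eta>(1))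
    obtain e' where e': "e' = 1 \<or> e' = -1" "?\<nu> (x a) = e' *\<^sub>R wedge (h.F1 a) (h.F2 a)"
      "lap f1 f2 = (2 * e') *\<^sub>R (mink (h.N11 a) (h.N22 a) *\<^sub>R wedge (h.F1 a) (h.F2 a) + wedge (h.N11 a) (h.N22 a))"
      using frame_value[OF \<eta>(1-3), of f1 f2] \<eta>(4) by auto
    have hN: "h.N11 a = second_ff M (x a) (h.F1 a) (h.F1 a)" "h.N22 a = second_ff M (x a) (h.F2 a) (h.F2 a)"
      using h.second_ff_frame(1)[OF \<eta>(2), of 1 1] h.second_ff_frame(4)[OF \<eta>(2), of 1 1] by simp_all
    have ee: "e *\<^sub>R wedge (F1 a) (F2 a) = e' *\<^sub>R wedge (h.F1 a) (h.F2 a)" using e(2) e'(2) by simp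
    obtain \<alpha> \<beta> \<gamma> \<delta> where lin: "h.F1 a = \<alpha> *\<^sub>R F1 a + \<beta> *\<^sub>R F2 a" "h.F2 a = \<gamma> *\<^sub>R F1 a + \<delta> *\<^sub>R F2 a"
      using h.tangent_combination(2,3)[OF \<eta>(2)] tangent_iff[OF a] by metis
    show ?thesis
    proof (rule pseudo_orthonormal_rescaled[OF frame[OF a] h.frame[OF \<eta>(2)] lin])
      fix c :: real assume c: "c \<noteq> 0" "h.F1 a = c *\<^sub>R F1 a" "h.F2 a = (1 / c) *\<^sub>R F2 a"
      have "e = e'" using ee c wedge_F_neq_0[OF a] by (simp add: wedge_simps)
      moreover have "h.N11 a = (c * c) *\<^sub>R N11 a" "h.N22 a = (1 / c * (1 / c)) *\<^sub>R N22 a"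
        unfolding hN c(2,3) second_ff_frame[OF a] by simp_all
      ultimately show ?thesis
        using c(1) unfolding e'(3) c(2,3) by (simp add: wedge_simps mink_simps)
    next
      fix c :: real assume c: "c \<noteq> 0" "h.F1 a = c *\<^sub>R F2 a" "h.F2 a = (1 / c) *\<^sub>R F1 a"
      have sw: "wedge (F2 a) (F1 a) = - wedge (F1 a) (F2 a)" "wedge (N22 a) (N11 a) = - wedge (N11 a) (N22 a)"
        by (rule wedge_commute)+
      have "e *\<^sub>R wedge (F1 a) (F2 a) = (- e') *\<^sub>R wedge (F1 a) (F2 a)"
        using ee c by (simp add: wedge_simps sw)
      then have "e = - e'" using wedge_F_neq_0[OF a] scaleR_cancel_right by blast
      moreover have "h.N11 a = (c * c) *\<^sub>R N22 a" "h.N22 a = (1 / c * (1 / c)) *\<^sub>R N11 a"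
        unfolding hN c(2,3) second_ff_frame[OF a] by simp_all
      ultimately show ?thesis
        using c(1) unfolding e'(3) c(2,3)
        by (simp add: wedge_simps mink_simps sw mink_commute[of "N22 a" "N11 a"] scaleR_add_right scaleR_diff_right)
    qed
  qed
  have "laplacian M ?\<nu> (x a) = (2 * e) *\<^sub>R (mink (N11 a) (N22 a) *\<^sub>R wedge (F1 a) (F2 a) + wedge (N11 a) (N22 a))"
    unfolding laplacian_def lap_def[symmetric]
  proof (rule the_equality)
    show "\<exists>W f1 f2. local_frame M W f1 f2 \<and> x a \<in> W \<and>
        (2 * e) *\<^sub>R (mink (N11 a) (N22 a) *\<^sub>R wedge (F1 a) (F2 a) + wedge (N11 a) (N22 a)) = lap f1 f2"
      using F e(3) a by (intro exI[of _ "x ` U"] exI[of _ "\<lambda>q. F1 (chart q)"] exI[of _ "\<lambda>q. F2 (chart q)"]) auto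
  qed (use unique in blast)
  then show ?thesis using that e by blast
qed

section \<open>Gauss maps of the first kind\<close>

context framed_patch
begin

text \<open>Swapping the pair exchanges the two values, which affects the sign of their wedge product only.\<close>

lemma pseudo_orthonormal_values:
  assumes a: "a \<in> U" and uv: "u \<in> tangent_space M (x a)" "v \<in> tangent_space M (x a)" "pseudo_orthonormal u v"
    and h: "h = (\<lambda>w. second_ff M (x a) w w)"
  shows "mink (h u) (h v) = mink (N11 a) (N22 a) \<and>
    (wedge (h u) (h v) = wedge (N11 a) (N22 a) \<or> wedge (h u) (h v) = - wedge (N11 a) (N22 a))"
proof -
  obtain \<alpha> \<beta> \<gamma> \<delta> where lin: "u = \<alpha> *\<^sub>R F1 a + \<beta> *\<^sub>R F2 a" "v = \<gamma> *\<^sub>R F1 a + \<delta> *\<^sub>R F2 a"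
    using uv(1,2) tangent_iff[OF a] by metis
  show ?thesis
  proof (rule pseudo_orthonormal_rescaled[OF frame[OF a] uv(3) lin])
    fix c :: real assume c: "c \<noteq> 0" "u = c *\<^sub>R F1 a" "v = (1 / c) *\<^sub>R F2 a"
    show ?thesis unfolding h c(2,3) second_ff_frame[OF a] using c(1) by (simp add: mink_simps wedge_simps)
  next
    fix c :: real assume c: "c \<noteq> 0" "u = c *\<^sub>R F2 a" "v = (1 / c) *\<^sub>R F1 a"
    show ?thesis unfolding h c(2,3) second_ff_frame[OF a] using c(1)
      by (simp add: mink_simps wedge_simps wedge_commute[of "N22 a" "N11 a"] mink_commute[of "N22 a" "N11 a"])
  qed
qed

lemma second_ff_F: 
  assumes "a \<in> U"
  shows "second_ff M (x a) (F1 a) (F1 a) = N11 a" "second_ff M (x a) (F1 a) (F2 a) = N12 a"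
    "second_ff M (x a) (F2 a) (F1 a) = N12 a" "second_ff M (x a) (F2 a) (F2 a) = N22 a"
  using second_ff_frame[OF assms, of 1 1] by simp_all

end

text \<open>The function \<open>f\<close> with \<open>\<Delta> \<nu> = f \<nu>\<close> if the Gauss map is of the first kind. It is described
  without reference to a patch, since it has to be one function on all of \<open>M\<close>, while its
  smoothness is checked in an arbitrary patch.\<close>

definition gauss_factor :: "(real^4) set \<Rightarrow> real^4 \<Rightarrow> real" where
  "gauss_factor M p = (THE k. \<exists>u\<in>tangent_space M p. \<exists>v\<in>tangent_space M p.
     pseudo_orthonormal u v \<and> k = 2 * mink (second_ff M p u u) (second_ff M p v v))"

text \<open>The values of the second fundamental form on the two null directions are linearly dependent. This is
  the condition \<open>N11 \<and> N22 = 0\<close> in a form that depends on the point alone.\<close>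

definition null_values_collinear :: "(real^4) set \<Rightarrow> real^4 \<Rightarrow> bool" where
  "null_values_collinear M p \<longleftrightarrow> (\<forall>u\<in>tangent_space M p. \<forall>v\<in>tangent_space M p.
     pseudo_orthonormal u v \<longrightarrow> wedge (second_ff M p u u) (second_ff M p v v) = 0)"

lemma (in framed_patch) gauss_factor_eq:
  assumes a: "a \<in> U"
  shows "gauss_factor M (x a) = 2 * mink (N11 a) (N22 a)"
  unfolding gauss_factor_def
proof (rule the_equality)
  show "\<exists>u\<in>tangent_space M (x a). \<exists>v\<in>tangent_space M (x a). pseudo_orthonormal u v \<and>
      2 * mink (N11 a) (N22 a) = 2 * mink (second_ff M (x a) u u) (second_ff M (x a) v v)"
    by (rule bexI[of _ "F1 a"], rule bexI[of _ "F2 a"])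
      (use tangent_combination(2,3)[OF a] frame[OF a] second_ff_F[OF a] in simp_all)
qed (use pseudo_orthonormal_values[OF a _ _ _ refl] in auto)

lemma (in framed_patch) null_values_collinear_iff:
  assumes a: "a \<in> U"
  shows "null_values_collinear M (x a) \<longleftrightarrow> wedge (N11 a) (N22 a) = 0"
proof
  assume "null_values_collinear M (x a)"
  then show "wedge (N11 a) (N22 a) = 0"
    using tangent_combination(2,3)[OF a] frame[OF a] second_ff_F[OF a]
    unfolding null_values_collinear_def by metis
next
  assume "wedge (N11 a) (N22 a) = 0"
  then show "null_values_collinear M (x a)"
    using pseudo_orthonormal_values[OF a _ _ _ refl] unfolding null_values_collinear_def by auto
qed

lemma smooth_gauss_factor:
  assumes "lorentzian_surface M"
  shows "smooth_map M (gauss_factor M)"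
  unfolding smooth_map_def
proof (intro allI impI)
  fix V z assume z: "patch M V z"
  show "smooth_on V (gauss_factor M \<circ> z)"
  proof (rule smooth_on_local)
    show "open V" using z by (simp add: patch_def)
    fix a assume "a \<in> V"
    then obtain U \<xi>1 \<xi>2 where U: "framed_patch M U z \<xi>1 \<xi>2" "a \<in> U" "U \<subseteq> V"
      using exists_framed_patch[OF assms z] by blast
    interpret framed_patch M U z \<xi>1 \<xi>2 by (rule U(1))
    have "smooth_on U (\<lambda>b. 2 * mink (N11 b) (N22 b))"
      by (intro smooth_on_mult smooth_on_mink smooth_on_const open_U smooth_sff smooth_xi)
    then have "smooth_on U (gauss_factor M \<circ> z)"
      by (rule smooth_on_cong[OF open_U, rotated]) (simp add: gauss_factor_eq)
    then show "\<exists>T. open T \<and> a \<in> T \<and> T \<subseteq> V \<and> smooth_on T (gauss_factor M \<circ> z)"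
      using U(2,3) open_U by blast
  qed
qed

lemma oriented_framed_patch_at:
  assumes "orientation M \<A>" "lorentzian_surface M" "p \<in> M"
  obtains V U x \<xi>1 \<xi>2 a where "(V, x) \<in> \<A>" "U \<subseteq> V" "framed_patch M U x \<xi>1 \<xi>2" "a \<in> U" "x a = p"
proof -
  obtain V x a where V: "(V, x) \<in> \<A>" "a \<in> V" "x a = p" "patch M V x"
    using assms(1,3) unfolding orientation_def by blast
  obtain U \<xi>1 \<xi>2 where "framed_patch M U x \<xi>1 \<xi>2" "a \<in> U" "U \<subseteq> V"
    using exists_framed_patch[OF assms(2) V(4,2)] by metis
  then show ?thesis using that V by blast
qed

text \<open>In the formula for \<open>\<Delta> \<nu>\<close>, a multiple of \<open>\<nu>\<close> can never compensate for the normal bivector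
  \<open>N11 \<and> N22\<close>.\<close>

lemma first_kind_iff:
  assumes A: "orientation M \<A>" and M: "lorentzian_surface M" "minimal M"
  shows "first_kind M \<A> \<longleftrightarrow> (\<forall>p\<in>M. null_values_collinear M p)"
proof
  assume "first_kind M \<A>"
  then obtain f where f: "\<And>p. p \<in> M \<Longrightarrow> laplacian M (gauss_map M \<A>) p = f p *\<^sub>R gauss_map M \<A> p"
    by (auto simp: first_kind_def one_type_gauss_map_with_def)
  show "\<forall>p\<in>M. null_values_collinear M p"
  proof
    fix p assume p: "p \<in> M"
    obtain V U x \<xi>1 \<xi>2 a where V: "(V, x) \<in> \<A>" "U \<subseteq> V" "framed_patch M U x \<xi>1 \<xi>2" "a \<in> U" "x a = p"
      using oriented_framed_patch_at[OF A M(1) p] .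
    interpret framed_patch M U x \<xi>1 \<xi>2 by (rule V(3))
    obtain e where e: "e = 1 \<or> e = (-1::real)" "gauss_map M \<A> (x a) = e *\<^sub>R wedge (F1 a) (F2 a)"
      "laplacian M (gauss_map M \<A>) (x a)
        = (2 * e) *\<^sub>R (mink (N11 a) (N22 a) *\<^sub>R wedge (F1 a) (F2 a) + wedge (N11 a) (N22 a))"
      using laplacian_gauss_map[OF A V(1,2,4) M(2)] .
    have "(2 * e) *\<^sub>R (mink (N11 a) (N22 a) *\<^sub>R wedge (F1 a) (F2 a) + wedge (N11 a) (N22 a))
        = f p *\<^sub>R (e *\<^sub>R wedge (F1 a) (F2 a))"
      using f[OF p] e(2,3) V(5) by simp
    then have "(1 / (2 * e)) *\<^sub>R ((2 * e) *\<^sub>R (mink (N11 a) (N22 a) *\<^sub>R wedge (F1 a) (F2 a) + wedge (N11 a) (N22 a)))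
        = (1 / (2 * e)) *\<^sub>R (f p *\<^sub>R (e *\<^sub>R wedge (F1 a) (F2 a)))"
      by (rule arg_cong)
    then have "mink (N11 a) (N22 a) *\<^sub>R wedge (F1 a) (F2 a) + wedge (N11 a) (N22 a) = (f p / 2) *\<^sub>R wedge (F1 a) (F2 a)"
      using e(1) by auto
    then have "wedge (N11 a) (N22 a) = (f p / 2 - mink (N11 a) (N22 a)) *\<^sub>R wedge (F1 a) (F2 a)"
      by (simp add: scaleR_diff_left eq_diff_eq add.commute)
    then have "wedge (N11 a) (N22 a) = 0" by (rule wedge_normal_independent[OF V(4)])
    then show "null_values_collinear M p" using null_values_collinear_iff[OF V(4)] V(5) by simp
  qed
next
  assume par: "\<forall>p\<in>M. null_values_collinear M p"
  have "laplacian M (gauss_map M \<A>) p = gauss_factor M p *\<^sub>R (gauss_map M \<A> p + 0)" if p: "p \<in> M" for p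
  proof -
    obtain V U x \<xi>1 \<xi>2 a where V: "(V, x) \<in> \<A>" "U \<subseteq> V" "framed_patch M U x \<xi>1 \<xi>2" "a \<in> U" "x a = p"
      using oriented_framed_patch_at[OF A M(1) p] .
    interpret framed_patch M U x \<xi>1 \<xi>2 by (rule V(3))
    obtain e where e: "e = 1 \<or> e = (-1::real)" "gauss_map M \<A> (x a) = e *\<^sub>R wedge (F1 a) (F2 a)"
      "laplacian M (gauss_map M \<A>) (x a)
        = (2 * e) *\<^sub>R (mink (N11 a) (N22 a) *\<^sub>R wedge (F1 a) (F2 a) + wedge (N11 a) (N22 a))"
      using laplacian_gauss_map[OF A V(1,2,4) M(2)] .
    have "wedge (N11 a) (N22 a) = 0" using par p V(5) null_values_collinear_iff[OF V(4)] by auto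
    then show ?thesis
      using e gauss_factor_eq[OF V(4)] V(5) by (simp add: mult_ac)
  qed
  then show "first_kind M \<A>"
    using smooth_gauss_factor[OF M(1)] unfolding first_kind_def one_type_gauss_map_with_def by blast
qed

lemma first_kind_imp_pointwise_one_type: "first_kind M \<A> \<Longrightarrow> pointwise_one_type M \<A>"
  unfolding first_kind_def pointwise_one_type_def bivectors_def
  by (intro bexI[of _ 0]) (auto simp: transpose_def vec_eq_iff)

section \<open>Both families have Gauss maps of the first kind\<close>

lemma exists_framed_patch_at:
  assumes M: "lorentzian_surface M" and p: "p \<in> W" "openin (top_of_set M) W"
  obtains U x \<xi>1 \<xi>2 a where "framed_patch M U x \<xi>1 \<xi>2" "a \<in> U" "x a = p" "x ` U \<subseteq> W"
proof -
  have "p \<in> M" using p openin_imp_subset by blast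
  then obtain V x where Vx: "patch M V x" "p \<in> x ` V"
    using M unfolding lorentzian_surface_def surface_def by blast
  then obtain a where V: "patch M V x" "a \<in> V" "x a = p" by blast
  define V' where "V' = {a \<in> V. x a \<in> W}"
  have "patch M V' x"
    by (rule patch_subset[OF V(1)]) (use patch_preimage_open[OF V(1) p(2)] in \<open>auto simp: V'_def\<close>)
  moreover have "a \<in> V'" using V p by (simp add: V'_def)
  ultimately obtain U \<xi>1 \<xi>2 where "framed_patch M U x \<xi>1 \<xi>2" "a \<in> U" "U \<subseteq> V'"
    using exists_framed_patch[OF M] by metis
  then show ?thesis using that[of U x \<xi>1 \<xi>2 a] V(3) by (auto simp: V'_def)
qed

lemma null_values_collinearI:
  assumes M: "lorentzian_surface M"
    and N: "\<And>U x \<xi>1 \<xi>2 a. framed_patch M U x \<xi>1 \<xi>2 \<Longrightarrow> a \<in> U \<Longrightarrow>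
      wedge (sff x \<xi>1 \<xi>2 \<xi>1 \<xi>1 a) (sff x \<xi>1 \<xi>2 \<xi>2 \<xi>2 a) = 0"
  shows "\<forall>p\<in>M. null_values_collinear M p"
proof
  fix p assume p: "p \<in> M"
  obtain U x \<xi>1 \<xi>2 a where U: "framed_patch M U x \<xi>1 \<xi>2" "a \<in> U" "x a = p"
    using exists_framed_patch_at[OF M p] openin_subtopology_self by metis
  interpret framed_patch M U x \<xi>1 \<xi>2 by (rule U(1))
  show "null_values_collinear M p" using null_values_collinear_iff[OF U(2)] N[OF U(1,2)] U(3) by simp
qed

text \<open>The normal plane of a Lorentzian plane is positive definite, so that within it the
  vectors orthogonal to a given non-zero one form a line.\<close>

lemma orthogonal_in_normal_plane_collinear:
  assumes uv: "pseudo_orthonormal u v" and \<eta>: "\<eta> \<noteq> 0" "mink \<eta> u = 0" "mink \<eta> v = 0"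
    and n: "mink n u = 0" "mink n v = 0" "mink n \<eta> = 0"
    and m: "mink m u = 0" "mink m v = 0" "mink m \<eta> = 0"
  shows "wedge n m = 0"
proof (cases "n = 0")
  case True
  then show ?thesis by (simp add: wedge_simps)
next
  case False
  have uv': "mink u u = 0" "mink v v = 0" "mink u v = -1" "mink v u = -1"
    using uv by (simp_all add: pseudo_orthonormal_def mink_commute)
  have pos: "mink w w > 0" if "w \<noteq> 0" "mink w u = 0" "mink w v = 0" for w
    by (rule orthogonal_timelike_imp_spacelike[of "u + v"])
      (use that in \<open>simp_all add: mink_simps uv' mink_commute[of u w] mink_commute[of v w]\<close>)
  have nn: "mink n n > 0" "mink \<eta> \<eta> > 0" using pos False n \<eta> by auto
  define L where "L w = mink w u *\<^sub>R axis 1 1 + mink w v *\<^sub>R axis 2 1 + mink w \<eta> *\<^sub>R axis 3 1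
    + mink w n *\<^sub>R (axis 4 1 :: real^4)" for w
  have lin: "linear L" by (simp add: L_def linear_iff mink_simps algebra_simps)
  have "surj L"
  proof (rule surjI)
    fix y :: "real^4"
    let ?w = "(- y$2) *\<^sub>R u + (- y$1) *\<^sub>R v + (y$3 / mink \<eta> \<eta>) *\<^sub>R \<eta> + (y$4 / mink n n) *\<^sub>R n"
    have w: "mink ?w u = y$1" "mink ?w v = y$2" "mink ?w \<eta> = y$3" "mink ?w n = y$4"
      using nn by (simp_all add: mink_simps uv' \<eta> n mink_commute[of u \<eta>] mink_commute[of v \<eta>]
          mink_commute[of u n] mink_commute[of v n] mink_commute[of \<eta> n])
    show "L ?w = y"
      unfolding L_def w by (simp add: vec_eq_iff forall_4 axis_def)
  qed
  then have inj: "inj L" using linear_surjective_imp_injective[OF lin] by simp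
  \<comment> \<open>\<open>L\<close> pairs a vector with a basis, so that \<open>?m\<close>, orthogonal to the whole basis, vanishes.\<close>
  let ?m = "m - (mink m n / mink n n) *\<^sub>R n"
  have "mink ?m u = 0" "mink ?m v = 0" "mink ?m \<eta> = 0" "mink ?m n = 0"
    using nn by (simp_all add: mink_simps n m)
  then have "L ?m = L 0" by (simp add: L_def mink_simps)
  then have "m = (mink m n / mink n n) *\<^sub>R n" using injD[OF inj] by fastforce
  then show ?thesis by (metis wedge_simps(6,11) scaleR_zero_right)
qed

text \<open>Translates between Euclidean and Minkowski normal vectors of a hyperplane.\<close>

definition time_reflection :: "real^4 \<Rightarrow> real^4" where
  "time_reflection v = (\<chi> i. if i = 1 then - v$1 else v$i)"

lemma mink_time_reflection: "mink (time_reflection u) v = u \<bullet> v"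
  by (simp add: mink_def time_reflection_def inner_vec_def sum_4)

lemma time_reflection_neq_0: "u \<noteq> 0 \<Longrightarrow> time_reflection u \<noteq> 0"
  by (auto simp: vec_eq_iff forall_4 time_reflection_def)

text \<open>Differentiating \<open>mink \<eta> (x b) = c\<close> twice shows that \<open>\<eta>\<close> is orthogonal to \<open>F1\<close>, \<open>F2\<close>, \<open>N11\<close>
  and \<open>N22\<close>.\<close>

lemma (in framed_patch) wedge_in_hyperplane:
  assumes a: "a \<in> U" and \<eta>: "\<eta> \<noteq> 0" and P: "\<And>b. b \<in> U \<Longrightarrow> mink \<eta> (x b) = c"
  shows "wedge (N11 a) (N22 a) = 0"
proof -
  have const: "mink \<eta> (ddir \<zeta> G b) = 0"
    if "b \<in> U" "smooth_on U G" "\<And>b. b \<in> U \<Longrightarrow> mink \<eta> (G b) = k" for G :: "real^2 \<Rightarrow> real^4" and b k \<zeta>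
  proof -
    have d: "G differentiable at b" by (rule smooth_on_differentiable[OF that(2) open_U that(1)])
    have "ddir \<zeta> (\<lambda>b. mink \<eta> (G b)) b = ddir \<zeta> (\<lambda>_. k) b"
      by (rule ddir_cong[OF open_U that(1,3) differentiable_bounded_bilinear[OF bounded_bilinear_mink _ d]]) simp_all
    then show ?thesis by (simp add: ddir_mink d mink_simps)
  qed
  have F: "mink \<eta> (F1 b) = 0" "mink \<eta> (F2 b) = 0" if "b \<in> U" for b
    using const[OF that smooth_x P] by auto
  have "mink \<eta> (N11 a) = 0" "mink \<eta> (N22 a) = 0"
    using const[OF a smooth_F(1) F(1)] const[OF a smooth_F(2) F(2)] F[OF a]
    by (simp_all add: sff_def normal_comp_def mink_simps)
  then show ?thesis
    using orthogonal_in_normal_plane_collinear[OF frame[OF a] \<eta> F[OF a], of "N11 a" "N22 a"]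
      mink_sff[OF a] by (simp add: mink_commute[of _ \<eta>])
qed

lemma type_i_null_values_collinear:
  assumes "type_i M"
  shows "\<forall>p\<in>M. null_values_collinear M p"
proof -
  obtain P where P: "lorentzian_surface M" "lorentzian_hyperplane P" "M \<subseteq> P"
    using assms by (auto simp: type_i_def)
  then have "aff_dim P = int (DIM(real^4)) - 1" "affine P" by (auto simp: lorentzian_hyperplane_def)
  then obtain c d where c: "c \<noteq> 0" "P = {q. c \<bullet> q = d}"
    using aff_dim_eq_hyperplane[of P] by (auto simp: hull_same)
  show ?thesis
  proof (rule null_values_collinearI[OF P(1)])
    fix U x \<xi>1 \<xi>2 a assume F: "framed_patch M U x \<xi>1 \<xi>2" "a \<in> U"
    interpret framed_patch M U x \<xi>1 \<xi>2 by (rule F(1))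
    show "wedge (N11 a) (N22 a) = 0"
      by (rule wedge_in_hyperplane[OF F(2) time_reflection_neq_0[OF c(1)], of d])
        (use P(3) c(2) image_subset in \<open>auto simp: mink_time_reflection\<close>)
  qed
qed

lemma (in framed_patch) relative_null_iff:
  assumes a: "a \<in> U"
  shows "\<alpha> *\<^sub>R F1 a + \<beta> *\<^sub>R F2 a \<in> relative_null_space M (x a) \<longleftrightarrow>
    \<alpha> *\<^sub>R N11 a + \<beta> *\<^sub>R N12 a = 0 \<and> \<alpha> *\<^sub>R N12 a + \<beta> *\<^sub>R N22 a = 0" (is "?L \<longleftrightarrow> ?R")
proof
  assume ?L
  then have "second_ff M (x a) (\<alpha> *\<^sub>R F1 a + \<beta> *\<^sub>R F2 a) (F1 a) = 0"
    "second_ff M (x a) (\<alpha> *\<^sub>R F1 a + \<beta> *\<^sub>R F2 a) (F2 a) = 0"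
    using tangent_combination[OF a] by (auto simp: relative_null_space_def)
  then show ?R
    using second_ff_eq[OF a, of \<alpha> \<beta> 1 0] second_ff_eq[OF a, of \<alpha> \<beta> 0 1] by (simp add: algebra_simps)
next
  assume R: ?R
  have "second_ff M (x a) (\<alpha> *\<^sub>R F1 a + \<beta> *\<^sub>R F2 a) Y = 0" if "Y \<in> tangent_space M (x a)" for Y
  proof -
    obtain \<gamma> \<delta> where Y: "Y = \<gamma> *\<^sub>R F1 a + \<delta> *\<^sub>R F2 a" using \<open>Y \<in> _\<close> tangent_iff[OF a] by auto
    have "second_ff M (x a) (\<alpha> *\<^sub>R F1 a + \<beta> *\<^sub>R F2 a) Y
      = \<gamma> *\<^sub>R (\<alpha> *\<^sub>R N11 a + \<beta> *\<^sub>R N12 a) + \<delta> *\<^sub>R (\<alpha> *\<^sub>R N12 a + \<beta> *\<^sub>R N22 a)"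
      unfolding Y second_ff_eq[OF a] by (simp add: algebra_simps)
    then show ?thesis using R by simp
  qed
  then show ?L using tangent_combination[OF a] by (simp add: relative_null_space_def)
qed

text \<open>A degenerate subspace contains a non-zero vector orthogonal to all of it, in particular a null
  vector; in a Lorentzian plane it is a multiple of \<open>F1\<close> or \<open>F2\<close>.\<close>

lemma (in framed_patch) degenerate_null_space:
  assumes a: "a \<in> U" and deg: "\<not> nondegenerate (relative_null_space M (x a))"
  shows "N12 a = 0" "N11 a = 0 \<or> N22 a = 0"
proof -
  obtain u where u: "u \<in> relative_null_space M (x a)" "u \<noteq> 0" "mink u u = 0"
    using deg by (auto simp: nondegenerate_def)
  then obtain \<alpha> \<beta> where u': "u = \<alpha> *\<^sub>R F1 a + \<beta> *\<^sub>R F2 a"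
    using tangent_iff[OF a] by (auto simp: relative_null_space_def)
  have "\<alpha> * \<beta> = 0" using u(3) unfolding u' by (simp add: mink_simps mink_F[OF a])
  then have "\<alpha> = 0 \<or> \<beta> = 0" by simp
  then show "N12 a = 0" "N11 a = 0 \<or> N22 a = 0"
    using u(1,2) unfolding u' relative_null_iff[OF a] by auto
qed

lemma type_ii_null_values_collinear:
  assumes "type_ii M"
  shows "minimal M" "\<forall>p\<in>M. null_values_collinear M p"
proof -
  have M: "lorentzian_surface M" and deg: "\<And>p. p \<in> M \<Longrightarrow> \<not> nondegenerate (relative_null_space M p)"
    using assms by (auto simp: type_ii_def degenerated_relative_null_bundle_def)
  show "minimal M"
    unfolding minimal_def
  proof
    fix p assume p: "p \<in> M"
    obtain U x \<xi>1 \<xi>2 a where U: "framed_patch M U x \<xi>1 \<xi>2" "a \<in> U" "x a = p"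
      using exists_framed_patch_at[OF M p] openin_subtopology_self by metis
    interpret framed_patch M U x \<xi>1 \<xi>2 by (rule U(1))
    show "mean_curvature M p = 0"
      using mean_curvature_eq[OF U(2)] degenerate_null_space(1)[OF U(2)] deg[OF p] U(3) by simp
  qed
  show "\<forall>p\<in>M. null_values_collinear M p"
  proof (rule null_values_collinearI[OF M])
    fix U x \<xi>1 \<xi>2 a assume F: "framed_patch M U x \<xi>1 \<xi>2" "a \<in> U"
    interpret framed_patch M U x \<xi>1 \<xi>2 by (rule F(1))
    have "x a \<in> M" using image_subset F(2) by auto
    then show "wedge (N11 a) (N22 a) = 0"
      using degenerate_null_space(2)[OF F(2)] deg by (auto simp: wedge_simps)
  qed
qed

section \<open>Parts of a surface\<close>

lemma framed_patch_openin_iff: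
  assumes "openin (top_of_set M) N"
  shows "framed_patch N U x \<xi>1 \<xi>2 \<longleftrightarrow> framed_patch M U x \<xi>1 \<xi>2 \<and> x ` U \<subseteq> N"
  using patch_openin_iff[OF assms]
  by (auto simp: framed_patch_def surface_patch_def)

lemma lorentzian_surface_openin:
  assumes M: "lorentzian_surface M" and N: "openin (top_of_set M) N" "connected N" "N \<noteq> {}"
  shows "lorentzian_surface N"
  using assms tangent_space_openin[OF N(1)] openin_imp_subset[OF N(1)]
  unfolding lorentzian_surface_def surface_def by (simp add: subset_iff)

lemma pointwise_data_openin:
  assumes M: "lorentzian_surface M" and N: "openin (top_of_set M) N" and p: "p \<in> N"
  shows "mean_curvature N p = mean_curvature M p"
    and "null_values_collinear N p = null_values_collinear M p"
    and "relative_null_space N p = relative_null_space M p"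
proof -
  obtain U x \<xi>1 \<xi>2 a where F: "framed_patch M U x \<xi>1 \<xi>2" "a \<in> U" "x a = p" "x ` U \<subseteq> N"
    using exists_framed_patch_at[OF M p N] .
  interpret M: framed_patch M U x \<xi>1 \<xi>2 by (rule F(1))
  interpret N: framed_patch N U x \<xi>1 \<xi>2 using F framed_patch_openin_iff[OF N] by blast
  show "mean_curvature N p = mean_curvature M p"
    using M.mean_curvature_eq[OF F(2)] N.mean_curvature_eq[OF F(2)] F(3) by simp
  show "null_values_collinear N p = null_values_collinear M p"
    using M.null_values_collinear_iff[OF F(2)] N.null_values_collinear_iff[OF F(2)] F(3) by simp
  have tan: "X \<in> tangent_space N p \<longleftrightarrow> X \<in> tangent_space M p" for X
    using M.tangent_iff[OF F(2)] N.tangent_iff[OF F(2)] F(3) by simp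
  have "X \<in> relative_null_space N p \<longleftrightarrow> X \<in> relative_null_space M p"
    if X: "X \<in> tangent_space M p" for X
  proof -
    obtain \<alpha> \<beta> where "X = \<alpha> *\<^sub>R M.F1 a + \<beta> *\<^sub>R M.F2 a" using X M.tangent_iff[OF F(2), of X] unfolding F(3) by blast
    then show ?thesis using M.relative_null_iff[OF F(2)] N.relative_null_iff[OF F(2)] F(3) by simp
  qed
  then show "relative_null_space N p = relative_null_space M p"
    using tan by (auto simp: relative_null_space_def)
qed

lemma connected_locally_constant:
  assumes "connected N" "p \<in> N" "q \<in> N"
    and "\<And>p. p \<in> N \<Longrightarrow> \<exists>W. openin (top_of_set N) W \<and> p \<in> W \<and> (\<forall>q\<in>W. f q = f p)"
  shows "f q = f p"
proof -
  have op: "openin (top_of_set N) {q \<in> N. P (f q)}" for P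
  proof (subst openin_subopen, intro ballI)
    fix q assume q: "q \<in> {q \<in> N. P (f q)}"
    then obtain W where W: "openin (top_of_set N) W" "q \<in> W" "\<forall>r\<in>W. f r = f q"
      using assms(4) by blast
    have "W \<subseteq> {q \<in> N. P (f q)}"
    proof
      fix r assume "r \<in> W"
      then show "r \<in> {q \<in> N. P (f q)}" using q W(3) openin_imp_subset[OF W(1)] by (simp add: subset_iff)
    qed
    then show "\<exists>W. openin (top_of_set N) W \<and> q \<in> W \<and> W \<subseteq> {q \<in> N. P (f q)}" using W by blast
  qed
  have "N - {q \<in> N. f q = f p} = {q \<in> N. f q \<noteq> f p}" by auto
  then have "closedin (top_of_set N) {q \<in> N. f q = f p}"
    using op[of "\<lambda>c. c \<noteq> f p"] by (auto simp: closedin_def)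
  then have "{q \<in> N. f q = f p} = {} \<or> {q \<in> N. f q = f p} = N"
    using assms(1) op[of "\<lambda>c. c = f p"] unfolding connected_clopen by blast
  then show ?thesis using assms(2,3) by blast
qed

section \<open>The relative nullity\<close>

lemma (in minimal_framed_patch) relative_null_space_eq:
  assumes a: "a \<in> U"
  shows "relative_null_space M (x a)
    = span ((if N11 a = 0 then {F1 a} else {}) \<union> (if N22 a = 0 then {F2 a} else {}))"
proof -
  have "X \<in> relative_null_space M (x a) \<longleftrightarrow>
      (\<exists>\<alpha> \<beta>. X = \<alpha> *\<^sub>R F1 a + \<beta> *\<^sub>R F2 a \<and> \<alpha> *\<^sub>R N11 a = 0 \<and> \<beta> *\<^sub>R N22 a = 0)" for X
  proof
    assume X: "X \<in> relative_null_space M (x a)"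
    then obtain \<alpha> \<beta> where "X = \<alpha> *\<^sub>R F1 a + \<beta> *\<^sub>R F2 a"
      using tangent_iff[OF a] by (auto simp: relative_null_space_def)
    with X show "\<exists>\<alpha> \<beta>. X = \<alpha> *\<^sub>R F1 a + \<beta> *\<^sub>R F2 a \<and> \<alpha> *\<^sub>R N11 a = 0 \<and> \<beta> *\<^sub>R N22 a = 0"
      using relative_null_iff[OF a, of \<alpha> \<beta>] N12_0[OF a] by auto
  qed (use relative_null_iff[OF a] N12_0[OF a] in auto)
  then have "relative_null_space M (x a)
      = {\<alpha> *\<^sub>R F1 a + \<beta> *\<^sub>R F2 a | \<alpha> \<beta>. \<alpha> *\<^sub>R N11 a = 0 \<and> \<beta> *\<^sub>R N22 a = 0}" by blast
  also have "\<dots> = {u + v | u v. u \<in> span (if N11 a = 0 then {F1 a} else {}) \<and> v \<in> span (if N22 a = 0 then {F2 a} else {})}"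
    by (cases "N11 a = 0"; cases "N22 a = 0") (auto simp: span_singleton)
  also have "\<dots> = span ((if N11 a = 0 then {F1 a} else {}) \<union> (if N22 a = 0 then {F2 a} else {}))"
    by (rule span_Un[symmetric])
  finally show ?thesis .
qed

lemma (in minimal_framed_patch) dim_relative_null_space:
  assumes a: "a \<in> U"
  shows "dim (relative_null_space M (x a)) = (if N11 a = 0 then 1 else 0) + (if N22 a = 0 then 1 else 0)"
proof -
  have ind: "\<alpha> = 0 \<and> \<beta> = 0" if "\<alpha> *\<^sub>R F1 a + \<beta> *\<^sub>R F2 a = 0" for \<alpha> \<beta>
  proof -
    have "mink (\<alpha> *\<^sub>R F1 a + \<beta> *\<^sub>R F2 a) (F1 a) = 0" "mink (\<alpha> *\<^sub>R F1 a + \<beta> *\<^sub>R F2 a) (F2 a) = 0"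
      unfolding that by (simp_all add: mink_simps)
    then show ?thesis by (simp add: mink_simps mink_F[OF a])
  qed
  have nz: "F1 a \<noteq> 0" "F2 a \<noteq> 0" using ind[of 1 0] ind[of 0 1] by auto
  have "F2 a \<notin> span {F1 a}"
  proof
    assume "F2 a \<in> span {F1 a}"
    then obtain k where "F2 a = k *\<^sub>R F1 a" by (auto simp: span_singleton)
    then show False using ind[of k "-1"] by simp
  qed
  then have "dim {F1 a, F2 a} = 2"
    using nz by (subst insert_commute) (simp add: dim_insert)
  then have "dim {F2 a, F1 a} = 2" by (simp only: insert_commute)
  then show ?thesis
    unfolding relative_null_space_eq[OF a] using nz by (cases "N11 a = 0"; cases "N22 a = 0") simp_all
qed

lemma openin_nullity_regular: "openin (top_of_set M) (nullity_regular M)"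
proof (subst openin_subopen, intro ballI)
  fix p assume "p \<in> nullity_regular M"
  then obtain W where W: "openin (top_of_set M) W" "p \<in> W"
    "\<forall>q\<in>W. dim (relative_null_space M q) = dim (relative_null_space M p)"
    by (auto simp: nullity_regular_def)
  have "q \<in> nullity_regular M" if q: "q \<in> W" for q
  proof -
    have "\<forall>r\<in>W. dim (relative_null_space M r) = dim (relative_null_space M q)" using W(3) q by simp
    moreover have "q \<in> M" using q openin_imp_subset[OF W(1)] by blast
    ultimately show ?thesis using W(1) q unfolding nullity_regular_def by blast
  qed
  then have "W \<subseteq> nullity_regular M" by blast
  then show "\<exists>W. openin (top_of_set M) W \<and> p \<in> W \<and> W \<subseteq> nullity_regular M" using W by blast
qed

text \<open>A non-zero \<open>N11\<close> or \<open>N22\<close> stays non-zero nearby, so the dimension of the relative null space cannot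
  jump up. Where it is least among the points of an open set, it is therefore locally constant.\<close>

lemma nullity_regular_dense:
  assumes M: "lorentzian_surface M" "minimal M"
  shows "M \<subseteq> closure (nullity_regular M)"
proof
  fix p assume p: "p \<in> M"
  show "p \<in> closure (nullity_regular M)"
    unfolding closure_iff_nhds_not_empty
  proof (intro allI impI)
    fix A S :: "(real^4) set" assume S: "S \<subseteq> A" "open S" "p \<in> S"
    let ?d = "\<lambda>q. dim (relative_null_space M q)"
    have W0: "openin (top_of_set M) (M \<inter> S)" using S(2) by (simp add: openin_open_Int)
    obtain q where q: "q \<in> M \<inter> S" "\<And>q'. q' \<in> M \<inter> S \<Longrightarrow> ?d q \<le> ?d q'"
      using ex_has_least_nat[of "\<lambda>q. q \<in> M \<inter> S" p ?d] p S(3) by blast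
    obtain U x \<xi>1 \<xi>2 a where F: "framed_patch M U x \<xi>1 \<xi>2" "a \<in> U" "x a = q" "x ` U \<subseteq> M \<inter> S"
      using exists_framed_patch_at[OF M(1) q(1) W0] .
    interpret minimal_framed_patch M U x \<xi>1 \<xi>2 by (rule minimal_framed_patchI[OF M(2) F(1)])
    define V where "V G = (if G a = 0 then U else U \<inter> G -` (- {0}))" for G :: "real^2 \<Rightarrow> real^4"
    have V: "open (V G)" "a \<in> V G" if "smooth_on U G" for G
      using continuous_open_preimage[OF smooth_on_imp_continuous_on[OF that] open_U, of "- {0}"] open_U F(2)
      by (auto simp: V_def)
    define U' where "U' = V N11 \<inter> V N22"
    have U': "open U'" "a \<in> U'" "U' \<subseteq> U"
      using V[OF smooth_sff[OF smooth_xi(1,1)]] V[OF smooth_sff[OF smooth_xi(2,2)]]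
      by (auto simp: U'_def V_def split: if_splits)
    interpret sub: surface_patch M U' x by unfold_locales (rule patch_subset[OF patch U'(3,1)])
    have "?d (x b) = ?d q" if b: "b \<in> U'" for b
    proof (rule antisym)
      have bU: "b \<in> U" using b U' by auto
      have "N11 a \<noteq> 0 \<Longrightarrow> N11 b \<noteq> 0" "N22 a \<noteq> 0 \<Longrightarrow> N22 b \<noteq> 0"
        using b by (auto simp: U'_def V_def)
      then show "?d (x b) \<le> ?d q"
        using dim_relative_null_space[OF bU] dim_relative_null_space[OF F(2)] F(3) by auto
      show "?d q \<le> ?d (x b)" using q(2) F(4) bU by blast
    qed
    then have "q \<in> nullity_regular M"
      using q(1) sub.image_openin U'(2) F(3) unfolding nullity_regular_def by blast
    then show "nullity_regular M \<inter> A \<noteq> {}" using q(1) S(1) by blast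
  qed
qed

text \<open>Images of coordinate discs are connected, so a component contains a neighbourhood of each of its
  points.\<close>

lemma openin_component:
  assumes M: "surface M" and R: "openin (top_of_set M) R" and N: "N \<in> components R"
  shows "openin (top_of_set M) N"
proof (subst openin_subopen, intro ballI)
  fix p assume p: "p \<in> N"
  then have pR: "p \<in> R" using in_components_subset[OF N] by blast
  then have "p \<in> M" using openin_imp_subset[OF R] by blast
  then obtain V x where "patch M V x" "p \<in> x ` V" using M unfolding surface_def by blast
  then obtain a where x: "patch M V x" "a \<in> V" "x a = p" by blast
  have "open {a \<in> V. x a \<in> R}" by (rule patch_preimage_open[OF x(1) R])
  then obtain e where e: "e > 0" "ball a e \<subseteq> {a \<in> V. x a \<in> R}"
    using x pR by (force elim: openE)
  interpret surface_patch M "ball a e" x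
    by unfold_locales (rule patch_subset[OF x(1)], use e in auto)
  have "connected (x ` ball a e)"
    by (intro connected_continuous_image smooth_on_imp_continuous_on smooth_x) simp
  then have "x ` ball a e \<subseteq> N"
    using components_maximal[OF N, of "x ` ball a e"] e p x(3) by (force simp: image_subset_iff)
  then show "\<exists>W. openin (top_of_set M) W \<and> p \<in> W \<and> W \<subseteq> N"
    using image_openin e(1) x(3) by (intro exI[of _ "x ` ball a e"]) auto
qed

section \<open>Surfaces of constant relative nullity\<close>

lemma continuous_bound_on_ball:
  fixes S :: "('a::euclidean_space \<Rightarrow> real) set"
  assumes "open U" "a \<in> U" "finite S" "\<And>f. f \<in> S \<Longrightarrow> continuous_on U f"
  obtains r K where "r > 0" "ball a r \<subseteq> U" "K \<ge> 1" "\<And>f b. f \<in> S \<Longrightarrow> b \<in> ball a r \<Longrightarrow> \<bar>f b\<bar> \<le> K"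
proof -
  define q where "q b = (\<Sum>f\<in>S. \<bar>f b\<bar>)" for b
  obtain r where r: "r > 0" "cball a r \<subseteq> U" using assms(1,2) open_contains_cball by blast
  have "continuous_on U q"
    unfolding q_def by (intro continuous_on_sum continuous_on_rabs assms(4))
  then have "compact (q ` cball a r)"
    by (rule compact_continuous_image[OF continuous_on_subset[OF _ r(2)] compact_cball])
  then obtain K where K: "\<And>y. y \<in> q ` cball a r \<Longrightarrow> \<bar>y\<bar> \<le> K"
    using compact_imp_bounded bounded_real by metis
  show ?thesis
  proof (rule that[of r "max 1 K"])
    fix f b assume f: "f \<in> S" and b: "b \<in> ball a r"
    have "\<bar>f b\<bar> \<le> q b" unfolding q_def by (rule member_le_sum[OF f _ assms(3)]) simp
    also have "\<dots> \<le> K" using K[of "q b"] b by force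
    finally show "\<bar>f b\<bar> \<le> max 1 K" by simp
  qed (use r ball_subset_cball in \<open>auto intro: order_trans\<close>)
qed

lemma norm_le_4:
  fixes v :: "real^4"
  assumes "\<bar>v$1\<bar> \<le> c" "\<bar>v$2\<bar> \<le> c" "\<bar>v$3\<bar> \<le> c" "\<bar>v$4\<bar> \<le> c"
  shows "norm v \<le> 4 * c"
  using norm_le_l1_cart[of v] assms by (simp add: sum_4)

text \<open>Under the hypotheses on \<open>\<rho>\<close>, \<open>\<sigma>\<close>, \<open>\<tau>\<close> and by the Codazzi equation, the derivatives of \<open>F1\<close>, \<open>F2\<close>
  and \<open>N11\<close> are combinations of these three vectors. So the four functions
  \<open>mink \<eta> x - c\<close>, \<open>mink \<eta> F1\<close>, \<open>mink \<eta> F2\<close>, \<open>mink \<eta> N11\<close> satisfy a homogeneous linear system of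
  first order, and vanish near \<open>a\<close> if they vanish at \<open>a\<close>.\<close>

lemma (in minimal_framed_patch) constant_normal_propagates:
  assumes a: "a \<in> U"
    and cont: "continuous_on U \<rho>" "continuous_on U \<sigma>" "continuous_on U \<tau>"
    and N22: "\<And>b. b \<in> U \<Longrightarrow> N22 b = \<rho> b *\<^sub>R N11 b"
    and dN11: "\<And>b. b \<in> U \<Longrightarrow> ddir \<xi>1 N11 b = \<sigma> b *\<^sub>R N11 b + \<tau> b *\<^sub>R F2 b"
    and \<eta>: "mink \<eta> (x a) = c" "mink \<eta> (F1 a) = 0" "mink \<eta> (F2 a) = 0" "mink \<eta> (N11 a) = 0"
  obtains U' where "open U'" "a \<in> U'" "U' \<subseteq> U"
    "\<And>b. b \<in> U' \<Longrightarrow> mink \<eta> (x b) = c \<and> mink \<eta> (F1 b) = 0 \<and> mink \<eta> (F2 b) = 0 \<and> mink \<eta> (N11 b) = 0"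
proof -
  define G :: "real^2 \<Rightarrow> real^4" where
    "G b = (mink \<eta> (x b) - c) *\<^sub>R axis 1 1 + mink \<eta> (F1 b) *\<^sub>R axis 2 1
      + mink \<eta> (F2 b) *\<^sub>R axis 3 1 + mink \<eta> (N11 b) *\<^sub>R axis 4 1" for b
  have G: "G b $ 1 = mink \<eta> (x b) - c" "G b $ 2 = mink \<eta> (F1 b)"
    "G b $ 3 = mink \<eta> (F2 b)" "G b $ 4 = mink \<eta> (N11 b)" for b
    by (simp_all add: G_def axis_def)
  have sN: "smooth_on U N11" by (rule smooth_sff[OF smooth_xi(1,1)])
  have sG: "smooth_on U G"
    unfolding G_def[abs_def]
    by (intro smooth_on_add smooth_on_scaleR smooth_on_diff smooth_on_mink smooth_on_const
        open_U smooth_x smooth_F sN)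
  have dG: "ddir \<zeta> G b $ i = ddir \<zeta> (\<lambda>b. G b $ i) b" if "b \<in> U" for \<zeta> b i
    by (rule ddir_bounded_linear[OF bounded_linear_vec_nth smooth_on_differentiable[OF sG open_U that], symmetric])
  have dmink: "ddir \<zeta> (\<lambda>b. mink \<eta> (H b)) b = mink \<eta> (ddir \<zeta> H b)" if "b \<in> U" "smooth_on U H" for \<zeta> H b
    using smooth_on_differentiable[OF that(2) open_U that(1)] by (simp add: ddir_mink mink_simps)
  have dmink': "ddir \<zeta> (\<lambda>b. mink \<eta> (x b) - c) b = mink \<eta> (ddir \<zeta> x b)" if "b \<in> U" for \<zeta> b
    using ddir_add[OF smooth_on_differentiable[OF smooth_on_mink[OF open_U smooth_on_const smooth_x] open_U that],
        of "\<lambda>_. - c" \<zeta> \<eta>] dmink[OF that smooth_x] by simp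
  have comps: "ddir \<zeta> G b $ 1 = mink \<eta> (ddir \<zeta> x b)" "ddir \<zeta> G b $ 2 = mink \<eta> (ddir \<zeta> F1 b)"
    "ddir \<zeta> G b $ 3 = mink \<eta> (ddir \<zeta> F2 b)" "ddir \<zeta> G b $ 4 = mink \<eta> (ddir \<zeta> N11 b)"
    if "b \<in> U" for \<zeta> b
    unfolding dG[OF that] using that
    by (simp_all add: G dmink dmink' smooth_F sN)
  \<comment> \<open>These express the coordinate directions by the frame; with them, bounds on the derivatives
    along \<open>\<xi>1\<close> and \<open>\<xi>2\<close> become bounds on the whole derivative.\<close>
  define m where "m k F b = mink (\<D> x b (axis k 1)) (F b)"
    for k :: 2 and F :: "real^2 \<Rightarrow> real^4" and b
  have cm: "continuous_on U (m k F)" if "smooth_on U F" for k F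
    unfolding m_def
    by (intro smooth_on_imp_continuous_on smooth_on_mink smooth_on_ddir_const open_U smooth_x that)
  define S where "S = {\<phi> \<xi>1, \<phi> \<xi>2, \<rho>, \<sigma>, \<tau>, \<kappa>, m 1 F1, m 2 F1, m 1 F2, m 2 F2}"
  note scont = smooth_on_imp_continuous_on
  have "continuous_on U f" if "f \<in> S" for f
    using that cont cm[OF smooth_F(1)] cm[OF smooth_F(2)] scont[OF smooth_conn[OF smooth_xi(1)]]
      scont[OF smooth_conn[OF smooth_xi(2)]]
      scont[OF smooth_on_mink[OF open_U smooth_sff[OF smooth_xi(1,1)] smooth_sff[OF smooth_xi(2,2)]]]
    unfolding S_def by blast
  moreover have "finite S" by (simp add: S_def)
  ultimately obtain r K where r: "r > 0" "ball a r \<subseteq> U" and K1: "K \<ge> 1"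
    and SK: "\<And>f b. f \<in> S \<Longrightarrow> b \<in> ball a r \<Longrightarrow> \<bar>f b\<bar> \<le> K"
    using continuous_bound_on_ball[OF open_U a, of S] by metis
  have bound: "norm (\<D> G b v) \<le> (48 * K * K) * norm v * norm (G b)"
    if b: "b \<in> ball a r" for b v
  proof -
    have bU: "b \<in> U" using b r by auto
    have K: "1 \<le> K" "\<bar>\<phi> \<xi>1 b\<bar> \<le> K" "\<bar>\<phi> \<xi>2 b\<bar> \<le> K" "\<bar>\<rho> b\<bar> \<le> K" "\<bar>\<sigma> b\<bar> \<le> K" "\<bar>\<tau> b\<bar> \<le> K"
      "\<bar>\<kappa> b\<bar> \<le> K" "\<bar>m 1 F1 b\<bar> \<le> K" "\<bar>m 2 F1 b\<bar> \<le> K" "\<bar>m 1 F2 b\<bar> \<le> K" "\<bar>m 2 F2 b\<bar> \<le> K"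
      using SK[OF _ b] SK[of \<kappa>, OF _ b] K1 unfolding S_def by simp_all
    let ?n = "norm (G b)"
    have g: "\<bar>mink \<eta> (F1 b)\<bar> \<le> ?n" "\<bar>mink \<eta> (F2 b)\<bar> \<le> ?n" "\<bar>mink \<eta> (N11 b)\<bar> \<le> ?n"
      using component_le_norm_cart[of "G b" 2] component_le_norm_cart[of "G b" 3]
        component_le_norm_cart[of "G b" 4] by (simp_all add: G)
    have one: "\<bar>s * y\<bar> \<le> K * ?n" if "\<bar>s\<bar> \<le> K" "\<bar>y\<bar> \<le> ?n" for s y
      unfolding abs_mult by (rule mult_mono[OF that]) (use K(1) in auto)
    have two: "\<bar>s * y + t * z\<bar> \<le> 3 * K * ?n" if "\<bar>s * y\<bar> \<le> 2 * (K * ?n)" "\<bar>t * z\<bar> \<le> K * ?n" for s t y z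
      using that by linarith
    have n1: "?n \<le> K * ?n" "0 \<le> K * ?n" using K(1) mult_right_mono[of 1 K ?n] by auto
    have D1: "norm (ddir \<xi>1 G b) \<le> 4 * (3 * K * ?n)"
    proof (rule norm_le_4; unfold comps[OF bU])
      show "\<bar>mink \<eta> (F1 b)\<bar> \<le> 3 * K * ?n" using g(1) n1 by linarith
      show "\<bar>mink \<eta> (ddir \<xi>1 F1 b)\<bar> \<le> 3 * K * ?n"
        using one[OF K(2) g(1)] g(3) n1 unfolding frame_derivatives[OF bU] mink_simps by linarith
      show "\<bar>mink \<eta> (ddir \<xi>1 F2 b)\<bar> \<le> 3 * K * ?n"
        using one[OF K(2) g(2)] n1 unfolding frame_derivatives[OF bU] mink_simps by linarith
      show "\<bar>mink \<eta> (ddir \<xi>1 N11 b)\<bar> \<le> 3 * K * ?n"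
        using one[OF K(5) g(3)] one[OF K(6) g(2)] n1 unfolding dN11[OF bU] mink_simps by linarith
    qed
    have D2: "norm (ddir \<xi>2 G b) \<le> 4 * (3 * K * ?n)"
    proof (rule norm_le_4; unfold comps[OF bU])
      show "\<bar>mink \<eta> (F2 b)\<bar> \<le> 3 * K * ?n" using g(2) n1 by linarith
      show "\<bar>mink \<eta> (ddir \<xi>2 F1 b)\<bar> \<le> 3 * K * ?n"
        using one[OF K(3) g(1)] n1 unfolding frame_derivatives[OF bU] mink_simps by linarith
      show "\<bar>mink \<eta> (ddir \<xi>2 F2 b)\<bar> \<le> 3 * K * ?n"
        using one[OF K(3) g(2)] one[OF K(4) g(3)] n1
        unfolding frame_derivatives[OF bU] N22[OF bU] mink_simps by linarith
      show "\<bar>mink \<eta> (ddir \<xi>2 N11 b)\<bar> \<le> 3 * K * ?n"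
        using one[OF K(3) g(3)] one[OF K(7) g(1)] n1
        unfolding codazzi[OF bU] mink_simps mult.assoc[of 2 "\<phi> \<xi>2 b"] by linarith
    qed
    have coord: "\<bar>mink (\<D> x b v) (F b)\<bar> \<le> 2 * K * norm v"
      if "\<bar>m 1 F b\<bar> \<le> K" "\<bar>m 2 F b\<bar> \<le> K" for F
    proof -
      have "v = v$1 *\<^sub>R axis 1 1 + v$2 *\<^sub>R axis 2 1"
        by (simp add: vec_eq_iff forall_2 axis_def)
      then have "\<D> x b v
          = \<D> x b (v$1 *\<^sub>R axis 1 1 + v$2 *\<^sub>R axis 2 1)" by (rule arg_cong)
      then have "mink (\<D> x b v) (F b) = v$1 * m 1 F b + v$2 * m 2 F b"
        by (simp add: linear_add[OF linear_dx[OF bU]] linear_scale[OF linear_dx[OF bU]] m_def mink_simps)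
      moreover have "\<bar>v$1 * m 1 F b\<bar> \<le> norm v * K" "\<bar>v$2 * m 2 F b\<bar> \<le> norm v * K"
        unfolding abs_mult by (intro mult_mono component_le_norm_cart that; simp)+
      ultimately show ?thesis by (simp add: algebra_simps)
    qed
    define \<alpha> where "\<alpha> = - mink (\<D> x b v) (F2 b)"
    define \<beta> where "\<beta> = - mink (\<D> x b v) (F1 b)"
    have \<alpha>\<beta>: "\<bar>\<alpha>\<bar> \<le> 2 * K * norm v" "\<bar>\<beta>\<bar> \<le> 2 * K * norm v"
      using coord[of F2] coord[of F1] K by (simp_all add: \<alpha>_def \<beta>_def)
    have "v = \<alpha> *\<^sub>R \<xi>1 b + \<beta> *\<^sub>R \<xi>2 b" unfolding \<alpha>_def \<beta>_def by (rule coordinates[OF bU])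
    then have "\<D> G b v = \<alpha> *\<^sub>R ddir \<xi>1 G b + \<beta> *\<^sub>R ddir \<xi>2 G b"
      using linear_frechet_derivative[OF smooth_on_differentiable[OF sG open_U bU]]
      by (simp add: ddir_def linear_add linear_scale)
    then have "norm (\<D> G b v) \<le> \<bar>\<alpha>\<bar> * norm (ddir \<xi>1 G b) + \<bar>\<beta>\<bar> * norm (ddir \<xi>2 G b)"
      using norm_triangle_ineq[of "\<alpha> *\<^sub>R ddir \<xi>1 G b" "\<beta> *\<^sub>R ddir \<xi>2 G b"] by simp
    also have "\<dots> \<le> (2 * K * norm v) * (4 * (3 * K * ?n)) + (2 * K * norm v) * (4 * (3 * K * ?n))"
      by (intro add_mono mult_mono \<alpha>\<beta> D1 D2) (use K(1) in auto)
    finally show ?thesis by (simp add: algebra_simps)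
  qed
  have "G a = 0" using \<eta> by (simp add: G_def)
  have "G b = 0" if "b \<in> ball a r" for b
    by (rule zero_of_linear_derivative_bound[OF convex_ball _ _ \<open>G a = 0\<close> that bound])
      (use r smooth_on_differentiable[OF sG open_U] in auto)
  then have "mink \<eta> (x b) - c = 0 \<and> mink \<eta> (F1 b) = 0 \<and> mink \<eta> (F2 b) = 0 \<and> mink \<eta> (N11 b) = 0"
    if "b \<in> ball a r" for b
    using that G[of b] by (metis zero_index)
  then show ?thesis using that[of "ball a r"] r by auto
qed

text \<open>The hyperplane \<open>{q. mink \<eta> q = c}\<close> passes through \<open>p\<close>, and the tangent plane and the values of the
  second fundamental form at \<open>p\<close> are parallel to it.\<close>

definition flat_at :: "(real^4) set \<Rightarrow> real^4 \<Rightarrow> real \<Rightarrow> real^4 \<Rightarrow> bool" where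
  "flat_at N \<eta> c p \<longleftrightarrow> mink \<eta> p = c \<and> (\<forall>X\<in>tangent_space N p. mink \<eta> X = 0) \<and>
     (\<forall>X\<in>tangent_space N p. \<forall>Y\<in>tangent_space N p. mink \<eta> (second_ff N p X Y) = 0)"

lemma (in minimal_framed_patch) flat_at_iff:
  assumes a: "a \<in> U"
  shows "flat_at M \<eta> c (x a) \<longleftrightarrow> mink \<eta> (x a) = c \<and> mink \<eta> (F1 a) = 0 \<and> mink \<eta> (F2 a) = 0 \<and>
    mink \<eta> (N11 a) = 0 \<and> mink \<eta> (N22 a) = 0" (is "_ \<longleftrightarrow> ?R")
proof
  show "flat_at M \<eta> c (x a) \<Longrightarrow> ?R"
    using tangent_combination(2,3)[OF a] second_ff_F[OF a] unfolding flat_at_def by metis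
  assume R: ?R
  have "mink \<eta> X = 0" if "X \<in> tangent_space M (x a)" for X
    using that R unfolding tangent_iff[OF a] by (auto simp: mink_simps)
  moreover have "mink \<eta> (second_ff M (x a) X Y) = 0"
    if XY: "X \<in> tangent_space M (x a)" "Y \<in> tangent_space M (x a)" for X Y
  proof -
    obtain \<alpha>1 \<alpha>2 \<beta>1 \<beta>2 where "X = \<alpha>1 *\<^sub>R F1 a + \<alpha>2 *\<^sub>R F2 a" "Y = \<beta>1 *\<^sub>R F1 a + \<beta>2 *\<^sub>R F2 a"
      using XY unfolding tangent_iff[OF a] by blast
    then show ?thesis using R N12_0[OF a] by (simp add: second_ff_eq[OF a] mink_simps)
  qed
  ultimately show "flat_at M \<eta> c (x a)" using R by (simp add: flat_at_def)
qed

text \<open>The hypotheses of \<open>constant_normal_propagates\<close>: together with the Codazzi equation, they say that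
  the span of \<open>F1\<close>, \<open>F2\<close>, \<open>N11\<close> contains \<open>N22\<close> and is closed under differentiation.\<close>

definition closed_frame where
  "closed_frame M U x \<xi>1 \<xi>2 \<rho> \<sigma> \<tau> \<longleftrightarrow> minimal_framed_patch M U x \<xi>1 \<xi>2 \<and>
     continuous_on U \<rho> \<and> continuous_on U \<sigma> \<and> continuous_on U \<tau> \<and>
     (\<forall>b\<in>U. sff x \<xi>1 \<xi>2 \<xi>2 \<xi>2 b = \<rho> b *\<^sub>R sff x \<xi>1 \<xi>2 \<xi>1 \<xi>1 b) \<and>
     (\<forall>b\<in>U. ddir \<xi>1 (sff x \<xi>1 \<xi>2 \<xi>1 \<xi>1) b
        = \<sigma> b *\<^sub>R sff x \<xi>1 \<xi>2 \<xi>1 \<xi>1 b + \<tau> b *\<^sub>R ddir \<xi>2 x b)"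

lemma (in minimal_framed_patch) closed_frame_totally_geodesic:
  assumes "\<And>b. b \<in> U \<Longrightarrow> N11 b = 0" "\<And>b. b \<in> U \<Longrightarrow> N22 b = 0"
  shows "closed_frame M U x \<xi>1 \<xi>2 (\<lambda>_. 0) (\<lambda>_. 0) (\<lambda>_. 0)"
proof -
  have "ddir \<xi>1 N11 b = 0" if b: "b \<in> U" for b
    using ddir_cong[OF open_U b assms(1) diffs(3)[OF b], of \<xi>1] by simp
  then show ?thesis
    using assms minimal_framed_patch_axioms by (simp add: closed_frame_def)
qed

text \<open>The Codazzi equation gives the derivative of \<open>N11\<close> along \<open>\<xi>2\<close> and that of \<open>N22\<close> along \<open>\<xi>1\<close>. The
  missing derivative of \<open>N11\<close> along \<open>\<xi>1\<close> results from the latter, as \<open>N22 = \<rho> N11\<close> with a factor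
  that has no zeros.\<close>

lemma (in minimal_framed_patch) closed_frame_nonvanishing:
  assumes nz: "\<And>b. b \<in> U \<Longrightarrow> N11 b \<noteq> 0" "\<And>b. b \<in> U \<Longrightarrow> N22 b \<noteq> 0"
    and par: "\<And>b. b \<in> U \<Longrightarrow> wedge (N11 b) (N22 b) = 0"
  obtains \<rho> \<sigma> \<tau> where "closed_frame M U x \<xi>1 \<xi>2 \<rho> \<sigma> \<tau>"
proof -
  have sN: "smooth_on U N11" "smooth_on U N22"
    using smooth_sff[OF smooth_xi(1,1)] smooth_sff[OF smooth_xi(2,2)] by auto
  define \<rho> where "\<rho> b = (N22 b \<bullet> N11 b) * inverse (N11 b \<bullet> N11 b)" for b
  have \<rho>: "N22 b = \<rho> b *\<^sub>R N11 b" if "b \<in> U" for b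
    using wedge_eq_0D[OF par[OF that] nz(1)[OF that]] by (simp add: \<rho>_def divide_inverse)
  have \<rho>0: "\<rho> b \<noteq> 0" if "b \<in> U" for b using \<rho>[OF that] nz(2)[OF that] by auto
  have s\<rho>: "smooth_on U \<rho>"
    unfolding \<rho>_def
    by (rule smooth_on_mult[OF open_U smooth_on_inner[OF open_U sN(2,1)]
          smooth_on_inverse[OF open_U _ smooth_on_inner[OF open_U sN(1,1)]]]) (use nz(1) in simp)
  have s\<rho>': "smooth_on U (\<lambda>b. inverse (\<rho> b))" by (rule smooth_on_inverse[OF open_U \<rho>0 s\<rho>])
  define \<sigma> where "\<sigma> b = - 2 * \<phi> \<xi>1 b + - 1 * (ddir \<xi>1 \<rho> b * inverse (\<rho> b))" for b
  define \<tau> where "\<tau> b = \<kappa> b * inverse (\<rho> b)" for b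
  have s\<sigma>: "smooth_on U \<sigma>"
    unfolding \<sigma>_def
    by (intro smooth_on_add[OF open_U] smooth_on_mult[OF open_U] smooth_on_const smooth_conn[OF smooth_xi(1)]
        smooth_on_ddir[OF open_U smooth_xi(1) s\<rho>] s\<rho>')
  have s\<tau>: "smooth_on U \<tau>"
    unfolding \<tau>_def by (rule smooth_on_mult[OF open_U smooth_on_mink[OF open_U sN] s\<rho>'])
  have "ddir \<xi>1 N11 b = \<sigma> b *\<^sub>R N11 b + \<tau> b *\<^sub>R F2 b" if b: "b \<in> U" for b
  proof -
    have "(- 2 * \<phi> \<xi>1 b) *\<^sub>R N22 b + \<kappa> b *\<^sub>R F2 b = ddir \<xi>1 N22 b"
      by (rule codazzi_swapped[OF b, symmetric])
    also have "\<dots> = ddir \<xi>1 (\<lambda>b. \<rho> b *\<^sub>R N11 b) b"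
      by (rule ddir_cong[OF open_U b \<rho> diffs(4)[OF b]])
    also have "\<dots> = \<rho> b *\<^sub>R ddir \<xi>1 N11 b + ddir \<xi>1 \<rho> b *\<^sub>R N11 b"
      by (rule ddir_scaleR[OF smooth_on_differentiable[OF s\<rho> open_U b] diffs(3)[OF b]])
    finally have "\<rho> b *\<^sub>R ddir \<xi>1 N11 b
        = (- 2 * \<phi> \<xi>1 b) *\<^sub>R (\<rho> b *\<^sub>R N11 b) + \<kappa> b *\<^sub>R F2 b - ddir \<xi>1 \<rho> b *\<^sub>R N11 b"
      unfolding \<rho>[OF b] by (simp only: eq_diff_eq)
    then have "inverse (\<rho> b) *\<^sub>R (\<rho> b *\<^sub>R ddir \<xi>1 N11 b)
        = inverse (\<rho> b) *\<^sub>R ((- 2 * \<phi> \<xi>1 b) *\<^sub>R (\<rho> b *\<^sub>R N11 b) + \<kappa> b *\<^sub>R F2 b - ddir \<xi>1 \<rho> b *\<^sub>R N11 b)"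
      by (rule arg_cong)
    then show ?thesis
      using \<rho>0[OF b] by (simp add: \<sigma>_def \<tau>_def scaleR_add_right scaleR_diff_right scaleR_diff_left mult_ac)
  qed
  then have "closed_frame M U x \<xi>1 \<xi>2 \<rho> \<sigma> \<tau>"
    using \<rho> s\<rho> s\<sigma> s\<tau> minimal_framed_patch_axioms
    by (simp add: closed_frame_def smooth_on_imp_continuous_on)
  then show ?thesis using that by blast
qed

lemma lorentzian_hyperplane_level_set:
  assumes \<eta>: "\<eta> \<noteq> 0" and p: "mink \<eta> p = c" and t: "mink \<eta> t = 0" "mink t t < 0"
  shows "lorentzian_hyperplane {q. mink \<eta> q = c}"
proof -
  have e: "{q. mink \<eta> q = c} = {q. time_reflection \<eta> \<bullet> q = c}"
    by (simp add: mink_def time_reflection_def inner_vec_def sum_4)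
  have "{u - v | u v. u \<in> {q. mink \<eta> q = c} \<and> v \<in> {q. mink \<eta> q = c}} = {w. mink \<eta> w = 0}"
  proof (intro set_eqI iffI)
    fix w assume "w \<in> {w. mink \<eta> w = 0}"
    then have "w = (p + w) - p" "mink \<eta> (p + w) = c" using p by (simp_all add: mink_simps)
    then show "w \<in> {u - v | u v. u \<in> {q. mink \<eta> q = c} \<and> v \<in> {q. mink \<eta> q = c}}" using p by blast
  qed (auto simp: mink_simps)
  moreover have "lorentzian_space {w. mink \<eta> w = 0}"
    by (rule lorentzian_spaceI[of _ t]) (use t in \<open>auto simp: subspace_def mink_simps\<close>)
  ultimately show ?thesis
    unfolding lorentzian_hyperplane_def e using time_reflection_neq_0[OF \<eta>]
    by (simp add: affine_hyperplane)
qed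

text \<open>For dimension reasons some \<open>\<eta> \<noteq> 0\<close> is orthogonal to \<open>F1\<close>, \<open>F2\<close> and \<open>N11\<close> at one point. The points at
  which the level hyperplane of \<open>\<eta>\<close> is tangent in the sense of \<open>flat_at\<close> form a set that is open
  by \<open>constant_normal_propagates\<close> and closed by continuity, hence all of \<open>N\<close>.\<close>

lemma lies_in_hyperplane:
  assumes N: "lorentzian_surface N"
    and cl: "\<And>p. p \<in> N \<Longrightarrow> \<exists>U x \<xi>1 \<xi>2 a \<rho> \<sigma> \<tau>. closed_frame N U x \<xi>1 \<xi>2 \<rho> \<sigma> \<tau> \<and> a \<in> U \<and> x a = p"
  shows "\<exists>P. lorentzian_hyperplane P \<and> N \<subseteq> P"
proof -
  obtain p where p: "p \<in> N" using N by (auto simp: lorentzian_surface_def surface_def)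
  obtain \<eta> t where \<eta>: "\<eta> \<noteq> 0" and flat: "flat_at N \<eta> (mink \<eta> p) p" and t: "mink \<eta> t = 0" "mink t t < 0"
  proof -
    obtain U x \<xi>1 \<xi>2 a \<rho> \<sigma> \<tau> where c: "closed_frame N U x \<xi>1 \<xi>2 \<rho> \<sigma> \<tau>" "a \<in> U" "x a = p"
      using cl[OF p] by blast
    interpret minimal_framed_patch N U x \<xi>1 \<xi>2 using c(1) by (simp add: closed_frame_def)
    have "dim {F1 a, F2 a, N11 a} < DIM(real^4)"
      using dim_le_card'[of "{F1 a, F2 a, N11 a}"] card_insert_le_m1[of 3 "{F2 a, N11 a}" "F1 a"]
        card_insert_le_m1[of 2 "{N11 a}" "F2 a"] by simp
    then obtain \<eta>0 where \<eta>0: "\<eta>0 \<noteq> 0" "\<And>w. w \<in> span {F1 a, F2 a, N11 a} \<Longrightarrow> orthogonal \<eta>0 w"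
      using orthogonal_to_subspace_exists by blast
    define \<eta> where "\<eta> = time_reflection \<eta>0"
    have \<eta>: "\<eta> \<noteq> 0" "mink \<eta> (F1 a) = 0" "mink \<eta> (F2 a) = 0" "mink \<eta> (N11 a) = 0"
      using \<eta>0 time_reflection_neq_0[OF \<eta>0(1)]
      by (simp_all add: \<eta>_def mink_time_reflection span_base orthogonal_def)
    have "N22 a = \<rho> a *\<^sub>R N11 a" using c(1,2) by (simp add: closed_frame_def)
    then have flat_p: "flat_at N \<eta> (mink \<eta> p) p"
      using flat_at_iff[OF c(2), of \<eta> "mink \<eta> p"] \<eta> c(3) by (simp add: mink_simps)
    show thesis
      by (rule that[OF \<eta>(1) flat_p, of "F1 a + F2 a"]) (simp_all add: mink_simps \<eta> mink_F[OF c(2)])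
  qed
  define k where "k = mink \<eta> p"
  have flat_p: "flat_at N \<eta> k p" using flat by (simp add: k_def)
  have "flat_at N \<eta> k q = flat_at N \<eta> k p" if q: "q \<in> N" for q
  proof (rule connected_locally_constant[OF _ p q])
    show "connected N" using N by (simp add: lorentzian_surface_def surface_def)
    fix q assume q: "q \<in> N"
    obtain U x \<xi>1 \<xi>2 a \<rho> \<sigma> \<tau> where c: "closed_frame N U x \<xi>1 \<xi>2 \<rho> \<sigma> \<tau>" "a \<in> U" "x a = q"
      using cl[OF q] by blast
    interpret minimal_framed_patch N U x \<xi>1 \<xi>2 using c(1) by (simp add: closed_frame_def)
    have N22: "N22 b = \<rho> b *\<^sub>R N11 b" if "b \<in> U" for b using c(1) that by (simp add: closed_frame_def)
    have iff: "flat_at N \<eta> k (x b) \<longleftrightarrow> mink \<eta> (x b) = k \<and> mink \<eta> (F1 b) = 0 \<and> mink \<eta> (F2 b) = 0 \<and> mink \<eta> (N11 b) = 0"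
      if "b \<in> U" for b
      using flat_at_iff[OF that, of \<eta> k] N22[OF that] by (auto simp: mink_simps)
    have "\<exists>U'. open U' \<and> a \<in> U' \<and> U' \<subseteq> U \<and> (\<forall>b\<in>U'. flat_at N \<eta> k (x b) = flat_at N \<eta> k (x a))"
    proof (cases "flat_at N \<eta> k (x a)")
      case True
      then have z: "mink \<eta> (x a) = k" "mink \<eta> (F1 a) = 0" "mink \<eta> (F2 a) = 0" "mink \<eta> (N11 a) = 0"
        using iff[OF c(2)] by auto
      have cont: "continuous_on U \<rho>" "continuous_on U \<sigma>" "continuous_on U \<tau>"
        and d: "\<And>b. b \<in> U \<Longrightarrow> ddir \<xi>1 N11 b = \<sigma> b *\<^sub>R N11 b + \<tau> b *\<^sub>R F2 b"
        using c(1) by (auto simp: closed_frame_def)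
      obtain U' where "open U'" "a \<in> U'" "U' \<subseteq> U"
        "\<And>b. b \<in> U' \<Longrightarrow> mink \<eta> (x b) = k \<and> mink \<eta> (F1 b) = 0 \<and> mink \<eta> (F2 b) = 0 \<and> mink \<eta> (N11 b) = 0"
        using constant_normal_propagates[OF c(2) cont N22 d z] by metis
      then show ?thesis using True iff by blast
    next
      case False
      have "\<exists>U'. open U' \<and> a \<in> U' \<and> U' \<subseteq> U \<and> (\<forall>b\<in>U'. g b \<noteq> e)"
        if "continuous_on U g" "g a \<noteq> e" for g :: "real^2 \<Rightarrow> real" and e
        using continuous_open_preimage[OF that(1) open_U, of "- {e}"] that(2) c(2)
        by (intro exI[of _ "U \<inter> g -` (- {e})"]) auto
      note away = this[OF smooth_on_imp_continuous_on[OF smooth_on_mink[OF open_U smooth_on_const]]]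
      have "mink \<eta> (x a) \<noteq> k \<or> mink \<eta> (F1 a) \<noteq> 0 \<or> mink \<eta> (F2 a) \<noteq> 0 \<or> mink \<eta> (N11 a) \<noteq> 0"
        using False iff[OF c(2)] by blast
      then have "\<exists>U'. open U' \<and> a \<in> U' \<and> U' \<subseteq> U \<and> (\<forall>b\<in>U'. \<not> (mink \<eta> (x b) = k \<and>
          mink \<eta> (F1 b) = 0 \<and> mink \<eta> (F2 b) = 0 \<and> mink \<eta> (N11 b) = 0))"
      proof (elim disjE)
        assume "mink \<eta> (x a) \<noteq> k"
        from away[OF smooth_x this] show ?thesis by blast
      next
        assume "mink \<eta> (F1 a) \<noteq> 0"
        from away[OF smooth_F(1) this] show ?thesis by blast
      next
        assume "mink \<eta> (F2 a) \<noteq> 0"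
        from away[OF smooth_F(2) this] show ?thesis by blast
      next
        assume "mink \<eta> (N11 a) \<noteq> 0"
        from away[OF smooth_sff[OF smooth_xi(1,1)] this] show ?thesis by blast
      qed
      then obtain U' where U': "open U'" "a \<in> U'" "U' \<subseteq> U" and ne: "\<forall>b\<in>U'. \<not> (mink \<eta> (x b) = k \<and>
          mink \<eta> (F1 b) = 0 \<and> mink \<eta> (F2 b) = 0 \<and> mink \<eta> (N11 b) = 0)" by blast
      have "\<forall>b\<in>U'. \<not> flat_at N \<eta> k (x b)"
      proof
        fix b assume b: "b \<in> U'"
        then have "b \<in> U" using U'(3) by blast
        then show "\<not> flat_at N \<eta> k (x b)" using iff ne b by simp
      qed
      then show ?thesis using False U' by blast
    qed
    then obtain U' where U': "open U'" "a \<in> U'" "U' \<subseteq> U"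
      "\<forall>b\<in>U'. flat_at N \<eta> k (x b) = flat_at N \<eta> k (x a)" by blast
    interpret sub: surface_patch N U' x by unfold_locales (rule patch_subset[OF patch U'(3,1)])
    show "\<exists>W. openin (top_of_set N) W \<and> q \<in> W \<and> (\<forall>r\<in>W. flat_at N \<eta> k r = flat_at N \<eta> k q)"
      using sub.image_openin U'(2,4) c(3) by (intro exI[of _ "x ` U'"]) auto
  qed
  then have "N \<subseteq> {q. mink \<eta> q = k}" using flat_p by (auto simp: flat_at_def)
  moreover have "lorentzian_hyperplane {q. mink \<eta> q = k}"
    by (rule lorentzian_hyperplane_level_set[OF \<eta> k_def[symmetric] t])
  ultimately show ?thesis by blast
qed

text \<open>If exactly one of \<open>N11\<close>, \<open>N22\<close> vanishes, then the relative null space is the null line of the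
  corresponding frame vector. If none or both vanish, then \<open>closed_frame\<close> holds near each point.\<close>

lemma constant_nullity_classification:
  assumes N: "lorentzian_surface N" "minimal N" and par: "\<forall>p\<in>N. null_values_collinear N p"
    and k: "\<And>p. p \<in> N \<Longrightarrow> dim (relative_null_space N p) = k"
  shows "type_i N \<or> type_ii N"
proof -
  have frames: "\<exists>U x \<xi>1 \<xi>2 a. minimal_framed_patch N U x \<xi>1 \<xi>2 \<and> a \<in> U \<and> x a = p" if "p \<in> N" for p
    using exists_framed_patch_at[OF N(1) that openin_subtopology_self] minimal_framed_patchI[OF N(2)] by metis
  show ?thesis
  proof (cases "k = 1")
    case True
    have "\<not> nondegenerate (relative_null_space N p)" if p: "p \<in> N" for p
    proof -
      obtain U x \<xi>1 \<xi>2 a where F: "minimal_framed_patch N U x \<xi>1 \<xi>2" "a \<in> U" "x a = p"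
        using frames[OF p] by blast
      interpret minimal_framed_patch N U x \<xi>1 \<xi>2 by (rule F(1))
      have "relative_null_space N p = span {F1 a} \<or> relative_null_space N p = span {F2 a}"
      proof -
        have "(if N11 a = 0 then 1 else 0) + (if N22 a = 0 then 1 else 0) = (1::nat)"
          using dim_relative_null_space[OF F(2)] k[OF p] True F(3) by simp
        then consider "N11 a = 0" "N22 a \<noteq> 0" | "N11 a \<noteq> 0" "N22 a = 0"
          by (cases "N11 a = 0"; cases "N22 a = 0") auto
        then show ?thesis
          using relative_null_space_eq[OF F(2)] F(3) by cases simp_all
      qed
      moreover have "\<not> nondegenerate (span {f})" if f: "f \<noteq> 0" "mink f f = 0" for f
        unfolding nondegenerate_def using f
        by (auto intro!: bexI[of _ f] simp: span_base span_singleton mink_simps)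
      moreover have "F1 a \<noteq> 0" "F2 a \<noteq> 0" using mink_F(3)[OF F(2)] by (auto simp: mink_simps)
      ultimately show ?thesis using mink_F[OF F(2)] by metis
    qed
    then show ?thesis using N(1) by (simp add: type_ii_def degenerated_relative_null_bundle_def)
  next
    case False
    have "\<exists>U x \<xi>1 \<xi>2 a \<rho> \<sigma> \<tau>. closed_frame N U x \<xi>1 \<xi>2 \<rho> \<sigma> \<tau> \<and> a \<in> U \<and> x a = p" if p: "p \<in> N" for p
    proof -
      obtain U x \<xi>1 \<xi>2 a where F: "minimal_framed_patch N U x \<xi>1 \<xi>2" "a \<in> U" "x a = p"
        using frames[OF p] by blast
      interpret minimal_framed_patch N U x \<xi>1 \<xi>2 by (rule F(1))
      have xN: "x b \<in> N" if "b \<in> U" for b using image_subset that by auto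
      have d: "(if N11 b = 0 then 1 else 0) + (if N22 b = 0 then 1 else 0) = k" if "b \<in> U" for b
        using dim_relative_null_space[OF that] k[OF xN[OF that]] by simp
      consider "k = 0" | "k = 2" using d[OF F(2)] False by (auto split: if_splits)
      then show ?thesis
      proof cases
        case 1
        have nz: "N11 b \<noteq> 0" "N22 b \<noteq> 0" if "b \<in> U" for b using d[OF that] 1 by (auto split: if_splits)
        have w: "wedge (N11 b) (N22 b) = 0" if "b \<in> U" for b
          using null_values_collinear_iff[OF that] par xN[OF that] by blast
        obtain \<rho> \<sigma> \<tau> where "closed_frame N U x \<xi>1 \<xi>2 \<rho> \<sigma> \<tau>"
          using closed_frame_nonvanishing[OF nz w] .
        then show ?thesis using F by blast
      next
        case 2
        have "N11 b = 0" "N22 b = 0" if "b \<in> U" for b using d[OF that] 2 by (auto split: if_splits)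
        then show ?thesis using closed_frame_totally_geodesic F by blast
      qed
    qed
    then show ?thesis using lies_in_hyperplane[OF N(1)] N by (simp add: type_i_def)
  qed
qed

lemma congruent_to_open_portion_refl: "congruent_to_open_portion S S"
  unfolding congruent_to_open_portion_def mink_isometry_def
  by (intro exI[of _ "\<lambda>x. x"] conjI exI[of _ "0"]) (auto intro!: exI[of _ "\<lambda>x. x"] linear_id[unfolded id_def])

lemma component_classification:
  assumes M: "lorentzian_surface M" "minimal M" and par: "\<forall>p\<in>M. null_values_collinear M p"
    and N: "N \<in> components (nullity_regular M)"
  shows "type_i N \<or> type_ii N"
proof -
  let ?d = "\<lambda>q. dim (relative_null_space M q)"
  have op: "openin (top_of_set M) N"
    using openin_component[OF _ openin_nullity_regular N] M(1) by (simp add: lorentzian_surface_def)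
  have NM: "N \<subseteq> M" by (rule openin_imp_subset[OF op])
  have conn: "connected N" "N \<noteq> {}" using N in_components_connected in_components_nonempty by blast+
  have L: "lorentzian_surface N" by (rule lorentzian_surface_openin[OF M(1) op conn])
  obtain p where p: "p \<in> N" using conn(2) by blast
  have "?d q = ?d p" if q: "q \<in> N" for q
  proof (rule connected_locally_constant[OF conn(1) p q])
    fix q assume q: "q \<in> N"
    then obtain W where W: "openin (top_of_set M) W" "q \<in> W" "\<forall>r\<in>W. ?d r = ?d q"
      using in_components_subset[OF N] by (auto simp: nullity_regular_def)
    have "openin (top_of_set N) (N \<inter> W)"
    proof -
      obtain O' where O': "open O'" "W = M \<inter> O'" using W(1) by (auto simp: openin_open)
      then have "N \<inter> W = N \<inter> O'" using NM by blast
      then show ?thesis using O'(1) by (simp add: openin_open_Int)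
    qed
    then show "\<exists>W. openin (top_of_set N) W \<and> q \<in> W \<and> (\<forall>r\<in>W. ?d r = ?d q)" using W q by blast
  qed
  then have "dim (relative_null_space N q) = ?d p" if "q \<in> N" for q
    using pointwise_data_openin(3)[OF M(1) op that] that by simp
  moreover have "minimal N" using M(2) pointwise_data_openin(1)[OF M(1) op] NM by (auto simp: minimal_def)
  moreover have "\<forall>p\<in>N. null_values_collinear N p" using par pointwise_data_openin(2)[OF M(1) op] NM by auto
  ultimately show ?thesis using constant_nullity_classification[OF L] by blast
qed

theorem proposition3p2:
  shows "(\<forall>M \<A>. orientation M \<A> \<and> (type_i M \<or> type_ii M) \<longrightarrow>
            lorentzian_surface M \<and> minimal M \<and> pointwise_one_type M \<A> \<and> first_kind M \<A>) \<and>
         (\<forall>M \<A>. orientation M \<A> \<and> lorentzian_surface M \<and> minimal M \<and>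
                 pointwise_one_type M \<A> \<and> first_kind M \<A> \<longrightarrow>
            (nullity_regular M = M \<longrightarrow>
               (\<exists>S. (type_i S \<or> type_ii S) \<and> congruent_to_open_portion M S)) \<and>
            openin (top_of_set M) (nullity_regular M) \<and> M \<subseteq> closure (nullity_regular M) \<and>
            (\<forall>N\<in>components (nullity_regular M).
               \<exists>S. (type_i S \<or> type_ii S) \<and> congruent_to_open_portion N S))"
proof (intro conjI allI impI)
  fix M \<A> assume "orientation M \<A> \<and> (type_i M \<or> type_ii M)"
  then have A: "orientation M \<A>" and t: "type_i M \<or> type_ii M" by auto
  show L: "lorentzian_surface M" using t by (auto simp: type_i_def type_ii_def)
  show m: "minimal M" using t type_ii_null_values_collinear(1) by (auto simp: type_i_def)
  show "first_kind M \<A>"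
    using first_kind_iff[OF A L m] t type_i_null_values_collinear type_ii_null_values_collinear(2) by blast
  then show "pointwise_one_type M \<A>" by (rule first_kind_imp_pointwise_one_type)
next
  fix M \<A> assume "orientation M \<A> \<and> lorentzian_surface M \<and> minimal M \<and>
                 pointwise_one_type M \<A> \<and> first_kind M \<A>"
  then have M: "lorentzian_surface M" "minimal M" and par: "\<forall>p\<in>M. null_values_collinear M p"
    using first_kind_iff by blast+
  have cls: "\<exists>S. (type_i S \<or> type_ii S) \<and> congruent_to_open_portion N S"
    if "N \<in> components (nullity_regular M)" for N
    using component_classification[OF M par that] congruent_to_open_portion_refl by blast
  then show "\<forall>N\<in>components (nullity_regular M).
      \<exists>S. (type_i S \<or> type_ii S) \<and> congruent_to_open_portion N S" by blast
  show "openin (top_of_set M) (nullity_regular M)" by (rule openin_nullity_regular)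
  show "M \<subseteq> closure (nullity_regular M)" by (rule nullity_regular_dense[OF M])
  assume "nullity_regular M = M"
  moreover have "connected M" "M \<noteq> {}" using M(1) by (auto simp: lorentzian_surface_def surface_def)
  ultimately have "M \<in> components (nullity_regular M)"
    by (simp add: in_components_self)
  then show "\<exists>S. (type_i S \<or> type_ii S) \<and> congruent_to_open_portion M S" by (rule cls)
qed

end
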